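(* Let $X$ be a connected finite CW-complex with $\pi_1(X)=G$ and $\dim H^1(X;\mathbb{R})>0$, and let $q\ge1$. For any representation $\sigma\colon G\to \mathrm{GL}_r(\mathbb{Z})$, $$\Sigma^q(X;\mathbb{Z}) \subseteq \mathrm{S}\bigl(\mathrm{Trop}_{\mathbb{Z}}\bigl(\mathcal{J}_{\le q}(X,L_{\sigma})\bigr)\bigr)^{\mathrm{c}},$$ where the complement is taken in the character sphere $\mathrm{S}(G)$.
   Context: Let $H=G_{\mathrm{ab}}$ be the abelianization of $G$, with $\mathrm{ab}\colon G\to H$, so $\mathrm{Hom}(H,\mathbb{R})=\mathrm{Hom}(G,\mathbb{R})\cong H^1(X;\mathbb{R})$. Let $\widetilde X$ be the universal cover, and regard $C_*(\widetilde X;\mathbb{Z})$ as a complex of free right $\mathbb{Z}G$-modules via $c\cdot g=g^{-1}c$ (deck transformation action). For a left $\mathbb{Z}G$-module $M$, $H_i(X;M)=H_i(C_*(\widetilde X;\mathbb{Z})\otimes_{\mathbb{Z}G}M)$. Twisted homology jump ideals: let $G$ act on $\mathbb{Z}[H]\otimes\mathbb{Z}^r$ by $g\cdot(u\otimes v)=(\mathrm{ab}(g)u)\otimes(\sigma(g)v)$, and consider the complex of finitely generated free $\mathbb{Z}[H]$-modules $C_*(\widetilde X;\mathbb{Z})\otimes_{\mathbb{Z}G}(\mathbb{Z}[H]\otimes\mathbb{Z}^r)$ with differentials $\partial^\sigma_i$ (and $\partial^\sigma_0=0$). With $c_i$ the number of $i$-cells of $X$, $\mathcal{J}_i(X,L_\sigma)\subseteq\mathbb{Z}[H]$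 is the ideal generated by the minors of size $r c_i$ of the block matrix $\partial^\sigma_{i+1}\oplus\partial^\sigma_i$. Put $\mathcal{J}_{\le q}(X,L_\sigma)=\bigcap_{0\le i\le q}\mathcal{J}_i(X,L_\sigma)$. Tropical variety over $\mathbb{Z}$: for $\chi\in\mathrm{Hom}(H,\mathbb{R})$ and $0\ne f=\sum_{h}a_hh\in\mathbb{Z}[H]$, the initial form $\mathrm{in}_\chi(f)$ is the sum of the terms $a_hh$ with $a_h\ne0$ for which $\chi(h)$ attains its minimum over $\{h \mid a_h\neq 0\}$. For an ideal $I$, $\mathrm{in}_\chi(I)$ is the ideal generated by $\mathrm{in}_\chi(f)$, $0\ne f\in I$, and $\mathrm{Trop}_{\mathbb{Z}}(I)=\{\chi\in\mathrm{Hom}(H,\mathbb{R})\mid \mathrm{in}_\chi(I)\ne\mathbb{Z}[H]\}$. Character sphere: $\mathrm{S}(G)=(\mathrm{Hom}(G,\mathbb{R})\setminus\{0\})/\mathbb{R}^{+}$; for $V\subseteq\mathrm{Hom}(G,\mathbb{R})$, $\mathrm{S}(V)$ is the image of $V\setminus\{0\}$ in $\mathrm{S}(G)$. BNSR invariants: for nonzero $\chi\colon G\to\mathbb{R}$, let $G_\chi=\{g\in G\mid\chi(g)\ge0\}$. A chain complex $C$ of $R$-modules is of finite $q$-type over $R$ if there is a chain complex $C'$ of finitely generated projective $R$-modules and a chain map $C'\to C$ inducing isomorphisms on $H_i$ for $i<q$ and an epimorphism on $H_q$. $\Sigma^q(X;\mathbb{Z})$ is the set of $\chi\in\mathrm{S}(G)$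 such that $C_*(\widetilde X;\mathbb{Z})$ is of finite $q$-type as a complex of right $\mathbb{Z}G_\chi$-modules. Equivalently (Farber–Geoghegan–Schütz), $\chi\in\Sigma^q(X;\mathbb{Z})$ iff $H_i(X;\widehat{\mathbb{Z}G}_{-\chi})=0$ for all $i\le q$, where $\widehat{\mathbb{Z}G}_{-\chi}$ is the ring of formal sums $\sum n_g g$ with $n_g\in\mathbb{Z}$ such that $\{g\mid n_g\ne0,\ \chi(g)\le c\}$ is finite for every $c\in\mathbb{R}$. *)

theory Defs
  imports
    "HOL-Homology.Homology"
    "HOL-Algebra.Generated_Groups"
    "HOL-Library.Poly_Mapping"
    "Jordan_Normal_Form.Determinant"
    "Jordan_Normal_Form.DL_Submatrix"
begin

text \<open>
  The groups \<open>G\<close> and \<open>H\<close> are types of class \<open>group_add\<close> and \<open>ab_group_add\<close>, hence written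
  additively, and their integral group rings are the rings \<open>'g \<Rightarrow>\<^sub>0 int\<close> and \<open>'h \<Rightarrow>\<^sub>0 int\<close> of
  finitely supported functions under convolution.
\<close>

definition disc :: "nat \<Rightarrow> (nat \<Rightarrow> real) topology" where
  "disc n = subtopology (Euclidean_space n) {x. (\<Sum>i<n. (x i)\<^sup>2) \<le> 1}"

definition open_disc :: "nat \<Rightarrow> (nat \<Rightarrow> real) set" where
  "open_disc n = {x \<in> topspace (Euclidean_space n). (\<Sum>i<n. (x i)\<^sup>2) < 1}"

definition sphere_bd :: "nat \<Rightarrow> (nat \<Rightarrow> real) set" where
  "sphere_bd n = {x \<in> topspace (Euclidean_space n). (\<Sum>i<n. (x i)\<^sup>2) = 1}"

text \<open>\<open>K n\<close> is the set of open \<open>n\<close>-cells.  The index is an integer so that the \<open>(-1)\<close>-skeleton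
  exists (and is empty).\<close>

definition skeleton :: "(nat \<Rightarrow> 'a set set) \<Rightarrow> int \<Rightarrow> 'a set" where
  "skeleton K k = \<Union>{e. \<exists>n. int n \<le> k \<and> e \<in> K n}"

definition characteristic_map ::
  "'a::topological_space set \<Rightarrow> (nat \<Rightarrow> 'a set set) \<Rightarrow> nat \<Rightarrow> 'a set \<Rightarrow> ((nat \<Rightarrow> real) \<Rightarrow> 'a) \<Rightarrow> bool" where
  "characteristic_map X K n e \<Phi> \<longleftrightarrow>
     continuous_map (disc n) (top_of_set X) \<Phi> \<and>
     homeomorphic_map (subtopology (Euclidean_space n) (open_disc n)) (top_of_set e) \<Phi> \<and>
     \<Phi> ` sphere_bd n \<subseteq> skeleton K (int n - 1)"

text \<open>As there are only finitely many cells, closure finiteness and the weak topology are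
  automatic.\<close>

definition finite_CW_complex :: "'a::topological_space set \<Rightarrow> (nat \<Rightarrow> 'a set set) \<Rightarrow> bool" where
  "finite_CW_complex X K \<longleftrightarrow>
     Hausdorff_space (top_of_set X) \<and>
     finite (Sigma UNIV K) \<and>
     disjoint_family_on snd (Sigma UNIV K) \<and>
     (\<Union>n. \<Union>(K n)) = X \<and>
     (\<forall>n. \<forall>e\<in>K n. \<exists>\<Phi>. characteristic_map X K n e \<Phi>)"

text \<open>\<open>H\<^sup>1(X; \<real>) \<noteq> 0\<close> in singular cohomology: there is a real 1-cocycle that is not a coboundary.\<close>

definition real_cochains :: "nat \<Rightarrow> 'a topology \<Rightarrow> ('a chain \<Rightarrow> real) set" where
  "real_cochains n X =
     {z. \<forall>c c'. singular_chain n X c \<longrightarrow> singular_chain n X c' \<longrightarrow> z (c + c') = z c + z c'}"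

definition H1_nonzero :: "'a topology \<Rightarrow> bool" where
  "H1_nonzero X \<longleftrightarrow>
     (\<exists>z \<in> real_cochains 1 X.
        (\<forall>c. singular_chain 2 X c \<longrightarrow> z (chain_boundary 2 c) = 0) \<and>
        \<not> (\<exists>f \<in> real_cochains 0 X. \<forall>c. singular_chain 1 X c \<longrightarrow> z c = f (chain_boundary 1 c)))"

definition loops :: "'a::topological_space set \<Rightarrow> 'a \<Rightarrow> (real \<Rightarrow> 'a) set" where
  "loops X x0 = {\<gamma>. path \<gamma> \<and> path_image \<gamma> \<subseteq> X \<and> pathstart \<gamma> = x0 \<and> pathfinish \<gamma> = x0}"

definition loop_class :: "'a::topological_space set \<Rightarrow> 'a \<Rightarrow> (real \<Rightarrow> 'a) \<Rightarrow> (real \<Rightarrow> 'a) set" where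
  "loop_class X x0 \<gamma> = {\<delta> \<in> loops X x0. homotopic_paths X \<gamma> \<delta>}"

definition fundamental_group :: "'a::topological_space set \<Rightarrow> 'a \<Rightarrow> (real \<Rightarrow> 'a) set monoid" where
  "fundamental_group X x0 =
     \<lparr>carrier = loop_class X x0 ` loops X x0,
      monoid.mult = (\<lambda>A B. {\<eta> \<in> loops X x0. \<exists>\<gamma>\<in>A. \<exists>\<delta>\<in>B. homotopic_paths X (\<gamma> +++ \<delta>) \<eta>}),
      one = loop_class X x0 (\<lambda>_. x0)\<rparr>"

definition type_group :: "'g::group_add monoid" where
  "type_group = \<lparr>carrier = UNIV, monoid.mult = (+), one = 0\<rparr>"

definition abelianization :: "('g::group_add \<Rightarrow> 'h::ab_group_add) \<Rightarrow> bool" where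
  "abelianization ab \<longleftrightarrow>
     ab \<in> epi type_group type_group \<and>
     kernel type_group type_group ab = derived type_group UNIV"

definition universal_cover ::
  "'b::topological_space set \<Rightarrow> ('b \<Rightarrow> 'a::topological_space) \<Rightarrow> 'a set \<Rightarrow> bool" where
  "universal_cover E p X \<longleftrightarrow> covering_space E p X \<and> simply_connected E"

text \<open>
  \<open>\<phi>\<close> identifies \<open>\<pi>\<^sub>1(X, p y0)\<close> with \<open>G\<close>.  The element of \<open>G\<close> given by a loop acts on the
  universal cover \<open>E\<close> by the deck transformation that moves the base point \<open>y0\<close> to the endpoint
  of the lift of that loop starting at \<open>y0\<close>.  This is a left action and determines \<open>act\<close> on \<open>E\<close>.
\<close>

definition deck_action ::
  "'a::topological_space set \<Rightarrow> 'b::topological_space set \<Rightarrow> ('b \<Rightarrow> 'a) \<Rightarrow> 'b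
     \<Rightarrow> ((real \<Rightarrow> 'a) set \<Rightarrow> 'g) \<Rightarrow> ('g \<Rightarrow> 'b \<Rightarrow> 'b) \<Rightarrow> bool" where
  "deck_action X E p y0 \<phi> act \<longleftrightarrow>
     (\<forall>g. homeomorphic_map (top_of_set E) (top_of_set E) (act g) \<and> (\<forall>y\<in>E. p (act g y) = p y)) \<and>
     (\<forall>\<gamma>. path \<gamma> \<and> path_image \<gamma> \<subseteq> E \<and> pathstart \<gamma> = y0 \<and> p (pathfinish \<gamma>) = p y0 \<longrightarrow>
        act (\<phi> (loop_class X (p y0) (p \<circ> \<gamma>))) y0 = pathfinish \<gamma>)"

text \<open>Abelian groups are multiplicative records, as in the homology library.\<close>

record ('m, 'r) rmodule = "'m monoid" +
  rscale :: "'m \<Rightarrow> 'r \<Rightarrow> 'm"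

definition right_module :: "'r::ring_1 set \<Rightarrow> ('m, 'r) rmodule \<Rightarrow> bool" where
  "right_module R M \<longleftrightarrow>
     comm_group M \<and>
     (\<forall>x\<in>carrier M. \<forall>a\<in>R. rscale M x a \<in> carrier M) \<and>
     (\<forall>x\<in>carrier M. \<forall>y\<in>carrier M. \<forall>a\<in>R.
        rscale M (x \<otimes>\<^bsub>M\<^esub> y) a = rscale M x a \<otimes>\<^bsub>M\<^esub> rscale M y a) \<and>
     (\<forall>x\<in>carrier M. \<forall>a\<in>R. \<forall>b\<in>R. rscale M x (a + b) = rscale M x a \<otimes>\<^bsub>M\<^esub> rscale M x b) \<and>
     (\<forall>x\<in>carrier M. \<forall>a\<in>R. \<forall>b\<in>R. rscale M x (a * b) = rscale M (rscale M x a) b) \<and>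
     (\<forall>x\<in>carrier M. rscale M x 1 = x)"

definition rmod_hom :: "'r set \<Rightarrow> ('m, 'r) rmodule \<Rightarrow> ('n, 'r) rmodule \<Rightarrow> ('m \<Rightarrow> 'n) set" where
  "rmod_hom R M N =
     {f \<in> hom M N. \<forall>x\<in>carrier M. \<forall>a\<in>R. f (rscale M x a) = rscale N (f x) a}"

definition free_rmodule :: "'r::ring_1 set \<Rightarrow> nat \<Rightarrow> (nat \<Rightarrow> 'r, 'r) rmodule" where
  "free_rmodule R k =
     \<lparr>carrier = {v. (\<forall>j<k. v j \<in> R) \<and> (\<forall>j\<ge>k. v j = 0)},
      monoid.mult = (\<lambda>v w j. v j + w j), one = (\<lambda>_. 0), rscale = (\<lambda>v a j. v j * a)\<rparr>"

definition fg_projective :: "'r::ring_1 set \<Rightarrow> ('m, 'r) rmodule \<Rightarrow> bool" where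
  "fg_projective R M \<longleftrightarrow>
     right_module R M \<and>
     (\<exists>k. \<exists>i \<in> rmod_hom R M (free_rmodule R k). \<exists>s \<in> rmod_hom R (free_rmodule R k) M.
        \<forall>x\<in>carrier M. s (i x) = x)"

definition rmodule_basis :: "'r::ring_1 set \<Rightarrow> ('m, 'r) rmodule \<Rightarrow> nat \<Rightarrow> (nat \<Rightarrow> 'm) \<Rightarrow> bool" where
  "rmodule_basis R M k b \<longleftrightarrow>
     (\<forall>j<k. b j \<in> carrier M) \<and>
     (\<forall>x\<in>carrier M. \<exists>!v. v \<in> carrier (free_rmodule R k) \<and>
        x = finprod M (\<lambda>j. rscale M (b j) (v j)) {..<k})"

definition coordinates :: "'r::ring_1 set \<Rightarrow> ('m, 'r) rmodule \<Rightarrow> nat \<Rightarrow> (nat \<Rightarrow> 'm) \<Rightarrow> 'm \<Rightarrow> nat \<Rightarrow> 'r" where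
  "coordinates R M k b x = (THE v. v \<in> carrier (free_rmodule R k) \<and>
        x = finprod M (\<lambda>j. rscale M (b j) (v j)) {..<k})"

text \<open>
  Complexes are indexed by the naturals, with \<open>d n : M n \<rightarrow> M (n - 1)\<close>; in degree \<open>0\<close> this reads
  \<open>d 0 : M 0 \<rightarrow> M 0\<close>, which is required to be the zero map.
\<close>

definition rmod_complex :: "'r::ring_1 set \<Rightarrow> (nat \<Rightarrow> ('m, 'r) rmodule) \<Rightarrow> (nat \<Rightarrow> 'm \<Rightarrow> 'm) \<Rightarrow> bool" where
  "rmod_complex R M d \<longleftrightarrow>
     (\<forall>n. right_module R (M n)) \<and>
     (\<forall>n. d n \<in> rmod_hom R (M n) (M (n - 1))) \<and>
     (\<forall>x\<in>carrier (M 0). d 0 x = \<one>\<^bsub>M 0\<^esub>) \<and>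
     (\<forall>n. \<forall>x\<in>carrier (M (Suc n)). d n (d (Suc n) x) = \<one>\<^bsub>M (n - 1)\<^esub>)"

definition chain_map :: "'r set \<Rightarrow> (nat \<Rightarrow> ('m, 'r) rmodule) \<Rightarrow> (nat \<Rightarrow> 'm \<Rightarrow> 'm) \<Rightarrow>
    (nat \<Rightarrow> ('n, 'r) rmodule) \<Rightarrow> (nat \<Rightarrow> 'n \<Rightarrow> 'n) \<Rightarrow> (nat \<Rightarrow> 'm \<Rightarrow> 'n) \<Rightarrow> bool" where
  "chain_map R M d N d' f \<longleftrightarrow>
     (\<forall>n. f n \<in> rmod_hom R (M n) (N n)) \<and>
     (\<forall>n. \<forall>x\<in>carrier (M (Suc n)). f n (d (Suc n) x) = d' (Suc n) (f (Suc n) x))"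

definition cycles :: "(nat \<Rightarrow> ('m, 'r) rmodule) \<Rightarrow> (nat \<Rightarrow> 'm \<Rightarrow> 'm) \<Rightarrow> nat \<Rightarrow> 'm set" where
  "cycles M d i = kernel (M i) (M (i - 1)) (d i)"

definition boundaries :: "(nat \<Rightarrow> ('m, 'r) rmodule) \<Rightarrow> (nat \<Rightarrow> 'm \<Rightarrow> 'm) \<Rightarrow> nat \<Rightarrow> 'm set" where
  "boundaries M d i = d (Suc i) ` carrier (M (Suc i))"

definition complex_homology :: "(nat \<Rightarrow> ('m, 'r) rmodule) \<Rightarrow> (nat \<Rightarrow> 'm \<Rightarrow> 'm) \<Rightarrow> nat \<Rightarrow> 'm set monoid" where
  "complex_homology M d i = (M i)\<lparr>carrier := cycles M d i\<rparr> Mod boundaries M d i"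

text \<open>The coset of a cycle \<open>z\<close> is sent to the coset of \<open>f i z\<close>.\<close>

definition homology_map :: "(nat \<Rightarrow> ('n, 'r) rmodule) \<Rightarrow> (nat \<Rightarrow> 'n \<Rightarrow> 'n) \<Rightarrow> (nat \<Rightarrow> 'm \<Rightarrow> 'n)
    \<Rightarrow> nat \<Rightarrow> 'm set \<Rightarrow> 'n set" where
  "homology_map N d' f i S = boundaries N d' i <#>\<^bsub>N i\<^esub> (f i ` S)"

text \<open>
  The complex \<open>P\<close> may be taken with elements in \<open>nat \<Rightarrow> 'r\<close>, because every finitely generated
  projective module is isomorphic to a direct summand of some \<open>R\<^sup>k\<close>.
\<close>

definition finite_type :: "'r::ring_1 set \<Rightarrow> nat \<Rightarrow> (nat \<Rightarrow> ('m, 'r) rmodule) \<Rightarrow> (nat \<Rightarrow> 'm \<Rightarrow> 'm) \<Rightarrow> bool" where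
  "finite_type R q M d \<longleftrightarrow>
     (\<exists>(P :: nat \<Rightarrow> (nat \<Rightarrow> 'r, 'r) rmodule) dP f.
        rmod_complex R P dP \<and> (\<forall>n. fg_projective R (P n)) \<and>
        chain_map R P dP M d f \<and>
        (\<forall>i<q. homology_map M d f i \<in> iso (complex_homology P dP i) (complex_homology M d i)) \<and>
        homology_map M d f q \<in> epi (complex_homology P dP q) (complex_homology M d q))"

definition cover_skeleton :: "'b set \<Rightarrow> ('b \<Rightarrow> 'a) \<Rightarrow> (nat \<Rightarrow> 'a set set) \<Rightarrow> int \<Rightarrow> 'b set" where
  "cover_skeleton E p K k = E \<inter> p -` skeleton K k"

definition cell_group :: "'b::topological_space set \<Rightarrow> ('b \<Rightarrow> 'a) \<Rightarrow> (nat \<Rightarrow> 'a set set) \<Rightarrow> nat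
    \<Rightarrow> 'b chain set monoid" where
  "cell_group E p K n = relative_homology_group (int n)
     (top_of_set (cover_skeleton E p K (int n))) (cover_skeleton E p K (int n - 1))"

definition cell_act :: "'b::topological_space set \<Rightarrow> ('b \<Rightarrow> 'a) \<Rightarrow> (nat \<Rightarrow> 'a set set) \<Rightarrow> ('g \<Rightarrow> 'b \<Rightarrow> 'b)
    \<Rightarrow> nat \<Rightarrow> 'g \<Rightarrow> 'b chain set \<Rightarrow> 'b chain set" where
  "cell_act E p K act n g =
     hom_induced (int n)
       (top_of_set (cover_skeleton E p K (int n))) (cover_skeleton E p K (int n - 1))
       (top_of_set (cover_skeleton E p K (int n))) (cover_skeleton E p K (int n - 1)) (act g)"

text \<open>The right \<open>\<int>G\<close>-module structure extends \<open>c \<cdot> g = g\<^sup>-\<^sup>1 c\<close> additively.\<close>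

definition cell_module :: "'b::topological_space set \<Rightarrow> ('b \<Rightarrow> 'a) \<Rightarrow> (nat \<Rightarrow> 'a set set)
    \<Rightarrow> ('g::group_add \<Rightarrow> 'b \<Rightarrow> 'b) \<Rightarrow> nat \<Rightarrow> ('b chain set, 'g \<Rightarrow>\<^sub>0 int) rmodule" where
  "cell_module E p K act n =
     \<lparr>carrier = carrier (cell_group E p K n),
      monoid.mult = monoid.mult (cell_group E p K n),
      one = monoid.one (cell_group E p K n),
      rscale = (\<lambda>c a. finprod (cell_group E p K n)
        (\<lambda>g. cell_act E p K act n (- g) c [^]\<^bsub>cell_group E p K n\<^esub> Poly_Mapping.lookup a g)
        (Poly_Mapping.keys a))\<rparr>"

definition cell_boundary :: "'b::topological_space set \<Rightarrow> ('b \<Rightarrow> 'a) \<Rightarrow> (nat \<Rightarrow> 'a set set)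
    \<Rightarrow> nat \<Rightarrow> 'b chain set \<Rightarrow> 'b chain set" where
  "cell_boundary E p K n =
     (if n = 0 then (\<lambda>_. monoid.one (cell_group E p K 0))
      else hom_relboundary (int n) (top_of_set (cover_skeleton E p K (int n)))
             (cover_skeleton E p K (int n - 1)) (cover_skeleton E p K (int n - 2)))"

definition characters :: "('g::group_add \<Rightarrow> real) set" where
  "characters = {\<xi>. \<forall>x y. \<xi> (x + y) = \<xi> x + \<xi> y}"

definition ray_rel :: "(('g::group_add \<Rightarrow> real) \<times> ('g \<Rightarrow> real)) set" where
  "ray_rel = {(\<xi>, \<psi>). \<xi> \<in> characters - {\<lambda>_. 0} \<and> \<psi> \<in> characters - {\<lambda>_. 0} \<and>
     (\<exists>c>0. \<psi> = (\<lambda>g. c * \<xi> g))}"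

text \<open>\<open>rays V\<close> is \<open>S(V)\<close>, and \<open>rays characters\<close> is the character sphere \<open>S(G)\<close>.\<close>

definition rays :: "('g::group_add \<Rightarrow> real) set \<Rightarrow> ('g \<Rightarrow> real) set set" where
  "rays V = (V - {\<lambda>_. 0}) // ray_rel"

definition nonneg_group_ring :: "('g::group_add \<Rightarrow> real) \<Rightarrow> ('g \<Rightarrow>\<^sub>0 int) set" where
  "nonneg_group_ring \<xi> = {a. \<forall>g \<in> Poly_Mapping.keys a. \<xi> g \<ge> 0}"

definition BNSR :: "nat \<Rightarrow> 'b::topological_space set \<Rightarrow> ('b \<Rightarrow> 'a) \<Rightarrow> (nat \<Rightarrow> 'a set set)
    \<Rightarrow> ('g::group_add \<Rightarrow> 'b \<Rightarrow> 'b) \<Rightarrow> ('g \<Rightarrow> real) set set" where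
  "BNSR q E p K act = rays {\<xi> \<in> characters.
     finite_type (nonneg_group_ring \<xi>) q (cell_module E p K act) (cell_boundary E p K)}"

definition GL_representation :: "nat \<Rightarrow> ('g::group_add \<Rightarrow> int mat) \<Rightarrow> bool" where
  "GL_representation r \<sigma> \<longleftrightarrow>
     (\<forall>g. \<sigma> g \<in> carrier_mat r r \<and> invertible_mat (\<sigma> g)) \<and> (\<forall>g h. \<sigma> (g + h) = \<sigma> g * \<sigma> h)"

text \<open>
  The action of \<open>a = \<Sum> n\<^sub>g g \<in> \<int>G\<close> on \<open>\<int>[H] \<otimes> \<int>\<^sup>r\<close> is \<open>\<int>[H]\<close>-linear; its \<open>(k, l)\<close> entry in the
  basis \<open>1 \<otimes> \<epsilon>\<^sub>l\<close> is \<open>\<Sum> n\<^sub>g \<sigma>(g)\<^sub>k\<^sub>l ab(g)\<close>.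
\<close>

definition twist_entry :: "('g \<Rightarrow> 'h) \<Rightarrow> ('g \<Rightarrow> int mat) \<Rightarrow> ('g \<Rightarrow>\<^sub>0 int) \<Rightarrow> nat \<Rightarrow> nat \<Rightarrow> ('h \<Rightarrow>\<^sub>0 int)" where
  "twist_entry ab \<sigma> a k l =
     (\<Sum>g\<in>Poly_Mapping.keys a. Poly_Mapping.single (ab g) (Poly_Mapping.lookup a g * \<sigma> g $$ (k, l)))"

text \<open>
  A complex \<open>M\<close> of right \<open>\<int>G\<close>-modules with bases \<open>b n 0, \<dots>, b n (c n - 1)\<close> and
  \<open>d (b n j) = \<Sum>\<^sub>i b (n - 1) i \<cdot> a\<^sub>i\<^sub>j\<close>.  Then \<open>M n \<otimes>\<^bsub>\<int>G\<^esub> (\<int>[H] \<otimes> \<int>\<^sup>r)\<close> is free over \<open>\<int>[H]\<close> on the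
  elements \<open>b n j \<otimes> (1 \<otimes> \<epsilon>\<^sub>l)\<close>, listed at position \<open>r * j + l\<close>, and
  \<open>d (b n j) \<otimes> w = \<Sum>\<^sub>i b (n - 1) i \<otimes> a\<^sub>i\<^sub>j w\<close>.  The following is the matrix of \<open>\<partial>\<^sup>\<sigma>\<^sub>n\<close>.
\<close>

definition twisted_boundary :: "(nat \<Rightarrow> ('m, 'g::group_add \<Rightarrow>\<^sub>0 int) rmodule) \<Rightarrow> (nat \<Rightarrow> 'm \<Rightarrow> 'm)
    \<Rightarrow> (nat \<Rightarrow> nat) \<Rightarrow> (nat \<Rightarrow> nat \<Rightarrow> 'm) \<Rightarrow> ('g \<Rightarrow> 'h) \<Rightarrow> nat \<Rightarrow> ('g \<Rightarrow> int mat) \<Rightarrow> nat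
    \<Rightarrow> ('h::ab_group_add \<Rightarrow>\<^sub>0 int) mat" where
  "twisted_boundary M d c b ab r \<sigma> n =
     (if n = 0 then 0\<^sub>m 0 (r * c 0)
      else Matrix.mat (r * c (n - 1)) (r * c n)
        (\<lambda>(s, t). twist_entry ab \<sigma>
           (coordinates UNIV (M (n - 1)) (c (n - 1)) (b (n - 1)) (d n (b n (t div r))) (s div r))
           (s mod r) (t mod r)))"

definition minors :: "nat \<Rightarrow> 'r::comm_ring_1 mat \<Rightarrow> 'r set" where
  "minors k A = {Determinant.det (submatrix A I J) | I J.
     I \<subseteq> {..<dim_row A} \<and> J \<subseteq> {..<dim_col A} \<and> card I = k \<and> card J = k}"

abbreviation ideal_generated :: "'r::comm_ring_1 set \<Rightarrow> 'r set" where
  "ideal_generated S \<equiv> module.span (*) S"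

definition jump_ideal where
  "jump_ideal M d c b ab r \<sigma> i = ideal_generated (minors (r * c i)
     (let A = twisted_boundary M d c b ab r \<sigma> (Suc i); B = twisted_boundary M d c b ab r \<sigma> i
      in four_block_mat A (0\<^sub>m (dim_row A) (dim_col B)) (0\<^sub>m (dim_row B) (dim_col A)) B))"

definition jump_ideal_le where
  "jump_ideal_le M d c b ab r \<sigma> q = (\<Inter>i\<le>q. jump_ideal M d c b ab r \<sigma> i)"

definition initial_form :: "('h::ab_group_add \<Rightarrow> real) \<Rightarrow> ('h \<Rightarrow>\<^sub>0 int) \<Rightarrow> ('h \<Rightarrow>\<^sub>0 int)" where
  "initial_form \<xi> f =
     (\<Sum>h | h \<in> Poly_Mapping.keys f \<and> (\<forall>k \<in> Poly_Mapping.keys f. \<xi> h \<le> \<xi> k).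
        Poly_Mapping.single h (Poly_Mapping.lookup f h))"

definition Trop :: "('h::ab_group_add \<Rightarrow>\<^sub>0 int) set \<Rightarrow> ('h \<Rightarrow> real) set" where
  "Trop I = {\<xi> \<in> characters. ideal_generated (initial_form \<xi> ` (I - {0})) \<noteq> UNIV}"

end

theory Submission
  imports Defs
begin

text \<open>
  Let \<open>C\<close> be the cellular chain complex of the universal cover and \<open>\<xi>\<close> a nonzero character such
  that \<open>C\<close> is of finite \<open>q\<close>-type over the ring \<open>\<int>G\<^sub>\<xi>\<close> of elements supported where \<open>\<xi> \<ge> 0\<close>.  The point
  is that \<open>C\<close> then has a contraction up to terms that are strictly positive for \<open>\<xi>\<close>: there are
  \<open>\<int>G\<close>-linear maps \<open>h\<close> raising the degree by one such that in degrees at most \<open>q\<close> the entries of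
  \<open>d h + h d - 1\<close> are supported where \<open>\<xi> > 0\<close>.  (This is a truncated form of the vanishing of the
  homology with coefficients in the Novikov ring.)

  To see this, take a chain map \<open>f : P \<rightarrow> C\<close> from finitely generated projectives as in the
  definition of finite type.  Only finitely many generators are involved, so there is a bound \<open>N\<close> such
  that \<open>f(P\<^sub>n)\<close> lies where \<open>\<xi> \<ge> N\<close>, for \<open>n \<le> q\<close>.  Translating the basis of \<open>C\<^sub>n\<close> by group
  elements \<open>u\<^sub>n\<close>, with \<open>\<xi>(u\<^sub>n)\<close> below \<open>N\<close> and growing fast enough with \<open>n\<close>, gives a subcomplex of free
  \<open>\<int>G\<^sub>\<xi>\<close>-modules on the translated basis.  As \<open>f\<close> is connected up to degree \<open>q\<close>, the inclusion \<open>inc\<close> of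
  that subcomplex factors through \<open>f\<close> up to a homotopy, \<open>inc = f g + d s + s d\<close>
  (\<open>lift_up_to_homotopy\<close>).  Extended \<open>\<int>G\<close>-linearly, \<open>s\<close> becomes the required \<open>h\<close>, because the error
  \<open>f g\<close> moves every translated basis vector from \<open>\<xi> = \<xi>(u\<^sub>n) < N\<close> up to \<open>\<xi> \<ge> N\<close>
  (\<open>almost_contraction\<close>).

  Now write \<open>\<xi>\<close> as the composite of a character \<open>\<zeta>\<close> of \<open>H\<close> with the abelianization.  Base change
  along \<open>\<sigma>\<close> and the abelianization
  turns \<open>d h + h d\<close> into a matrix over \<open>\<int>[H]\<close> that is the identity up to strictly positive entries, so
  its determinant is \<open>1\<close> plus strictly positive terms (\<open>det_unipotent\<close>).  On the other hand
  \<open>d h + h d\<close> is a product whose middle factor is the block sum of two consecutive differentials, so by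
  the Cauchy-Binet expansion the determinant in degree \<open>i\<close> lies in the \<open>i\<close>-th jump ideal
  (\<open>det_homotopy_in_jump_ideal\<close>).  The product of these determinants over \<open>i \<le> q\<close> lies in the
  intersection of the jump ideals and has initial form \<open>1\<close>; hence \<open>\<zeta>\<close> is not in the tropical variety
  (\<open>finite_type_not_in_Trop\<close>).

  That \<open>C\<close> is a complex of \<open>\<int>G\<close>-modules rests on the lifting properties of coverings, which make the
  given deck transformations an action (\<open>deck_action_add\<close>, \<open>cellular_complex\<close>).
\<close>

section \<open>Ideals of minors\<close>

lemma module_mult_self: "Modules.module ((*) :: 'r::comm_ring_1 \<Rightarrow> 'r \<Rightarrow> 'r)"
  by unfold_locales (simp_all add: algebra_simps)

lemma ideal_sum_mult:
  fixes S :: "'r::comm_ring_1 set"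
  assumes "\<And>x. x \<in> A \<Longrightarrow> u x \<in> ideal_generated S"
  shows "(\<Sum>x\<in>A. c x * u x) \<in> ideal_generated S"
  by (intro Modules.module.span_sum[OF module_mult_self]
        Modules.module.span_scale[OF module_mult_self] assms)

text \<open>
  Submatrices are cut out by index sets, which \<open>pick\<close> lists in increasing order.  An arbitrary
  injective choice of indices differs from that list by a permutation, hence the corresponding
  minors differ by a sign.
\<close>

lemma injection_eq_pick_permutation:
  assumes inj: "inj_on f {0..<k}"
  shows "\<exists>p. p permutes {0..<k} \<and> (\<forall>i<k. f i = pick (f ` {0..<k}) (p i))"
proof -
  define I where "I = f ` {0..<k}"
  have cI: "card I = k" using card_image[OF inj] by (simp add: I_def)
  have fI: "finite I" by (simp add: I_def)
  define p where "p i = (if i < k then card {a \<in> I. a < f i} else i)" for i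
  have pk: "f i = pick I (p i)" if "i < k" for i
    using pick_card_in_set[of "f i" I] that by (auto simp: p_def I_def)
  have lt: "p i < k" if "i < k" for i
  proof -
    have "{a \<in> I. a < f i} \<subset> I" using that by (auto simp: I_def)
    then show ?thesis using psubset_card_mono[OF fI] cI that by (simp add: p_def)
  qed
  have "inj_on p {0..<k}"
  proof (rule inj_onI)
    fix i j assume "i \<in> {0..<k}" "j \<in> {0..<k}" "p i = p j"
    then have "f i = f j" using pk by auto
    with inj \<open>i \<in> {0..<k}\<close> \<open>j \<in> {0..<k}\<close> show "i = j" by (auto dest: inj_onD)
  qed
  moreover have "p ` {0..<k} \<subseteq> {0..<k}" using lt by auto
  ultimately have "bij_betw p {0..<k} {0..<k}"
    by (simp add: bij_betw_def endo_inj_surj)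
  then have "p permutes {0..<k}"
    by (rule bij_imp_permutes) (simp add: p_def)
  with pk show ?thesis unfolding I_def by blast
qed

lemma det_permute_cols:
  assumes A: "A \<in> carrier_mat n n" and p: "p permutes {0..<(n::nat)}"
  shows "Determinant.det (Matrix.mat n n (\<lambda>(i, j). A $$ (i, p j))) = signof p * Determinant.det A"
proof -
  have lt: "p i < n" if "i < n" for i using permutes_in_image[OF p] that by simp
  have "Matrix.mat n n (\<lambda>(i, j). A $$ (i, p j))
      = transpose_mat (Matrix.mat n n (\<lambda>(i, j). transpose_mat A $$ (p i, j)))"
    using A lt by (intro eq_matI) auto
  then show ?thesis
    using det_permute_rows[of "transpose_mat A" n p] A p
    by (simp add: Determinant.det_transpose[OF mat_carrier] Determinant.det_transpose[OF A])
qed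

text \<open>
  A repeated row or column makes the determinant vanish; otherwise it is a minor up to the signs of
  the two reorderings.
\<close>

lemma det_reindexed_in_minor_ideal:
  fixes A :: "'r::comm_ring_1 mat"
  assumes f: "\<And>i. i < k \<Longrightarrow> f i < dim_row A" and g: "\<And>i. i < k \<Longrightarrow> g i < dim_col A"
  shows "Determinant.det (Matrix.mat k k (\<lambda>(i, j). A $$ (f i, g j))) \<in> ideal_generated (minors k A)"
proof -
  let ?M = "Matrix.mat k k (\<lambda>(i, j). A $$ (f i, g j))"
  show ?thesis
  proof (cases "inj_on f {0..<k} \<and> inj_on g {0..<k}")
    case False
    have "Determinant.det ?M = 0"
    proof (cases "inj_on f {0..<k}")
      case True
      with False obtain i j where "i < k" "j < k" "i \<noteq> j" "g i = g j"
        by (auto simp: inj_on_def)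
      then show ?thesis
        by (intro det_identical_columns[of ?M k i j]) (auto simp: Matrix.col_def intro!: eq_vecI)
    next
      case False
      then obtain i j where "i < k" "j < k" "i \<noteq> j" "f i = f j"
        by (auto simp: inj_on_def)
      then show ?thesis
        by (intro det_identical_rows[of ?M k i j]) (auto simp: Matrix.row_def intro!: eq_vecI)
    qed
    then show ?thesis by (simp add: Modules.module.span_zero[OF module_mult_self])
  next
    case True
    define I where "I = f ` {0..<k}"
    define J where "J = g ` {0..<k}"
    from True obtain p q where p: "p permutes {0..<k}" "\<And>i. i < k \<Longrightarrow> f i = pick I (p i)"
      and q: "q permutes {0..<k}" "\<And>i. i < k \<Longrightarrow> g i = pick J (q i)"
      using injection_eq_pick_permutation[of f k] injection_eq_pick_permutation[of g k]
      unfolding I_def J_def by blast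
    have I: "I \<subseteq> {..<dim_row A}" "card I = k" and J: "J \<subseteq> {..<dim_col A}" "card J = k"
      using f g True by (auto simp: I_def J_def card_image)
    have eqs: "{i. i < dim_row A \<and> i \<in> I} = I" "{i. i < dim_col A \<and> i \<in> J} = J"
      using I J by auto
    let ?S = "submatrix A I J"
    have S: "?S \<in> carrier_mat k k" using eqs I J by (simp add: submatrix_def)
    have lt: "p i < k" "q i < k" if "i < k" for i
      using permutes_in_image[OF p(1)] permutes_in_image[OF q(1)] that by auto
    let ?B = "Matrix.mat k k (\<lambda>(i, j). ?S $$ (i, q j))"
    have "?M = Matrix.mat k k (\<lambda>(i, j). ?B $$ (p i, j))"
      using lt p(2) q(2) eqs I J by (intro eq_matI) (auto simp: submatrix_def)
    then have "Determinant.det ?M = signof p * (signof q * Determinant.det ?S)"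
      using det_permute_rows[of ?B k p] det_permute_cols[OF S q(1)] p(1) by simp
    moreover have "Determinant.det ?S \<in> ideal_generated (minors k A)"
      using I J by (intro Modules.module.span_base[OF module_mult_self]) (auto simp: minors_def)
    ultimately show ?thesis
      by (simp add: Modules.module.span_scale[OF module_mult_self])
  qed
qed

text \<open>
  The rows of \<open>P * B\<close> are linear combinations of the rows of \<open>B\<close>, and the determinant is linear in
  each row.
\<close>

lemma det_mult_rows:
  fixes P :: "'r::comm_ring_1 mat"
  assumes P: "P \<in> carrier_mat k m" and B: "B \<in> carrier_mat m k"
  shows "Determinant.det (P * B) =
    (\<Sum>f | (\<forall>i\<in>{0..<k}. f i \<in> {0..<m}) \<and> (\<forall>i. i \<notin> {0..<k} \<longrightarrow> f i = i).
       (\<Prod>i = 0..<k. P $$ (i, f i)) * Determinant.det (Matrix.mat k k (\<lambda>(i, j). B $$ (f i, j))))"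
proof -
  have "Determinant.det (P * B) = (\<Sum>f | (\<forall>i\<in>{0..<k}. f i \<in> {0..<m}) \<and> (\<forall>i. i \<notin> {0..<k} \<longrightarrow> f i = i).
        Determinant.det (mat\<^sub>r k k (\<lambda>i. P $$ (i, f i) \<cdot>\<^sub>v Matrix.row B (f i))))"
    unfolding mat_mul_finsum_alt[OF P B]
    by (rule det_linear_rows_sum) (use B in auto)
  also have "\<dots> = (\<Sum>f | (\<forall>i\<in>{0..<k}. f i \<in> {0..<m}) \<and> (\<forall>i. i \<notin> {0..<k} \<longrightarrow> f i = i).
       (\<Prod>i = 0..<k. P $$ (i, f i)) * Determinant.det (Matrix.mat k k (\<lambda>(i, j). B $$ (f i, j))))"
  proof (rule sum.cong[OF refl])
    fix f assume f: "f \<in> {f. (\<forall>i\<in>{0..<k}. f i \<in> {0..<m}) \<and> (\<forall>i. i \<notin> {0..<k} \<longrightarrow> f i = i)}"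
    have "mat\<^sub>r k k (\<lambda>i. Matrix.row B (f i)) = Matrix.mat k k (\<lambda>(i, j). B $$ (f i, j))"
      using f B by (intro eq_matI) auto
    then show "Determinant.det (mat\<^sub>r k k (\<lambda>i. P $$ (i, f i) \<cdot>\<^sub>v Matrix.row B (f i)))
      = (\<Prod>i = 0..<k. P $$ (i, f i)) * Determinant.det (Matrix.mat k k (\<lambda>(i, j). B $$ (f i, j)))"
      using det_rows_mul[of "\<lambda>i. Matrix.row B (f i)" k "\<lambda>i. P $$ (i, f i)"] B f by auto
  qed
  finally show ?thesis .
qed

text \<open>
  The Cauchy-Binet formula as a statement on ideals: expanding along the rows, and after
  transposition along the columns, gives a combination of determinants of reindexed submatrices of
  \<open>A\<close>.
\<close>

lemma det_mult_mult_in_minor_ideal: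
  fixes A :: "'r::comm_ring_1 mat"
  assumes P: "P \<in> carrier_mat k m" and A: "A \<in> carrier_mat m n" and Q: "Q \<in> carrier_mat n k"
  shows "Determinant.det (P * A * Q) \<in> ideal_generated (minors k A)"
proof -
  have AQ: "A * Q \<in> carrier_mat m k" using A Q by simp
  have rows: "Determinant.det (Matrix.mat k k (\<lambda>(i, j). (A * Q) $$ (f i, j))) \<in> ideal_generated (minors k A)"
    if f: "\<And>i. i < k \<Longrightarrow> f i < m" for f
  proof -
    define B where "B = transpose_mat (Matrix.mat k n (\<lambda>(i, j). A $$ (f i, j)))"
    have B: "B \<in> carrier_mat n k" by (simp add: B_def)
    have "Matrix.mat k k (\<lambda>(i, j). (A * Q) $$ (f i, j)) = Matrix.mat k n (\<lambda>(i, j). A $$ (f i, j)) * Q"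
      using A Q f by (intro eq_matI) (auto simp: scalar_prod_def)
    then have "transpose_mat (Matrix.mat k k (\<lambda>(i, j). (A * Q) $$ (f i, j))) = transpose_mat Q * B"
      using Q by (simp add: transpose_mult[of _ k n] B_def)
    then have "Determinant.det (Matrix.mat k k (\<lambda>(i, j). (A * Q) $$ (f i, j))) = Determinant.det (transpose_mat Q * B)"
      using Determinant.det_transpose[of "Matrix.mat k k (\<lambda>(i, j). (A * Q) $$ (f i, j))" k] by simp
    also have "\<dots> \<in> ideal_generated (minors k A)"
    proof (subst det_mult_rows[OF _ B], use Q in simp, rule ideal_sum_mult)
      fix g assume g: "g \<in> {g. (\<forall>i\<in>{0..<k}. g i \<in> {0..<n}) \<and> (\<forall>i. i \<notin> {0..<k} \<longrightarrow> g i = i)}"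
      have "Matrix.mat k k (\<lambda>(i, j). B $$ (g i, j)) = transpose_mat (Matrix.mat k k (\<lambda>(i, j). A $$ (f i, g j)))"
        using g by (intro eq_matI) (auto simp: B_def)
      then show "Determinant.det (Matrix.mat k k (\<lambda>(i, j). B $$ (g i, j))) \<in> ideal_generated (minors k A)"
        using det_reindexed_in_minor_ideal[of k f A g] A f g by (simp add: Determinant.det_transpose[OF mat_carrier])
    qed
    finally show ?thesis .
  qed
  have "P * A * Q = P * (A * Q)" using assms by simp
  then show ?thesis
    by (simp only: det_mult_rows[OF P AQ]) (rule ideal_sum_mult, rule rows, simp)
qed

text \<open>
  This rests on the factorization of \<open>A * S + T * B\<close> as the row \<open>(1, T)\<close> times the block sum of \<open>A\<close> and
  \<open>B\<close> times the column with entries \<open>S\<close> and \<open>1\<close>.  The outer factors are written as block matrices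
  with empty blocks.
\<close>

lemma det_in_block_minor_ideal:
  fixes A :: "'r::comm_ring_1 Matrix.mat"
  assumes A: "A \<in> carrier_mat k nA" and B: "B \<in> carrier_mat mB k"
    and S: "S \<in> carrier_mat nA k" and T: "T \<in> carrier_mat k mB"
  shows "Determinant.det (A * S + T * B) \<in> ideal_generated (minors k
    (four_block_mat A (0\<^sub>m (dim_row A) (dim_col B)) (0\<^sub>m (dim_row B) (dim_col A)) B))"
proof -
  let ?D = "four_block_mat A (0\<^sub>m k k) (0\<^sub>m mB nA) B"
  let ?P = "four_block_mat (1\<^sub>m k) T (0\<^sub>m 0 k) (0\<^sub>m 0 mB)"
  let ?Q = "four_block_mat S (0\<^sub>m nA 0) (1\<^sub>m k) (0\<^sub>m k 0)"
  have P: "?P \<in> carrier_mat k (k + mB)" using four_block_carrier_mat[of "1\<^sub>m k" k k "0\<^sub>m 0 mB" 0 mB] by simp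
  have D: "?D \<in> carrier_mat (k + mB) (nA + k)" by (rule four_block_carrier_mat[OF A B])
  have Q: "?Q \<in> carrier_mat (nA + k) k" using four_block_carrier_mat[OF S, of "0\<^sub>m k 0" k 0] by simp
  have "?P * ?D = four_block_mat (1\<^sub>m k * A + T * 0\<^sub>m mB nA) (1\<^sub>m k * 0\<^sub>m k k + T * B)
      (0\<^sub>m 0 k * A + 0\<^sub>m 0 mB * 0\<^sub>m mB nA) (0\<^sub>m 0 k * 0\<^sub>m k k + 0\<^sub>m 0 mB * B)"
    by (rule mult_four_block_mat) (use A B T in auto)
  also have "\<dots> = four_block_mat A (T * B) (0\<^sub>m 0 nA) (0\<^sub>m 0 k)"
    using A B T by simp
  finally have PD: "?P * ?D = four_block_mat A (T * B) (0\<^sub>m 0 nA) (0\<^sub>m 0 k)" .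
  have "?P * ?D * ?Q = four_block_mat (A * S + T * B * 1\<^sub>m k) (A * 0\<^sub>m nA 0 + T * B * 0\<^sub>m k 0)
      (0\<^sub>m 0 nA * S + 0\<^sub>m 0 k * 1\<^sub>m k) (0\<^sub>m 0 nA * 0\<^sub>m nA 0 + 0\<^sub>m 0 k * 0\<^sub>m k 0)"
    unfolding PD by (rule mult_four_block_mat) (use A B S T in auto)
  also have "\<dots> = A * S + T * B"
    using A B S T by (intro eq_matI) auto
  finally have "Determinant.det (A * S + T * B) \<in> ideal_generated (minors k ?D)"
    using det_mult_mult_in_minor_ideal[OF P D Q] by simp
  then show ?thesis using A B by simp
qed

section \<open>Supports in group rings along a character\<close>

text \<open>
  For a character \<open>\<xi>\<close> these sets form a multiplicative filtration of the group ring, with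
  \<open>supp_ge \<xi> 0\<close> the subring over which finite type is tested and \<open>positive_part \<xi>\<close> an ideal of that
  subring.
\<close>

definition supp_ge :: "('g::group_add \<Rightarrow> real) \<Rightarrow> real \<Rightarrow> ('g \<Rightarrow>\<^sub>0 int) set" where
  "supp_ge \<xi> c = {a. \<forall>g\<in>Poly_Mapping.keys a. c \<le> \<xi> g}"

definition positive_part :: "('g::group_add \<Rightarrow> real) \<Rightarrow> ('g \<Rightarrow>\<^sub>0 int) set" where
  "positive_part \<xi> = {a. \<forall>g\<in>Poly_Mapping.keys a. 0 < \<xi> g}"

lemma nonneg_group_ring_eq_supp_ge: "nonneg_group_ring \<xi> = supp_ge \<xi> 0"
  by (simp add: nonneg_group_ring_def supp_ge_def)

lemma character_zero: "\<xi> \<in> characters \<Longrightarrow> \<xi> (0::'g::group_add) = 0"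
  unfolding characters_def by (metis (mono_tags, lifting) add.right_neutral add_cancel_right_right mem_Collect_eq)

lemma character_add: "\<xi> \<in> characters \<Longrightarrow> \<xi> (x + y) = \<xi> x + \<xi> y"
  by (simp add: characters_def)

lemma character_uminus: "\<xi> \<in> characters \<Longrightarrow> \<xi> (- x) = - \<xi> (x::'g::group_add)"
  using character_add[of \<xi> "- x" x] character_zero[of \<xi>] by simp

lemma supp_ge_zero [simp]: "0 \<in> supp_ge \<xi> c" by (simp add: supp_ge_def)

lemma supp_ge_add: "a \<in> supp_ge \<xi> c \<Longrightarrow> b \<in> supp_ge \<xi> c \<Longrightarrow> a + b \<in> supp_ge \<xi> c"
  unfolding supp_ge_def using Poly_Mapping.keys_add[of a b] by blast

lemma supp_ge_uminus: "a \<in> supp_ge \<xi> c \<Longrightarrow> - a \<in> supp_ge \<xi> c"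
  by (simp add: supp_ge_def)

lemma supp_ge_sum: "(\<And>x. x \<in> A \<Longrightarrow> f x \<in> supp_ge \<xi> c) \<Longrightarrow> sum f A \<in> supp_ge \<xi> c"
  by (induction A rule: infinite_finite_induct) (auto intro: supp_ge_add)

lemma supp_ge_mono: "a \<in> supp_ge \<xi> c \<Longrightarrow> d \<le> c \<Longrightarrow> a \<in> supp_ge \<xi> d"
  by (force simp: supp_ge_def)

lemma supp_ge_mult:
  assumes "\<xi> \<in> characters" "a \<in> supp_ge \<xi> c" "b \<in> supp_ge \<xi> d"
  shows "a * b \<in> supp_ge \<xi> (c + d)"
  unfolding supp_ge_def
proof (clarify)
  fix g assume "g \<in> Poly_Mapping.keys (a * b)"
  then obtain x y where "g = x + y" "x \<in> Poly_Mapping.keys a" "y \<in> Poly_Mapping.keys b"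
    using Poly_Mapping.keys_mult[of a b] by blast
  then show "c + d \<le> \<xi> g"
    using assms by (auto simp: supp_ge_def character_add intro: add_mono)
qed

lemma supp_ge_exists: "\<exists>c. a \<in> supp_ge \<xi> c"
proof -
  have "bdd_below (\<xi> ` Poly_Mapping.keys a)" by simp
  then show ?thesis unfolding bdd_below_def supp_ge_def by blast
qed

lemma supp_ge_one: "\<xi> \<in> characters \<Longrightarrow> 1 \<in> supp_ge \<xi> 0"
  by (simp add: supp_ge_def character_zero single_one[symmetric] del: single_one)

lemma supp_ge_single: "c \<le> \<xi> g \<Longrightarrow> Poly_Mapping.single g n \<in> supp_ge \<xi> c"
  by (simp add: supp_ge_def)

lemma supp_ge_imp_positive: "a \<in> supp_ge \<xi> c \<Longrightarrow> 0 < c \<Longrightarrow> a \<in> positive_part \<xi>"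
  by (force simp: supp_ge_def positive_part_def)

lemma positive_imp_supp_ge: "a \<in> positive_part \<xi> \<Longrightarrow> a \<in> supp_ge \<xi> 0"
  by (force simp: supp_ge_def positive_part_def)

lemma positive_zero [simp]: "0 \<in> positive_part \<xi>" by (simp add: positive_part_def)

lemma positive_add: "a \<in> positive_part \<xi> \<Longrightarrow> b \<in> positive_part \<xi> \<Longrightarrow> a + b \<in> positive_part \<xi>"
  unfolding positive_part_def using Poly_Mapping.keys_add[of a b] by blast

lemma positive_uminus: "a \<in> positive_part \<xi> \<Longrightarrow> - a \<in> positive_part \<xi>"
  by (simp add: positive_part_def)

lemma positive_sum: "(\<And>x. x \<in> A \<Longrightarrow> f x \<in> positive_part \<xi>) \<Longrightarrow> sum f A \<in> positive_part \<xi>"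
  by (induction A rule: infinite_finite_induct) (auto intro: positive_add)

lemma positive_mult_supp_ge:
  assumes "\<xi> \<in> characters" "a \<in> positive_part \<xi>" "b \<in> supp_ge \<xi> 0"
  shows "a * b \<in> positive_part \<xi>"
  unfolding positive_part_def
proof (clarify)
  fix g assume "g \<in> Poly_Mapping.keys (a * b)"
  then obtain x y where "g = x + y" "x \<in> Poly_Mapping.keys a" "y \<in> Poly_Mapping.keys b"
    using Poly_Mapping.keys_mult[of a b] by blast
  then show "0 < \<xi> g"
    using assms by (auto simp: supp_ge_def positive_part_def character_add intro: add_pos_nonneg)
qed

text \<open>
  The elements \<open>f\<close> with \<open>f - 1\<close> strictly positive are the ones that become units with leading term \<open>1\<close>
  in the Novikov completion.
\<close>

lemma unipotent_mult:
  assumes "\<xi> \<in> characters" "f - 1 \<in> positive_part \<xi>" "g - 1 \<in> positive_part \<xi>"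
  shows "f * g - 1 \<in> positive_part \<xi>"
proof -
  have "f * g - 1 = (f - 1) * (g - 1) + (f - 1) + (g - 1)" by (simp add: algebra_simps)
  then show ?thesis
    using assms by (metis positive_add positive_imp_supp_ge positive_mult_supp_ge)
qed

lemma unipotent_prod:
  fixes f :: "'i \<Rightarrow> 'h::ab_group_add \<Rightarrow>\<^sub>0 int"
  assumes "\<xi> \<in> characters" "\<And>i. i \<in> A \<Longrightarrow> f i - 1 \<in> positive_part \<xi>"
  shows "prod f A - 1 \<in> positive_part \<xi>"
  using assms(2)
  by (induction A rule: infinite_finite_induct) (auto intro: unipotent_mult[OF assms(1)])

text \<open>
  In the Leibniz expansion every permutation other than the identity picks an off-diagonal entry,
  which is strictly positive; the identity contributes a product of unipotent diagonal entries.
\<close>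

lemma det_unipotent:
  fixes A :: "('h::ab_group_add \<Rightarrow>\<^sub>0 int) Matrix.mat"
  assumes \<xi>: "\<xi> \<in> characters" and A: "A \<in> carrier_mat k k"
    and ent: "\<And>i j. i < k \<Longrightarrow> j < k \<Longrightarrow> A $$ (i, j) - (if i = j then 1 else 0) \<in> positive_part \<xi>"
  shows "Determinant.det A - 1 \<in> positive_part \<xi>"
proof -
  let ?P = "{p. p permutes {0..<k}}"
  let ?t = "\<lambda>p. signof p * (\<Prod>i = 0..<k. A $$ (i, p i))"
  have fin: "finite ?P" by (rule finite_permutations) simp
  have diag: "(\<Prod>i = 0..<k. A $$ (i, i)) - 1 \<in> positive_part \<xi>"
    using ent[of i i for i] by (intro unipotent_prod[OF \<xi>]) fastforce
  have nn: "A $$ (i, j) \<in> supp_ge \<xi> 0" if "i < k" "j < k" for i j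
    using supp_ge_add[OF positive_imp_supp_ge[OF ent[OF that]], of "if i = j then 1 else 0"]
      supp_ge_one[OF \<xi>] by (auto split: if_splits)
  have nnprod: "(\<Prod>i\<in>B. f i) \<in> supp_ge \<xi> 0" if "\<And>i. i \<in> B \<Longrightarrow> f i \<in> supp_ge \<xi> 0"
    for B :: "nat set" and f
    using that
    by (induction B rule: infinite_finite_induct)
      (use supp_ge_one[OF \<xi>] supp_ge_mult[OF \<xi>, of _ 0 _ 0] in auto)
  have off: "?t p \<in> positive_part \<xi>" if p: "p \<in> ?P - {id}" for p
  proof -
    have lt: "p i < k" if "i < k" for i
      using p permutes_in_image[of p "{0..<k}" i] that by simp
    from p obtain i where i: "p i \<noteq> i" by fastforce
    then have ik: "i < k" using p permutes_not_in[of p "{0..<k}" i] by auto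
    have "(\<Prod>i = 0..<k. A $$ (i, p i)) = A $$ (i, p i) * (\<Prod>j\<in>{0..<k} - {i}. A $$ (j, p j))"
      using ik by (intro prod.remove) auto
    moreover have "A $$ (i, p i) \<in> positive_part \<xi>" using ent[OF ik lt[OF ik]] i by auto
    ultimately have "(\<Prod>i = 0..<k. A $$ (i, p i)) \<in> positive_part \<xi>"
      using lt nn by (auto intro!: positive_mult_supp_ge[OF \<xi>] nnprod)
    then show ?thesis by (cases p rule: sign_cases) (auto simp: positive_uminus)
  qed
  have "Determinant.det A = ?t id + (\<Sum>p\<in>?P - {id}. ?t p)"
    unfolding det_def'[OF A] by (rule sum.remove[OF fin]) (simp add: permutes_id)
  then have "Determinant.det A - 1 = ((\<Prod>i = 0..<k. A $$ (i, i)) - 1) + (\<Sum>p\<in>?P - {id}. ?t p)"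
    by simp
  also have "\<dots> \<in> positive_part \<xi>" by (intro positive_add diag positive_sum off)
  finally show ?thesis .
qed

text \<open>
  The neutral element is in the support, with coefficient \<open>1\<close> and value \<open>0\<close>; all other elements of
  the support have positive value.
\<close>

lemma unipotent_initial_form:
  assumes \<xi>: "\<xi> \<in> characters" and f: "f - 1 \<in> positive_part \<xi>"
  shows "initial_form \<xi> f = 1" and "f \<noteq> 0"
proof -
  have "Poly_Mapping.lookup (f - 1) 0 = 0"
    using f character_zero[OF \<xi>] by (force simp: positive_part_def in_keys_iff)
  then have l: "Poly_Mapping.lookup f 0 = 1" by (simp add: lookup_minus lookup_one)
  then show "f \<noteq> 0" by auto
  have pos: "0 < \<xi> h" if "h \<in> Poly_Mapping.keys f" "h \<noteq> 0" for h
  proof -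
    have "h \<in> Poly_Mapping.keys (f - 1)" using that by (simp add: in_keys_iff lookup_minus lookup_one)
    then show ?thesis using f by (simp add: positive_part_def)
  qed
  have "0 \<in> Poly_Mapping.keys f" using l by (simp add: in_keys_iff)
  then have "{h \<in> Poly_Mapping.keys f. \<forall>k\<in>Poly_Mapping.keys f. \<xi> h \<le> \<xi> k} = {0}"
    using pos character_zero[OF \<xi>] by (force simp: less_le_not_le)
  then show "initial_form \<xi> f = 1" by (simp add: initial_form_def l)
qed

lemma unipotent_not_in_Trop:
  assumes f: "f \<in> I" "f - 1 \<in> positive_part \<xi>"
  shows "\<xi> \<notin> Trop I"
proof
  assume "\<xi> \<in> Trop I"
  then have \<xi>: "\<xi> \<in> characters" and ne: "ideal_generated (initial_form \<xi> ` (I - {0})) \<noteq> UNIV"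
    by (auto simp: Trop_def)
  have "1 \<in> initial_form \<xi> ` (I - {0})"
    using unipotent_initial_form[OF \<xi> f(2)] f(1) by force
  then have "x * 1 \<in> ideal_generated (initial_form \<xi> ` (I - {0}))" for x
    by (intro Modules.module.span_scale[OF module_mult_self] Modules.module.span_base[OF module_mult_self])
  with ne show False by auto
qed

section \<open>Base change along the twisted representation\<close>

lemma poly_mapping_single_induct [case_names single sum]:
  fixes a :: "'g \<Rightarrow>\<^sub>0 int"
  assumes single: "\<And>g n. P (Poly_Mapping.single g n)" and sum: "\<And>a b. P a \<Longrightarrow> P b \<Longrightarrow> P (a + b)"
  shows "P a"
proof (induction a rule: update_induct)
  case const
  show ?case using single[of undefined 0] by simp
next
  case (update a g n)
  have "Poly_Mapping.update g n a = a + Poly_Mapping.single g n"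
    using update.hyps by (intro poly_mapping_eqI)
      (auto simp: lookup_update lookup_add lookup_single when_def in_keys_iff)
  then show ?case using sum single update.IH by simp
qed

text \<open>
  A common index set for several group ring elements allows their sums to be compared termwise.
\<close>

lemma twist_entry_superset:
  assumes "finite S" "Poly_Mapping.keys a \<subseteq> S"
  shows "twist_entry ab \<sigma> a k l =
    (\<Sum>g\<in>S. Poly_Mapping.single (ab g) (Poly_Mapping.lookup a g * \<sigma> g $$ (k, l)))"
  unfolding twist_entry_def using assms
  by (intro sum.mono_neutral_left) (auto simp: in_keys_iff)

lemma twist_entry_add:
  "twist_entry ab \<sigma> (a + b) k l = twist_entry ab \<sigma> a k l + twist_entry ab \<sigma> b k l"
proof -
  let ?S = "Poly_Mapping.keys a \<union> Poly_Mapping.keys b"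
  have "twist_entry ab \<sigma> c k l =
    (\<Sum>g\<in>?S. Poly_Mapping.single (ab g) (Poly_Mapping.lookup c g * \<sigma> g $$ (k, l)))"
    if "c \<in> {a, b, a + b}" for c
    using that Poly_Mapping.keys_add[of a b] by (intro twist_entry_superset) auto
  then show ?thesis
    by (simp add: lookup_add algebra_simps single_add sum.distrib)
qed

lemma twist_entry_zero [simp]: "twist_entry ab \<sigma> 0 k l = 0"
  by (simp add: twist_entry_def)

lemma twist_entry_single:
  "twist_entry ab \<sigma> (Poly_Mapping.single g n) k l = Poly_Mapping.single (ab g) (n * \<sigma> g $$ (k, l))"
  by (simp add: twist_entry_superset[of "{g}"])

lemma twist_entry_uminus: "twist_entry ab \<sigma> (- a) k l = - twist_entry ab \<sigma> a k l"
  using twist_entry_add[of ab \<sigma> a "- a" k l] by (simp add: eq_neg_iff_add_eq_0 add.commute)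

lemma twist_entry_diff:
  "twist_entry ab \<sigma> (a - b) k l = twist_entry ab \<sigma> a k l - twist_entry ab \<sigma> b k l"
  using twist_entry_add[of ab \<sigma> a "- b" k l] by (simp add: twist_entry_uminus)

lemma twist_entry_sum:
  "twist_entry ab \<sigma> (sum f A) k l = (\<Sum>x\<in>A. twist_entry ab \<sigma> (f x) k l)"
  by (induction A rule: infinite_finite_induct) (auto simp: twist_entry_add)

lemma single_sum: "Poly_Mapping.single g (sum f A) = (\<Sum>x\<in>A. Poly_Mapping.single g (f x))"
  by (induction A rule: infinite_finite_induct) (auto simp: single_add)

text \<open>
  Both sides are biadditive in \<open>a\<close> and \<open>b\<close>, so the multiplicativity of \<open>\<sigma>\<close> and \<open>ab\<close> on single group
  elements suffices.
\<close>

lemma twist_entry_mult: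
  fixes \<sigma> :: "'g::group_add \<Rightarrow> int Matrix.mat" and ab :: "'g \<Rightarrow> 'h::ab_group_add"
  assumes \<sigma>: "GL_representation r \<sigma>" and ab: "\<And>x y. ab (x + y) = ab x + ab y"
    and k: "k < r" and l: "l < r"
  shows "twist_entry ab \<sigma> (a * b) k l = (\<Sum>m<r. twist_entry ab \<sigma> a k m * twist_entry ab \<sigma> b m l)"
proof -
  have car: "\<sigma> g \<in> carrier_mat r r" for g using \<sigma> by (simp add: GL_representation_def)
  have \<sigma>add: "\<sigma> (g + h) $$ (k, l) = (\<Sum>m<r. \<sigma> g $$ (k, m) * \<sigma> h $$ (m, l))" for g h
    using \<sigma> carrier_matD[OF car[of g]] carrier_matD[OF car[of h]] k l
    by (simp add: GL_representation_def scalar_prod_def lessThan_atLeast0)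
  show ?thesis
  proof (induction a rule: poly_mapping_single_induct)
    case (single g m)
    show ?case
    proof (induction b rule: poly_mapping_single_induct)
      case (single h n)
      show ?case
        by (simp add: mult_single twist_entry_single ab \<sigma>add single_sum[symmetric] sum_distrib_left
            algebra_simps)
    next
      case (sum b b')
      then show ?case by (simp add: algebra_simps twist_entry_add sum.distrib)
    qed
  next
    case (sum a a')
    then show ?case by (simp add: algebra_simps twist_entry_add sum.distrib)
  qed
qed

text \<open>
  An invertible idempotent matrix is the identity.
\<close>

lemma GL_representation_zero:
  assumes \<sigma>: "GL_representation r \<sigma>"
  shows "\<sigma> 0 = 1\<^sub>m r"
proof -
  have car: "\<sigma> 0 \<in> carrier_mat r r" and inv: "invertible_mat (\<sigma> 0)" and idem: "\<sigma> 0 = \<sigma> 0 * \<sigma> 0"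
    using \<sigma> unfolding GL_representation_def by (metis add.right_neutral)+
  then obtain B where B: "B * \<sigma> 0 = 1\<^sub>m (dim_row B)" "\<sigma> 0 * B = 1\<^sub>m r"
    by (auto simp: invertible_mat_def inverts_mat_def)
  have Bc: "B \<in> carrier_mat r r"
    using B car by (metis carrier_matD carrier_matI index_mult_mat(2,3) index_one_mat(2,3))
  have "\<sigma> 0 = \<sigma> 0 * (\<sigma> 0 * B)" using B(2) car by simp
  also have "\<dots> = \<sigma> 0 * \<sigma> 0 * B" using car Bc by simp
  also have "\<dots> = 1\<^sub>m r" using idem B(2) by simp
  finally show ?thesis .
qed

lemma twist_entry_one:
  fixes ab :: "'g::group_add \<Rightarrow> 'h::ab_group_add"
  assumes "GL_representation r \<sigma>" "ab 0 = 0" "k < r" "l < r"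
  shows "twist_entry ab \<sigma> 1 k l = (if k = l then 1 else 0)"
  using twist_entry_single[of ab \<sigma> 0 1 k l] assms by (simp add: GL_representation_zero)

lemma twist_entry_positive:
  assumes "a \<in> positive_part (\<xi> \<circ> ab)"
  shows "twist_entry ab \<sigma> a k l \<in> positive_part \<xi>"
  unfolding twist_entry_def
  using assms by (intro positive_sum) (auto simp: positive_part_def)

text \<open>
  The base change of a matrix over \<open>\<int>G\<close> to \<open>\<int>[H]\<close>: entry \<open>a i j\<close> becomes an \<open>r \<times> r\<close> block.  The
  layout is that of the twisted boundary matrices, with the basis element \<open>b n j \<otimes> (1 \<otimes> \<epsilon>\<^sub>l)\<close> at
  position \<open>r * j + l\<close>.
\<close>

definition twist_mat where
  "twist_mat ab \<sigma> r m n a = Matrix.mat (r * m) (r * n)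
     (\<lambda>(s, t). twist_entry ab \<sigma> (a (s div r) (t div r)) (s mod r) (t mod r))"

lemma twist_mat_carrier [simp]: "twist_mat ab \<sigma> r m n a \<in> carrier_mat (r * m) (r * n)"
  by (simp add: twist_mat_def)

lemma block_index:
  assumes "s < r * (m::nat)" shows "s div r < m" "s mod r < r"
proof -
  have "0 < r" using assms by (cases r) auto
  then show "s div r < m" "s mod r < r" using assms by (auto simp: less_mult_imp_div_less mult.commute)
qed

lemma sum_blocks: "(\<Sum>u<r * n. f (u div r) (u mod r)) = (\<Sum>l<n. \<Sum>m<r. f l (m::nat))"
proof (cases "r = 0")
  case False
  have "(\<Sum>u<r * n. f (u div r) (u mod r)) = (\<Sum>l<n. \<Sum>u = l * r..<l * r + r. f (u div r) (u mod r))"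
    by (simp add: sum.nat_group mult.commute)
  also have "\<dots> = (\<Sum>l<n. \<Sum>m<r. f l m)"
  proof (rule sum.cong[OF refl])
    fix l
    show "(\<Sum>u = l * r..<l * r + r. f (u div r) (u mod r)) = (\<Sum>m<r. f l m)"
      using False by (simp add: sum.atLeastLessThan_shift_0[of _ "l * r"] lessThan_atLeast0)
  qed
  finally show ?thesis .
qed simp

lemma twist_mat_mult:
  fixes ab :: "'g::group_add \<Rightarrow> 'h::ab_group_add"
  assumes \<sigma>: "GL_representation r \<sigma>" and ab: "\<And>x y. ab (x + y) = ab x + ab y"
  shows "twist_mat ab \<sigma> r m n a * twist_mat ab \<sigma> r n p b
    = twist_mat ab \<sigma> r m p (\<lambda>i j. \<Sum>l<n. a i l * b l j)"
proof (rule eq_matI)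
  fix s t
  assume "s < dim_row (twist_mat ab \<sigma> r m p (\<lambda>i j. \<Sum>l<n. a i l * b l j))"
    and "t < dim_col (twist_mat ab \<sigma> r m p (\<lambda>i j. \<Sum>l<n. a i l * b l j))"
  then have st: "s < r * m" "t < r * p" by (simp_all add: twist_mat_def)
  have "(twist_mat ab \<sigma> r m n a * twist_mat ab \<sigma> r n p b) $$ (s, t) =
     (\<Sum>u<r * n. twist_entry ab \<sigma> (a (s div r) (u div r)) (s mod r) (u mod r) *
        twist_entry ab \<sigma> (b (u div r) (t div r)) (u mod r) (t mod r))"
    using st by (simp add: twist_mat_def scalar_prod_def lessThan_atLeast0)
  also have "\<dots> = (\<Sum>l<n. \<Sum>m<r. twist_entry ab \<sigma> (a (s div r) l) (s mod r) m *
        twist_entry ab \<sigma> (b l (t div r)) m (t mod r))"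
    by (rule sum_blocks[where f = "\<lambda>l m. twist_entry ab \<sigma> (a (s div r) l) (s mod r) m *
        twist_entry ab \<sigma> (b l (t div r)) m (t mod r)"])
  also have "\<dots> = twist_mat ab \<sigma> r m p (\<lambda>i j. \<Sum>l<n. a i l * b l j) $$ (s, t)"
    using st block_index[OF st(1)] block_index[OF st(2)]
    by (simp add: twist_mat_def twist_entry_sum twist_entry_mult[OF \<sigma> ab])
  finally show "(twist_mat ab \<sigma> r m n a * twist_mat ab \<sigma> r n p b) $$ (s, t)
    = twist_mat ab \<sigma> r m p (\<lambda>i j. \<Sum>l<n. a i l * b l j) $$ (s, t)" .
qed (simp_all add: twist_mat_def)

lemma twist_mat_unipotent:
  fixes ab :: "'g::group_add \<Rightarrow> 'h::ab_group_add"
  assumes \<sigma>: "GL_representation r \<sigma>" and ab: "\<And>x y. ab (x + y) = ab x + ab y"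
    and \<xi>: "\<xi> \<in> characters"
    and a: "\<And>i j. i < n \<Longrightarrow> j < n \<Longrightarrow> a i j - (if i = j then 1 else 0) \<in> positive_part (\<xi> \<circ> ab)"
  shows "Determinant.det (twist_mat ab \<sigma> r n n a) - 1 \<in> positive_part \<xi>"
proof (rule det_unipotent[OF \<xi> twist_mat_carrier])
  fix s t assume st: "s < r * n" "t < r * n"
  have ab0: "ab 0 = 0" using ab[of 0 0] by simp
  note b = block_index[OF st(1)] block_index[OF st(2)]
  let ?d = "if s div r = t div r then 1 else 0 :: 'g \<Rightarrow>\<^sub>0 int"
  have eq: "s = t \<longleftrightarrow> s div r = t div r \<and> s mod r = t mod r" by (metis div_mult_mod_eq)
  have "twist_mat ab \<sigma> r n n a $$ (s, t) - (if s = t then 1 else 0)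
    = twist_entry ab \<sigma> (a (s div r) (t div r) - ?d) (s mod r) (t mod r)"
    using st b twist_entry_one[where r=r and \<sigma>=\<sigma> and ab=ab, OF \<sigma> ab0]
    by (auto simp: twist_mat_def twist_entry_diff eq)
  also have "\<dots> \<in> positive_part \<xi>"
    using a b by (intro twist_entry_positive) auto
  finally show "twist_mat ab \<sigma> r n n a $$ (s, t) - (if s = t then 1 else 0) \<in> positive_part \<xi>" .
qed

lemma twist_mat_add:
  "twist_mat ab \<sigma> r m n (\<lambda>i j. a i j + a' i j) = twist_mat ab \<sigma> r m n a + twist_mat ab \<sigma> r m n a'"
  by (rule eq_matI) (auto simp: twist_mat_def twist_entry_add)

section \<open>Right modules and their homomorphisms\<close>

lemma right_moduleD:
  assumes "right_module R M"
  shows "comm_group M"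
    and "\<And>x a. x \<in> carrier M \<Longrightarrow> a \<in> R \<Longrightarrow> rscale M x a \<in> carrier M"
    and "\<And>x y a. x \<in> carrier M \<Longrightarrow> y \<in> carrier M \<Longrightarrow> a \<in> R \<Longrightarrow>
        rscale M (x \<otimes>\<^bsub>M\<^esub> y) a = rscale M x a \<otimes>\<^bsub>M\<^esub> rscale M y a"
    and "\<And>x a b. x \<in> carrier M \<Longrightarrow> a \<in> R \<Longrightarrow> b \<in> R \<Longrightarrow>
        rscale M x (a + b) = rscale M x a \<otimes>\<^bsub>M\<^esub> rscale M x b"
    and "\<And>x a b. x \<in> carrier M \<Longrightarrow> a \<in> R \<Longrightarrow> b \<in> R \<Longrightarrow>
        rscale M x (a * b) = rscale M (rscale M x a) b"
    and "\<And>x. x \<in> carrier M \<Longrightarrow> rscale M x 1 = x"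
  using assms by (simp_all add: right_module_def)

lemma right_module_mono: "right_module R M \<Longrightarrow> S \<subseteq> R \<Longrightarrow> right_module S M"
  unfolding right_module_def by blast

lemma rmod_hom_mono: "f \<in> rmod_hom R M N \<Longrightarrow> S \<subseteq> R \<Longrightarrow> f \<in> rmod_hom S M N"
  unfolding rmod_hom_def by blast

lemma rmod_homD:
  assumes "f \<in> rmod_hom R M N"
  shows "\<And>x. x \<in> carrier M \<Longrightarrow> f x \<in> carrier N"
    and "\<And>x y. x \<in> carrier M \<Longrightarrow> y \<in> carrier M \<Longrightarrow> f (x \<otimes>\<^bsub>M\<^esub> y) = f x \<otimes>\<^bsub>N\<^esub> f y"
    and "\<And>x a. x \<in> carrier M \<Longrightarrow> a \<in> R \<Longrightarrow> f (rscale M x a) = rscale N (f x) a"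
  using assms by (auto simp: rmod_hom_def hom_def)

lemma rmod_homI:
  assumes "\<And>x. x \<in> carrier M \<Longrightarrow> f x \<in> carrier N"
    and "\<And>x y. x \<in> carrier M \<Longrightarrow> y \<in> carrier M \<Longrightarrow> f (x \<otimes>\<^bsub>M\<^esub> y) = f x \<otimes>\<^bsub>N\<^esub> f y"
    and "\<And>x a. x \<in> carrier M \<Longrightarrow> a \<in> R \<Longrightarrow> f (rscale M x a) = rscale N (f x) a"
  shows "f \<in> rmod_hom R M N"
  using assms by (auto simp: rmod_hom_def hom_def)

lemma rmod_hom_group_hom:
  assumes "f \<in> rmod_hom R M N" "comm_group M" "comm_group N"
  shows "group_hom M N f"
  using assms
  by (auto simp: rmod_hom_def group_hom_def group_hom_axioms_def comm_group.axioms)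

lemma rmod_hom_one:
  assumes "f \<in> rmod_hom R M N" "right_module R M" "right_module R N"
  shows "f \<one>\<^bsub>M\<^esub> = \<one>\<^bsub>N\<^esub>"
  by (rule group_hom.hom_one[OF rmod_hom_group_hom[OF assms(1) right_moduleD(1)[OF assms(2)] right_moduleD(1)[OF assms(3)]]])

lemma rmod_hom_compose:
  assumes "f \<in> rmod_hom R M N" "g \<in> rmod_hom R N L"
  shows "(\<lambda>x. g (f x)) \<in> rmod_hom R M L"
  using rmod_homD[OF assms(1)] rmod_homD[OF assms(2)] by (intro rmod_homI) simp_all

lemma rmod_hom_const_one:
  assumes "right_module R N" shows "(\<lambda>_. \<one>\<^bsub>N\<^esub>) \<in> rmod_hom R M N"
proof -
  note N = right_moduleD[OF assms]
  interpret comm_group N by (rule N(1))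
  have "rscale N \<one>\<^bsub>N\<^esub> a = \<one>\<^bsub>N\<^esub>" if "a \<in> R" for a
    using N(3)[of "\<one>\<^bsub>N\<^esub>" "\<one>\<^bsub>N\<^esub>" a] N(2)[of "\<one>\<^bsub>N\<^esub>" a] that by (simp add: l_cancel_one)
  then show ?thesis by (intro rmod_homI) simp_all
qed

lemma rmod_hom_mult:
  assumes "f \<in> rmod_hom R M N" "g \<in> rmod_hom R M N" "right_module R M" "right_module R N"
  shows "(\<lambda>x. f x \<otimes>\<^bsub>N\<^esub> g x) \<in> rmod_hom R M N"
proof -
  interpret comm_group N by (rule right_moduleD(1)[OF assms(4)])
  show ?thesis
    using rmod_homD[OF assms(1)] rmod_homD[OF assms(2)] right_moduleD[OF assms(4)]
    by (intro rmod_homI) (simp_all add: m_ac)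
qed

lemma rmod_hom_inverse:
  assumes "f \<in> rmod_hom R M N" "right_module R M" "right_module R N"
  shows "(\<lambda>x. inv\<^bsub>N\<^esub> f x) \<in> rmod_hom R M N"
proof -
  note N = right_moduleD[OF assms(3)]
  note f = rmod_homD[OF assms(1)]
  interpret comm_group N by (rule N(1))
  have one: "rscale N \<one>\<^bsub>N\<^esub> a = \<one>\<^bsub>N\<^esub>" if "a \<in> R" for a
    using rmod_homD(3)[OF rmod_hom_const_one[OF assms(3)], of "\<one>\<^bsub>M\<^esub>" M a] that
      comm_group.axioms right_moduleD(1)[OF assms(2)]
    by (metis N(1) comm_groupE(2))
  have "rscale N (inv\<^bsub>N\<^esub> y) a = inv\<^bsub>N\<^esub> (rscale N y a)" if "y \<in> carrier N" "a \<in> R" for y a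
  proof -
    have "rscale N (inv\<^bsub>N\<^esub> y) a \<otimes>\<^bsub>N\<^esub> rscale N y a = \<one>\<^bsub>N\<^esub>"
      using N(3)[of "inv\<^bsub>N\<^esub> y" y a] that one by simp
    then show ?thesis using N(2) that by (simp add: inv_equality)
  qed
  then show ?thesis using f N by (intro rmod_homI) (simp_all add: inv_mult)
qed

section \<open>Free modules and coordinates\<close>

definition subring_1 :: "'r::ring_1 set \<Rightarrow> bool" where
  "subring_1 R \<longleftrightarrow> 0 \<in> R \<and> 1 \<in> R \<and> (\<forall>a\<in>R. - a \<in> R) \<and> (\<forall>a\<in>R. \<forall>b\<in>R. a + b \<in> R \<and> a * b \<in> R)"

definition unit_coord :: "nat \<Rightarrow> nat \<Rightarrow> 'r::ring_1" where
  "unit_coord j = (\<lambda>i. if i = j then 1 else 0)"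

definition combination :: "('m, 'r) rmodule \<Rightarrow> nat \<Rightarrow> (nat \<Rightarrow> 'm) \<Rightarrow> (nat \<Rightarrow> 'r) \<Rightarrow> 'm" where
  "combination M k g v = finprod M (\<lambda>j. rscale M (g j) (v j)) {..<k}"

lemma free_rmodule_simps [simp]:
  "v \<in> carrier (free_rmodule R k) \<longleftrightarrow> (\<forall>j<k. v j \<in> R) \<and> (\<forall>j\<ge>k. v j = 0)"
  "v \<otimes>\<^bsub>free_rmodule R k\<^esub> w = (\<lambda>j. v j + w j)"
  "\<one>\<^bsub>free_rmodule R k\<^esub> = (\<lambda>_. 0)"
  "rscale (free_rmodule R k) v a = (\<lambda>j. v j * a)"
  by (simp_all add: free_rmodule_def)

lemma subring_1_UNIV [simp]: "subring_1 UNIV" by (simp add: subring_1_def)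

lemma right_module_free:
  assumes R: "subring_1 R"
  shows "right_module R (free_rmodule R k)"
proof -
  have "comm_group (free_rmodule R k)"
  proof (rule comm_groupI)
    fix v assume v: "v \<in> carrier (free_rmodule R k)"
    then show "\<exists>w\<in>carrier (free_rmodule R k). w \<otimes>\<^bsub>free_rmodule R k\<^esub> v = \<one>\<^bsub>free_rmodule R k\<^esub>"
      using R by (intro bexI[of _ "\<lambda>j. - v j"]) (auto simp: subring_1_def)
  qed (use R in \<open>auto simp: subring_1_def add_ac\<close>)
  then show ?thesis using R by (auto simp: right_module_def subring_1_def algebra_simps)
qed

lemma unit_coord_carrier: "subring_1 R \<Longrightarrow> j < k \<Longrightarrow> unit_coord j \<in> carrier (free_rmodule R k)"
  by (auto simp: unit_coord_def subring_1_def)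

lemma combination_closed:
  assumes "right_module R N" "\<And>j. j < k \<Longrightarrow> g j \<in> carrier N" "v \<in> carrier (free_rmodule R k)"
  shows "combination N k g v \<in> carrier N"
proof -
  interpret comm_group N by (rule right_moduleD(1)[OF assms(1)])
  show ?thesis unfolding combination_def
    using assms right_moduleD(2)[OF assms(1)] by (intro finprod_closed) auto
qed

lemma finprod_hom:
  assumes "comm_group M" "comm_group N" "f \<in> hom M N" "finite A" "g \<in> A \<rightarrow> carrier M"
  shows "f (finprod M g A) = finprod N (\<lambda>x. f (g x)) A"
proof -
  interpret M: comm_group M by fact
  interpret N: comm_group N by fact
  interpret group_hom M N f by unfold_locales fact
  show ?thesis using assms(4,5)
    by (induction A rule: finite_induct) (auto simp: Pi_def)
qed

lemma combination_hom:
  assumes R: "subring_1 R" and N: "right_module R N" and g: "\<And>j. j < k \<Longrightarrow> g j \<in> carrier N"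
  shows "combination N k g \<in> rmod_hom R (free_rmodule R k) N"
proof -
  note Nd = right_moduleD[OF N]
  interpret comm_group N by (rule Nd(1))
  show ?thesis
  proof (rule rmod_homI)
    fix v assume "v \<in> carrier (free_rmodule R k)"
    then show "combination N k g v \<in> carrier N" by (intro combination_closed[OF N g])
  next
    fix v w assume v: "v \<in> carrier (free_rmodule R k)" and w: "w \<in> carrier (free_rmodule R k)"
    have "combination N k g (v \<otimes>\<^bsub>free_rmodule R k\<^esub> w)
      = finprod N (\<lambda>j. rscale N (g j) (v j) \<otimes>\<^bsub>N\<^esub> rscale N (g j) (w j)) {..<k}"
      unfolding combination_def free_rmodule_simps using v w g Nd(2,4)
      by (intro finprod_cong') auto
    also have "\<dots> = combination N k g v \<otimes>\<^bsub>N\<^esub> combination N k g w"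
      unfolding combination_def using v w g Nd(2) by (intro finprod_multf) auto
    finally show "combination N k g (v \<otimes>\<^bsub>free_rmodule R k\<^esub> w)
      = combination N k g v \<otimes>\<^bsub>N\<^esub> combination N k g w" .
  next
    fix v a assume v: "v \<in> carrier (free_rmodule R k)" and a: "a \<in> R"
    have h: "(\<lambda>x. rscale N x a) \<in> hom N N" using Nd(2,3) a by (auto simp: hom_def)
    show "combination N k g (rscale (free_rmodule R k) v a) = rscale N (combination N k g v) a"
      unfolding combination_def free_rmodule_simps using v a g Nd(2,5)
      by (subst finprod_hom[OF Nd(1) Nd(1) h]) (auto intro!: finprod_cong')
  qed
qed

lemma rscale_zero:
  assumes "right_module R N" "subring_1 R" "x \<in> carrier N"
  shows "rscale N x 0 = \<one>\<^bsub>N\<^esub>"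
proof -
  note Nd = right_moduleD[OF assms(1)]
  interpret comm_group N by (rule Nd(1))
  have "0 \<in> R" using assms by (simp add: subring_1_def)
  then show ?thesis
    using Nd(4)[of x 0 0] Nd(2)[of x 0] assms(3) by (simp add: l_cancel_one)
qed

lemma combination_unit:
  assumes R: "subring_1 R" and N: "right_module R N" and g: "\<And>j. j < k \<Longrightarrow> g j \<in> carrier N" and j: "j < k"
  shows "combination N k g (unit_coord j) = g j"
proof -
  note Nd = right_moduleD[OF N]
  interpret comm_group N by (rule Nd(1))
  have "combination N k g (unit_coord j) = finprod N (\<lambda>i. if j = i then g i else \<one>\<^bsub>N\<^esub>) {..<k}"
    unfolding combination_def using g Nd(6) rscale_zero[OF N R]
    by (intro finprod_cong') (auto simp: unit_coord_def)
  also have "\<dots> = g j" using g j by (intro finprod_singleton) auto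
  finally show ?thesis .
qed

text \<open>
  The claim is proved for the truncations of \<open>v\<close> to its first \<open>m\<close> coordinates, by induction on \<open>m\<close>.
\<close>

lemma rmod_hom_free_eq_combination:
  assumes R: "subring_1 R" and N: "right_module R N"
    and f: "f \<in> rmod_hom R (free_rmodule R k) N" and v: "v \<in> carrier (free_rmodule R k)"
  shows "f v = combination N k (\<lambda>j. f (unit_coord j)) v"
proof -
  note Nd = right_moduleD[OF N]
  interpret comm_group N by (rule Nd(1))
  have R0: "0 \<in> R" using R by (simp add: subring_1_def)
  have "f (\<lambda>i. if i < m then v i else 0) = finprod N (\<lambda>j. rscale N (f (unit_coord j)) (v j)) {..<m}"
    if "m \<le> k" for m
    using that
  proof (induction m)
    case 0
    show ?case using rmod_hom_one[OF f right_module_free[OF R] N] by simp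
  next
    case (Suc m)
    let ?t = "\<lambda>i. if i < m then v i else 0"
    have t: "?t \<in> carrier (free_rmodule R k)" using v Suc.prems R0 by auto
    have vm: "v m \<in> R" using v Suc.prems by simp
    have um: "unit_coord m \<in> carrier (free_rmodule R k)" using Suc.prems by (intro unit_coord_carrier[OF R]) simp
    have s: "rscale (free_rmodule R k) (unit_coord m) (v m) \<in> carrier (free_rmodule R k)"
      using right_moduleD(2)[OF right_module_free[OF R] um vm] .
    have eq: "(\<lambda>i. if i < Suc m then v i else 0)
      = ?t \<otimes>\<^bsub>free_rmodule R k\<^esub> rscale (free_rmodule R k) (unit_coord m) (v m)"
      by (auto simp: unit_coord_def fun_eq_iff less_Suc_eq)
    have "f (\<lambda>i. if i < Suc m then v i else 0) = f ?t \<otimes>\<^bsub>N\<^esub> rscale N (f (unit_coord m)) (v m)"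
      unfolding eq rmod_homD(2)[OF f t s] rmod_homD(3)[OF f um vm] ..
    also have "f ?t = finprod N (\<lambda>j. rscale N (f (unit_coord j)) (v j)) {..<m}" using Suc by simp
    also have "\<dots> \<otimes>\<^bsub>N\<^esub> rscale N (f (unit_coord m)) (v m)
      = finprod N (\<lambda>j. rscale N (f (unit_coord j)) (v j)) {..<Suc m}"
    proof -
      have car: "rscale N (f (unit_coord j)) (v j) \<in> carrier N" if "j \<le> m" for j
        using that Suc.prems v by (intro Nd(2) rmod_homD(1)[OF f] unit_coord_carrier[OF R]) auto
      then show ?thesis
        by (simp add: lessThan_Suc Pi_def finprod_insert m_comm)
    qed
    finally show ?case .
  qed
  from this[of k] have "f (\<lambda>i. if i < k then v i else 0) = combination N k (\<lambda>j. f (unit_coord j)) v"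
    by (simp add: combination_def)
  moreover have "(\<lambda>i. if i < k then v i else 0) = v" using v by auto
  ultimately show ?thesis by simp
qed

lemma rmod_hom_free_eqI:
  assumes R: "subring_1 R" and N: "right_module R N"
    and f: "f \<in> rmod_hom R (free_rmodule R k) N" and g: "g \<in> rmod_hom R (free_rmodule R k) N"
    and eq: "\<And>j. j < k \<Longrightarrow> f (unit_coord j) = g (unit_coord j)"
    and v: "v \<in> carrier (free_rmodule R k)"
  shows "f v = g v"
proof -
  interpret comm_group N by (rule right_moduleD(1)[OF N])
  have "combination N k (\<lambda>j. f (unit_coord j)) v = combination N k (\<lambda>j. g (unit_coord j)) v"
    unfolding combination_def
    using eq v right_moduleD(2)[OF N] rmod_homD(1)[OF g] unit_coord_carrier[OF R]
    by (intro finprod_cong') auto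
  then show ?thesis
    using rmod_hom_free_eq_combination[OF R N f v] rmod_hom_free_eq_combination[OF R N g v] by simp
qed

lemma combination_free:
  assumes R: "subring_1 R" and g: "\<And>j. j < k \<Longrightarrow> g j \<in> carrier (free_rmodule R m)"
    and v: "v \<in> carrier (free_rmodule R k)"
  shows "combination (free_rmodule R m) k g v = (\<lambda>i. \<Sum>j<k. g j i * v j)"
proof -
  interpret comm_group "free_rmodule R m" by (rule right_moduleD(1)[OF right_module_free[OF R]])
  have "finprod (free_rmodule R m) (\<lambda>j. rscale (free_rmodule R m) (g j) (v j)) A = (\<lambda>i. \<Sum>j\<in>A. g j i * v j)"
    if "finite A" "A \<subseteq> {..<k}" for A
    using that
  proof (induction A rule: finite_induct)
    case (insert j A)
    have car: "rscale (free_rmodule R m) (g j) (v j) \<in> carrier (free_rmodule R m)" if "j < k" for j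
      by (rule right_moduleD(2)[OF right_module_free[OF R] g[OF that]]) (use v that in simp)
    then have "finprod (free_rmodule R m) (\<lambda>j. rscale (free_rmodule R m) (g j) (v j)) (insert j A)
      = rscale (free_rmodule R m) (g j) (v j) \<otimes>\<^bsub>free_rmodule R m\<^esub>
        finprod (free_rmodule R m) (\<lambda>j. rscale (free_rmodule R m) (g j) (v j)) A"
      using insert by (intro finprod_insert) (auto simp del: free_rmodule_simps)
    then show ?case using insert by simp
  qed simp
  then show ?thesis by (simp add: combination_def)
qed

text \<open>
  A homomorphism of free modules is given by a matrix.  The target may have a larger coefficient
  ring \<open>S\<close>, to cover maps that are linear over \<open>\<int>G\<^sub>\<xi>\<close> with values in a free \<open>\<int>G\<close>-module.
\<close>

lemma rmod_hom_free_free: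
  assumes R: "subring_1 R" and S: "subring_1 S" "R \<subseteq> S"
    and f: "f \<in> rmod_hom R (free_rmodule R k) (free_rmodule S m)"
    and v: "v \<in> carrier (free_rmodule R k)"
  shows "f v i = (\<Sum>j<k. f (unit_coord j) i * v j)"
proof -
  have N: "right_module R (free_rmodule S m)"
    by (rule right_module_mono[OF right_module_free[OF S(1)] S(2)])
  have "f v = combination (free_rmodule S m) k (\<lambda>j. f (unit_coord j)) v"
    by (rule rmod_hom_free_eq_combination[OF R N f v])
  also have "\<dots> = (\<lambda>i. \<Sum>j<k. f (unit_coord j) i * v j)"
  proof (rule combination_free[OF S(1)])
    fix j assume "j < k"
    then show "f (unit_coord j) \<in> carrier (free_rmodule S m)"
      by (intro rmod_homD(1)[OF f] unit_coord_carrier[OF R])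
  next
    show "v \<in> carrier (free_rmodule S k)" using v S(2) by auto
  qed
  finally show ?thesis by simp
qed

lemma coordinates_props:
  fixes M :: "('m, 'r::ring_1) rmodule"
  assumes M: "right_module UNIV M" and b: "rmodule_basis UNIV M k b"
  shows "\<And>x. x \<in> carrier M \<Longrightarrow> combination M k b (coordinates UNIV M k b x) = x"
    and "\<And>v. v \<in> carrier (free_rmodule UNIV k) \<Longrightarrow> coordinates UNIV M k b (combination M k b v) = v"
    and "coordinates UNIV M k b \<in> rmod_hom UNIV M (free_rmodule UNIV k)"
proof -
  let ?c = "coordinates UNIV M k b"
  have bc: "\<And>j. j < k \<Longrightarrow> b j \<in> carrier M" using b by (simp add: rmodule_basis_def)
  have ex: "\<exists>!v. v \<in> carrier (free_rmodule UNIV k) \<and> x = combination M k b v" if "x \<in> carrier M" for x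
    using b that unfolding rmodule_basis_def combination_def by blast
  have c: "?c x \<in> carrier (free_rmodule UNIV k) \<and> x = combination M k b (?c x)" if "x \<in> carrier M" for x
    using theI'[OF ex[OF that]] unfolding coordinates_def combination_def .
  show 1: "\<And>x. x \<in> carrier M \<Longrightarrow> combination M k b (?c x) = x" using c by simp
  have closed: "combination M k b v \<in> carrier M" if "v \<in> carrier (free_rmodule UNIV k)" for v
    by (rule combination_closed[OF M bc that])
  show 2: "?c (combination M k b v) = v" if v: "v \<in> carrier (free_rmodule UNIV k)" for v
    using ex[OF closed[OF v]] c[OF closed[OF v]] v by blast
  have "combination M k b \<in> rmod_hom UNIV (free_rmodule UNIV k) M"
    by (rule combination_hom[OF subring_1_UNIV M bc])
  note h = rmod_homD[OF this]
  have F: "v \<otimes>\<^bsub>free_rmodule UNIV k\<^esub> w \<in> carrier (free_rmodule UNIV k)"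
      "rscale (free_rmodule UNIV k) v a \<in> carrier (free_rmodule UNIV k)"
    if "v \<in> carrier (free_rmodule UNIV k)" "w \<in> carrier (free_rmodule UNIV k)" for v w and a :: 'r
    using that by simp_all
  have cc: "?c x \<in> carrier (free_rmodule UNIV k)" if "x \<in> carrier M" for x
    using c[OF that] by (rule conjunct1)
  show "?c \<in> rmod_hom UNIV M (free_rmodule UNIV k)"
  proof (rule rmod_homI)
    fix x y assume x: "x \<in> carrier M" and y: "y \<in> carrier M"
    have "combination M k b (?c x \<otimes>\<^bsub>free_rmodule UNIV k\<^esub> ?c y) = x \<otimes>\<^bsub>M\<^esub> y"
      by (simp only: h(2)[OF cc[OF x] cc[OF y]] 1[OF x] 1[OF y])
    then show "?c (x \<otimes>\<^bsub>M\<^esub> y) = ?c x \<otimes>\<^bsub>free_rmodule UNIV k\<^esub> ?c y"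
      using 2[OF F(1)[OF cc[OF x] cc[OF y]]] by (simp only:)
  next
    fix x a assume x: "x \<in> carrier M"
    have "combination M k b (rscale (free_rmodule UNIV k) (?c x) a) = rscale M x a"
      by (simp only: h(3)[OF cc[OF x] UNIV_I] 1[OF x])
    then show "?c (rscale M x a) = rscale (free_rmodule UNIV k) (?c x) a"
      using 2[OF F(2)[OF cc[OF x] cc[OF x], of a]] by (simp only:)
  qed (rule cc)
qed

section \<open>Chain maps that are connected up to a given degree\<close>

lemma rmod_complexD:
  assumes "rmod_complex R M d"
  shows "\<And>n. right_module R (M n)" and "\<And>n. d n \<in> rmod_hom R (M n) (M (n - 1))"
    and "\<And>x. x \<in> carrier (M 0) \<Longrightarrow> d 0 x = \<one>\<^bsub>M 0\<^esub>"
    and "\<And>n x. x \<in> carrier (M (Suc n)) \<Longrightarrow> d n (d (Suc n) x) = \<one>\<^bsub>M (n - 1)\<^esub>"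
  using assms by (auto simp: rmod_complex_def)

lemma rmod_complex_mono: "rmod_complex R M d \<Longrightarrow> S \<subseteq> R \<Longrightarrow> rmod_complex S M d"
  unfolding rmod_complex_def using right_module_mono rmod_hom_mono by blast

lemma chain_mapD:
  assumes "chain_map R P dP M d f"
  shows "\<And>n. f n \<in> rmod_hom R (P n) (M n)"
    and "\<And>n x. x \<in> carrier (P (Suc n)) \<Longrightarrow> f n (dP (Suc n) x) = d (Suc n) (f (Suc n) x)"
  using assms by (auto simp: chain_map_def)

lemma boundaries_subgroup:
  assumes "rmod_complex R M d"
  shows "subgroup (boundaries M d i) (M i)"
proof -
  note M = rmod_complexD[OF assms]
  interpret group_hom "M (Suc i)" "M i" "d (Suc i)"
    using M(2)[of "Suc i"] by (intro rmod_hom_group_hom right_moduleD(1)[OF M(1)]) simp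
  show ?thesis unfolding boundaries_def by (rule img_is_subgroup)
qed

lemma homology_carrier:
  "carrier (complex_homology M d i) = (\<lambda>z. boundaries M d i #>\<^bsub>M i\<^esub> z) ` cycles M d i"
  by (auto simp: complex_homology_def FactGroup_def RCOSETS_def r_coset_def)

lemma homology_map_surjD:
  assumes P: "rmod_complex R P dP" and M: "rmod_complex R M d"
    and sur: "homology_map M d f i ` carrier (complex_homology P dP i) = carrier (complex_homology M d i)"
    and z: "z \<in> cycles M d i"
  shows "\<exists>y\<in>cycles P dP i. \<exists>c\<in>carrier (M (Suc i)). z = d (Suc i) c \<otimes>\<^bsub>M i\<^esub> f i y"
proof -
  note Pd = rmod_complexD[OF P] and Md = rmod_complexD[OF M]
  interpret P: comm_group "P i" by (rule right_moduleD(1)[OF Pd(1)])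
  interpret M: comm_group "M i" by (rule right_moduleD(1)[OF Md(1)])
  interpret dP: group_hom "P i" "P (i - 1)" "dP i"
    using Pd(2)[of i] by (intro rmod_hom_group_hom right_moduleD(1)[OF Pd(1)]) simp
  have zc: "z \<in> carrier (M i)" using z by (simp add: cycles_def kernel_def)
  have "boundaries M d i #>\<^bsub>M i\<^esub> z \<in> carrier (complex_homology M d i)"
    unfolding homology_carrier using z by blast
  then have "boundaries M d i #>\<^bsub>M i\<^esub> z \<in> homology_map M d f i ` carrier (complex_homology P dP i)"
    unfolding sur .
  then obtain p where p: "p \<in> cycles P dP i"
    and eq: "boundaries M d i #>\<^bsub>M i\<^esub> z = homology_map M d f i (boundaries P dP i #>\<^bsub>P i\<^esub> p)"
    by (auto simp: homology_carrier)
  have "z \<in> boundaries M d i #>\<^bsub>M i\<^esub> z"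
    using M.rcos_self[OF zc boundaries_subgroup[OF M]] .
  then obtain h y where h: "h \<in> boundaries M d i" and y: "y \<in> boundaries P dP i #>\<^bsub>P i\<^esub> p"
    and zz: "z = h \<otimes>\<^bsub>M i\<^esub> f i y"
    unfolding eq homology_map_def set_mult_def by auto
  from y obtain u where u: "u \<in> carrier (P (Suc i))" and yu: "y = dP (Suc i) u \<otimes>\<^bsub>P i\<^esub> p"
    by (auto simp: r_coset_def boundaries_def)
  have pc: "p \<in> carrier (P i)" "dP i p = \<one>\<^bsub>P (i - 1)\<^esub>" using p by (auto simp: cycles_def kernel_def)
  have duc: "dP (Suc i) u \<in> carrier (P i)" using rmod_homD(1)[OF Pd(2)[of "Suc i"] u] by simp
  have "y \<in> cycles P dP i"
    unfolding cycles_def kernel_def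
    using pc duc Pd(4)[OF u] comm_group.axioms(2)[OF right_moduleD(1)[OF Pd(1)], of "i - 1"]
    by (simp add: yu group.is_monoid monoid.l_one monoid.one_closed)
  moreover obtain c where "c \<in> carrier (M (Suc i))" "h = d (Suc i) c"
    using h by (auto simp: boundaries_def)
  ultimately show ?thesis using zz by blast
qed

text \<open>
  This evaluates the map on homology at the coset of a cycle whose image is a boundary.
\<close>

lemma set_mult_subgroup_absorb:
  assumes "group G" "subgroup H G" "T \<subseteq> H" "t \<in> T"
  shows "H <#>\<^bsub>G\<^esub> T = H"
proof -
  interpret group G by fact
  have "H <#>\<^bsub>G\<^esub> T \<subseteq> H" using assms subgroup.m_closed by (fastforce simp: set_mult_def)
  moreover have "H \<subseteq> H <#>\<^bsub>G\<^esub> T"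
  proof
    fix x assume x: "x \<in> H"
    have t: "t \<in> H" using assms by blast
    have "x = (x \<otimes>\<^bsub>G\<^esub> inv\<^bsub>G\<^esub> t) \<otimes>\<^bsub>G\<^esub> t"
      using x t subgroup.mem_carrier[OF assms(2)] by (simp add: m_assoc)
    moreover have "x \<otimes>\<^bsub>G\<^esub> inv\<^bsub>G\<^esub> t \<in> H"
      using x t assms(2) by (simp add: subgroup.m_closed subgroup.m_inv_closed)
    ultimately show "x \<in> H <#>\<^bsub>G\<^esub> T" using assms(4) unfolding set_mult_def by blast
  qed
  ultimately show ?thesis by blast
qed

lemma homology_map_injD:
  assumes P: "rmod_complex R P dP" and M: "rmod_complex R M d" and f: "chain_map R P dP M d f"
    and inj: "inj_on (homology_map M d f i) (carrier (complex_homology P dP i))"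
    and p: "p \<in> cycles P dP i" and fp: "f i p \<in> boundaries M d i"
  shows "p \<in> boundaries P dP i"
proof -
  note Pd = rmod_complexD[OF P] and Md = rmod_complexD[OF M] and fd = chain_mapD[OF f]
  interpret P: comm_group "P i" by (rule right_moduleD(1)[OF Pd(1)])
  interpret M: comm_group "M i" by (rule right_moduleD(1)[OF Md(1)])
  interpret dP: group_hom "P i" "P (i - 1)" "dP i"
    using Pd(2)[of i] by (intro rmod_hom_group_hom right_moduleD(1)[OF Pd(1)]) simp
  note BP = boundaries_subgroup[OF P, of i] and BM = boundaries_subgroup[OF M, of i]
  have one: "\<one>\<^bsub>P i\<^esub> \<in> cycles P dP i" by (simp add: cycles_def kernel_def)
  have f1: "f i \<one>\<^bsub>P i\<^esub> = \<one>\<^bsub>M i\<^esub>" by (rule rmod_hom_one[OF fd(1) Pd(1) Md(1)])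
  have triv: "homology_map M d f i (boundaries P dP i #>\<^bsub>P i\<^esub> x) = boundaries M d i"
    if x: "x \<in> cycles P dP i" "f i x \<in> boundaries M d i" for x
  proof -
    have xc: "x \<in> carrier (P i)" using x by (simp add: cycles_def kernel_def)
    have "f i ` (boundaries P dP i #>\<^bsub>P i\<^esub> x) \<subseteq> boundaries M d i"
    proof clarify
      fix y assume "y \<in> boundaries P dP i #>\<^bsub>P i\<^esub> x"
      then obtain u where u: "u \<in> carrier (P (Suc i))" and y: "y = dP (Suc i) u \<otimes>\<^bsub>P i\<^esub> x"
        by (auto simp: r_coset_def boundaries_def)
      have duc: "dP (Suc i) u \<in> carrier (P i)" using rmod_homD(1)[OF Pd(2)[of "Suc i"] u] by simp
      have "f i y = d (Suc i) (f (Suc i) u) \<otimes>\<^bsub>M i\<^esub> f i x"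
        unfolding y rmod_homD(2)[OF fd(1) duc xc] fd(2)[OF u] ..
      moreover have "d (Suc i) (f (Suc i) u) \<in> boundaries M d i"
        using rmod_homD(1)[OF fd(1) u] by (simp add: boundaries_def)
      ultimately show "f i y \<in> boundaries M d i" using x(2) by (simp add: subgroup.m_closed[OF BM])
    qed
    moreover have "f i x \<in> f i ` (boundaries P dP i #>\<^bsub>P i\<^esub> x)"
      using P.rcos_self[OF xc BP] by blast
    ultimately show ?thesis unfolding homology_map_def
      using set_mult_subgroup_absorb[OF M.is_group BM] by blast
  qed
  have "boundaries P dP i #>\<^bsub>P i\<^esub> p = boundaries P dP i #>\<^bsub>P i\<^esub> \<one>\<^bsub>P i\<^esub>"
    using inj triv[OF p fp] triv[OF one] p one f1 subgroup.one_closed[OF BM]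
    unfolding homology_carrier by (auto dest: inj_onD)
  moreover have "p \<in> boundaries P dP i #>\<^bsub>P i\<^esub> p"
    using p by (intro P.rcos_self[OF _ BP]) (simp add: cycles_def kernel_def)
  moreover have "boundaries P dP i #>\<^bsub>P i\<^esub> \<one>\<^bsub>P i\<^esub> = boundaries P dP i"
    by (rule P.coset_mult_one[OF subgroup.subset[OF BP]])
  ultimately show ?thesis by simp
qed

text \<open>
  Exactness of the mapping cone of \<open>f\<close> in degree \<open>i\<close>: a cycle \<open>(p, c)\<close> of the cone is the boundary of
  some \<open>(p', c')\<close>.  For \<open>i = 0\<close> the component \<open>p\<close> lives in degree \<open>-1\<close> and has to vanish; since
  \<open>i - 1\<close> is truncated there, this is an explicit condition.
\<close>

definition cone_exact where
  "cone_exact P dP M d f i \<longleftrightarrow>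
     (\<forall>p\<in>carrier (P (i - 1)). \<forall>c\<in>carrier (M i).
        dP (i - 1) p = \<one>\<^bsub>P (i - 1 - 1)\<^esub> \<longrightarrow> (i = 0 \<longrightarrow> p = \<one>\<^bsub>P 0\<^esub>) \<longrightarrow> d i c = f (i - 1) p \<longrightarrow>
        (\<exists>p'\<in>carrier (P i). \<exists>c'\<in>carrier (M (Suc i)).
           dP i p' = p \<and> c = f i p' \<otimes>\<^bsub>M i\<^esub> d (Suc i) c'))"

text \<open>
  Injectivity on homology in degree \<open>i - 1\<close> makes \<open>p\<close> the boundary of some \<open>p''\<close>.  Then \<open>c - f p''\<close> is a
  cycle, and surjectivity in degree \<open>i\<close> writes it as \<open>f y + d c'\<close> with a cycle \<open>y\<close>, so that
  \<open>p' = y + p''\<close> works.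
\<close>

lemma cone_exactI:
  assumes P: "rmod_complex R P dP" and M: "rmod_complex R M d" and f: "chain_map R P dP M d f"
    and sur: "homology_map M d f i ` carrier (complex_homology P dP i) = carrier (complex_homology M d i)"
    and inj: "\<And>k. i = Suc k \<Longrightarrow> inj_on (homology_map M d f k) (carrier (complex_homology P dP k))"
  shows "cone_exact P dP M d f i"
  unfolding cone_exact_def
proof (intro ballI impI)
  fix p c assume p: "p \<in> carrier (P (i - 1))" and c: "c \<in> carrier (M i)"
    and dp: "dP (i - 1) p = \<one>\<^bsub>P (i - 1 - 1)\<^esub>" and p0: "i = 0 \<longrightarrow> p = \<one>\<^bsub>P 0\<^esub>" and dc: "d i c = f (i - 1) p"
  note Pd = rmod_complexD[OF P] and Md = rmod_complexD[OF M] and fd = chain_mapD[OF f]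
  interpret P: comm_group "P i" by (rule right_moduleD(1)[OF Pd(1)])
  interpret P': comm_group "P (i - 1)" by (rule right_moduleD(1)[OF Pd(1)])
  interpret M: comm_group "M i" by (rule right_moduleD(1)[OF Md(1)])
  interpret M': comm_group "M (i - 1)" by (rule right_moduleD(1)[OF Md(1)])
  interpret f: group_hom "P i" "M i" "f i"
    using fd(1)[of i] by (intro rmod_hom_group_hom right_moduleD(1)[OF Pd(1)] right_moduleD(1)[OF Md(1)]) simp
  interpret d: group_hom "M i" "M (i - 1)" "d i"
    using Md(2)[of i] by (intro rmod_hom_group_hom right_moduleD(1)[OF Md(1)]) simp
  interpret dP: group_hom "P i" "P (i - 1)" "dP i"
    using Pd(2)[of i] by (intro rmod_hom_group_hom right_moduleD(1)[OF Pd(1)]) simp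
  obtain p'' where p'': "p'' \<in> carrier (P i)" "dP i p'' = p" "d i (f i p'') = f (i - 1) p"
  proof (cases i)
    case 0
    have "f 0 \<one>\<^bsub>P 0\<^esub> = \<one>\<^bsub>M 0\<^esub>" by (rule rmod_hom_one[OF fd(1) Pd(1) Md(1)])
    moreover have "dP 0 \<one>\<^bsub>P 0\<^esub> = \<one>\<^bsub>P 0\<^esub>" "d 0 \<one>\<^bsub>M 0\<^esub> = \<one>\<^bsub>M 0\<^esub>"
      using Pd(3) Md(3) P.one_closed M.one_closed 0 by simp_all
    ultimately show ?thesis using 0 p0 P.one_closed by (intro that[of "\<one>\<^bsub>P i\<^esub>"]) simp_all
  next
    case (Suc k)
    have "p \<in> cycles P dP k" using p dp Suc by (simp add: cycles_def kernel_def)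
    moreover have "f k p \<in> boundaries M d k"
      unfolding boundaries_def using dc c Suc by (intro image_eqI[of _ _ c]) simp_all
    ultimately have "p \<in> boundaries P dP k" using homology_map_injD[OF P M f inj[OF Suc]] by blast
    then obtain u where u: "u \<in> carrier (P i)" "dP i u = p" using Suc by (auto simp: boundaries_def)
    moreover have "d i (f i u) = f (i - 1) p" using fd(2)[of u k] u Suc by simp
    ultimately show ?thesis using that by blast
  qed
  have "c \<otimes>\<^bsub>M i\<^esub> inv\<^bsub>M i\<^esub> f i p'' \<in> cycles M d i"
  proof -
    have fp: "f i p'' \<in> carrier (M i)" by (rule f.hom_closed[OF p''(1)])
    have "d i (c \<otimes>\<^bsub>M i\<^esub> inv\<^bsub>M i\<^esub> f i p'') = d i c \<otimes>\<^bsub>M (i - 1)\<^esub> inv\<^bsub>M (i - 1)\<^esub> d i (f i p'')"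
      by (simp only: d.hom_mult[OF c M.inv_closed[OF fp]] d.hom_inv[OF fp])
    also have "\<dots> = \<one>\<^bsub>M (i - 1)\<^esub>"
      unfolding p''(3) dc[symmetric] by (rule M'.r_inv[OF d.hom_closed[OF c]])
    finally show ?thesis
      unfolding cycles_def kernel_def using M.m_closed[OF c M.inv_closed[OF fp]] by simp
  qed
  from homology_map_surjD[OF P M sur this]
  obtain y c' where y: "y \<in> cycles P dP i" and c': "c' \<in> carrier (M (Suc i))"
    and eq: "c \<otimes>\<^bsub>M i\<^esub> inv\<^bsub>M i\<^esub> f i p'' = d (Suc i) c' \<otimes>\<^bsub>M i\<^esub> f i y"
    by (elim bexE) (rule that)
  have yc: "y \<in> carrier (P i)" "dP i y = \<one>\<^bsub>P (i - 1)\<^esub>" using y by (auto simp: cycles_def kernel_def)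
  have dc': "d (Suc i) c' \<in> carrier (M i)" using rmod_homD(1)[OF Md(2)[of "Suc i"] c'] by simp
  have "c = (c \<otimes>\<^bsub>M i\<^esub> inv\<^bsub>M i\<^esub> f i p'') \<otimes>\<^bsub>M i\<^esub> f i p''" using c p'' by (simp add: M.m_assoc)
  also have "\<dots> = f i (y \<otimes>\<^bsub>P i\<^esub> p'') \<otimes>\<^bsub>M i\<^esub> d (Suc i) c'"
    unfolding eq using yc p'' dc' by (simp add: M.m_ac)
  finally show "\<exists>p'\<in>carrier (P i). \<exists>c'\<in>carrier (M (Suc i)). dP i p' = p \<and> c = f i p' \<otimes>\<^bsub>M i\<^esub> d (Suc i) c'"
  proof (intro bexI[of _ "y \<otimes>\<^bsub>P i\<^esub> p''"] bexI[of _ c'] conjI)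
    show "dP i (y \<otimes>\<^bsub>P i\<^esub> p'') = p"
      unfolding dP.hom_mult[OF yc(1) p''(1)] yc(2) p''(2) by (rule P'.l_one[OF p])
  qed (use yc p'' c' in simp_all)
qed

lemma finite_typeD:
  assumes M: "rmod_complex R M d" and ft: "finite_type R q M d"
  obtains P :: "nat \<Rightarrow> (nat \<Rightarrow> 'r::ring_1, 'r) rmodule" and dP f where
    "rmod_complex R P dP" "\<And>n. fg_projective R (P n)" "chain_map R P dP M d f"
    "\<And>i. i \<le> q \<Longrightarrow> cone_exact P dP M d f i"
proof -
  from ft obtain P :: "nat \<Rightarrow> (nat \<Rightarrow> 'r, 'r) rmodule" and dP f where
    P: "rmod_complex R P dP" "\<forall>n. fg_projective R (P n)" "chain_map R P dP M d f"
    and iso: "\<forall>i<q. homology_map M d f i \<in> iso (complex_homology P dP i) (complex_homology M d i)"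
    and epi: "homology_map M d f q \<in> epi (complex_homology P dP q) (complex_homology M d q)"
    unfolding finite_type_def by blast
  have "cone_exact P dP M d f i" if "i \<le> q" for i
  proof (rule cone_exactI[OF P(1) M P(3)])
    show "homology_map M d f i ` carrier (complex_homology P dP i) = carrier (complex_homology M d i)"
      using iso epi that by (cases "i = q") (auto simp: iso_def epi_def bij_betw_def)
    show "inj_on (homology_map M d f k) (carrier (complex_homology P dP k))" if "i = Suc k" for k
      using iso that \<open>i \<le> q\<close> by (auto simp: iso_def bij_betw_def)
  qed
  then show ?thesis using that[of P dP f] P by blast
qed

text \<open>
  The pair \<open>(\<kappa> v, \<mu> v)\<close> is a cycle of the mapping cone.  It is enough to bound it for the unit vectors
  \<open>v\<close>, because a homomorphism on a free module can be prescribed there.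
\<close>

lemma lift_from_free:
  assumes R: "subring_1 R" and P: "rmod_complex R P dP" and M: "rmod_complex R M d"
    and f: "chain_map R P dP M d f" and cone: "cone_exact P dP M d f n"
    and \<kappa>: "\<kappa> \<in> rmod_hom R (free_rmodule R k) (P (n - 1))"
    and \<mu>: "\<mu> \<in> rmod_hom R (free_rmodule R k) (M n)"
    and cyc: "\<And>v. v \<in> carrier (free_rmodule R k) \<Longrightarrow> dP (n - 1) (\<kappa> v) = \<one>\<^bsub>P (n - 1 - 1)\<^esub>"
    and zero: "\<And>v. v \<in> carrier (free_rmodule R k) \<Longrightarrow> n = 0 \<Longrightarrow> \<kappa> v = \<one>\<^bsub>P 0\<^esub>"
    and bd: "\<And>v. v \<in> carrier (free_rmodule R k) \<Longrightarrow> d n (\<mu> v) = f (n - 1) (\<kappa> v)"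
  shows "\<exists>G\<in>rmod_hom R (free_rmodule R k) (P n). \<exists>H\<in>rmod_hom R (free_rmodule R k) (M (Suc n)).
    \<forall>v\<in>carrier (free_rmodule R k). dP n (G v) = \<kappa> v \<and> \<mu> v = f n (G v) \<otimes>\<^bsub>M n\<^esub> d (Suc n) (H v)"
proof -
  note Pd = rmod_complexD[OF P] and Md = rmod_complexD[OF M] and fd = chain_mapD[OF f]
  have "\<exists>p c. p \<in> carrier (P n) \<and> c \<in> carrier (M (Suc n)) \<and> dP n p = \<kappa> (unit_coord j) \<and>
      \<mu> (unit_coord j) = f n p \<otimes>\<^bsub>M n\<^esub> d (Suc n) c" if "j < k" for j
  proof -
    note u = unit_coord_carrier[OF R that]
    show ?thesis
      using cone[unfolded cone_exact_def, rule_format, OF rmod_homD(1)[OF \<kappa> u] rmod_homD(1)[OF \<mu> u] cyc[OF u] zero[OF u] bd[OF u]]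
      by blast
  qed
  then obtain p c where pc: "\<And>j. j < k \<Longrightarrow> p j \<in> carrier (P n)" "\<And>j. j < k \<Longrightarrow> c j \<in> carrier (M (Suc n))"
    "\<And>j. j < k \<Longrightarrow> dP n (p j) = \<kappa> (unit_coord j)"
    "\<And>j. j < k \<Longrightarrow> \<mu> (unit_coord j) = f n (p j) \<otimes>\<^bsub>M n\<^esub> d (Suc n) (c j)"
    by metis
  define G where "G = combination (P n) k p"
  define H where "H = combination (M (Suc n)) k c"
  have G: "G \<in> rmod_hom R (free_rmodule R k) (P n)" unfolding G_def by (rule combination_hom[OF R Pd(1) pc(1)])
  have H: "H \<in> rmod_hom R (free_rmodule R k) (M (Suc n))" unfolding H_def by (rule combination_hom[OF R Md(1) pc(2)])
  have Gu: "G (unit_coord j) = p j" if "j < k" for j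
    unfolding G_def by (rule combination_unit[OF R Pd(1) pc(1) that])
  have Hu: "H (unit_coord j) = c j" if "j < k" for j
    unfolding H_def by (rule combination_unit[OF R Md(1) pc(2) that])
  have dH: "(\<lambda>v. d (Suc n) (H v)) \<in> rmod_hom R (free_rmodule R k) (M n)"
    using rmod_hom_compose[OF H Md(2)[of "Suc n"]] by simp
  have e1: "dP n (G v) = \<kappa> v" if "v \<in> carrier (free_rmodule R k)" for v
    by (rule rmod_hom_free_eqI[OF R Pd(1) rmod_hom_compose[OF G Pd(2)] \<kappa> _ that]) (simp add: Gu pc)
  have e2: "\<mu> v = f n (G v) \<otimes>\<^bsub>M n\<^esub> d (Suc n) (H v)" if "v \<in> carrier (free_rmodule R k)" for v
    by (rule rmod_hom_free_eqI[OF R Md(1) \<mu> rmod_hom_mult[OF rmod_hom_compose[OF G fd(1)] dH right_module_free[OF R] Md(1)] _ that])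
      (simp add: Gu Hu pc)
  show ?thesis using G H e1 e2 by blast
qed

text \<open>
  The comparison theorem for a free complex \<open>F\<close> with differential \<open>D\<close> and a chain map \<open>f\<close> that is
  connected up to degree \<open>q\<close>: the chain map \<open>inc : F \<rightarrow> M\<close> factors as \<open>inc = f G + d H + H D\<close>.  In the
  step to degree \<open>m + 1\<close>, the pair \<open>(G (D v), inc v - H (D v))\<close> is a cycle of the mapping cone of \<open>f\<close>,
  and its bounding pair is \<open>(G v, H v)\<close>.  In degree \<open>0\<close> the term \<open>H D\<close> is absent, which is the
  reason for the case distinctions.
\<close>

lemma lift_up_to_homotopy:
  assumes R: "subring_1 R" and P: "rmod_complex R P dP" and M: "rmod_complex R M d"
    and f: "chain_map R P dP M d f" and cone: "\<And>n. n \<le> q \<Longrightarrow> cone_exact P dP M d f n"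
    and D: "\<And>n. Suc n \<le> q \<Longrightarrow> D (Suc n) \<in> rmod_hom R (free_rmodule R (c (Suc n))) (free_rmodule R (c n))"
    and DD: "\<And>n v. Suc (Suc n) \<le> q \<Longrightarrow> v \<in> carrier (free_rmodule R (c (Suc (Suc n)))) \<Longrightarrow>
        D (Suc n) (D (Suc (Suc n)) v) = (\<lambda>_. 0)"
    and inc: "\<And>n. n \<le> q \<Longrightarrow> inc n \<in> rmod_hom R (free_rmodule R (c n)) (M n)"
    and dinc: "\<And>n v. Suc n \<le> q \<Longrightarrow> v \<in> carrier (free_rmodule R (c (Suc n))) \<Longrightarrow>
        d (Suc n) (inc (Suc n) v) = inc n (D (Suc n) v)"
  shows "\<exists>G H. \<forall>n\<le>q. G n \<in> rmod_hom R (free_rmodule R (c n)) (P n) \<and>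
      H n \<in> rmod_hom R (free_rmodule R (c n)) (M (Suc n)) \<and>
      (\<forall>v\<in>carrier (free_rmodule R (c n)).
         dP n (G n v) = (if n = 0 then \<one>\<^bsub>P 0\<^esub> else G (n - 1) (D n v)) \<and>
         inc n v = f n (G n v) \<otimes>\<^bsub>M n\<^esub> d (Suc n) (H n v) \<otimes>\<^bsub>M n\<^esub>
           (if n = 0 then \<one>\<^bsub>M n\<^esub> else H (n - 1) (D n v)))"
    (is "\<exists>G H. \<forall>n\<le>q. ?Q G H n")
proof -
  note Pd = rmod_complexD[OF P] and Md = rmod_complexD[OF M] and fd = chain_mapD[OF f]
  note F = right_module_free[OF R]
  have "\<exists>G H. \<forall>n\<le>m. ?Q G H n" if "m \<le> q" for m
    using that
  proof (induction m)
    case 0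
    interpret M0: comm_group "M 0" by (rule right_moduleD(1)[OF Md(1)])
    have one: "dP 0 \<one>\<^bsub>P 0\<^esub> = \<one>\<^bsub>P 0\<^esub>" "f 0 \<one>\<^bsub>P 0\<^esub> = \<one>\<^bsub>M 0\<^esub>"
      using rmod_hom_one[OF Pd(2)[of 0] Pd(1) Pd(1)] rmod_hom_one[OF fd(1) Pd(1) Md(1)] by simp_all
    have "\<exists>G\<in>rmod_hom R (free_rmodule R (c 0)) (P 0). \<exists>H\<in>rmod_hom R (free_rmodule R (c 0)) (M (Suc 0)).
      \<forall>v\<in>carrier (free_rmodule R (c 0)). dP 0 (G v) = \<one>\<^bsub>P 0\<^esub> \<and> inc 0 v = f 0 (G v) \<otimes>\<^bsub>M 0\<^esub> d (Suc 0) (H v)"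
      by (rule lift_from_free[OF R P M f cone[OF 0]])
        (use rmod_hom_const_one[OF Pd(1)] inc[OF 0] one Md(3) rmod_homD(1)[OF inc[OF 0]] in simp_all)
    then obtain G H where GH: "G \<in> rmod_hom R (free_rmodule R (c 0)) (P 0)"
      "H \<in> rmod_hom R (free_rmodule R (c 0)) (M (Suc 0))"
      "\<forall>v\<in>carrier (free_rmodule R (c 0)). dP 0 (G v) = \<one>\<^bsub>P 0\<^esub> \<and> inc 0 v = f 0 (G v) \<otimes>\<^bsub>M 0\<^esub> d (Suc 0) (H v)"
      by blast
    have "inc 0 v \<in> carrier (M 0)" if "v \<in> carrier (free_rmodule R (c 0))" for v
      by (rule rmod_homD(1)[OF inc[OF 0] that])
    with GH show ?case
      by (intro exI[of _ "\<lambda>_. G"] exI[of _ "\<lambda>_. H"])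
        (auto simp del: free_rmodule_simps simp: M0.r_one[symmetric])
  next
    case (Suc m)
    then obtain G H where GH: "\<forall>n\<le>m. ?Q G H n" by auto
    then have Gm: "G m \<in> rmod_hom R (free_rmodule R (c m)) (P m)"
      and Hm: "H m \<in> rmod_hom R (free_rmodule R (c m)) (M (Suc m))" by blast+
    interpret Mm: comm_group "M m" by (rule right_moduleD(1)[OF Md(1)])
    interpret MS: comm_group "M (Suc m)" by (rule right_moduleD(1)[OF Md(1)])
    interpret dS: group_hom "M (Suc m)" "M m" "d (Suc m)"
      using Md(2)[of "Suc m"] by (intro rmod_hom_group_hom right_moduleD(1)[OF Md(1)]) simp
    let ?F = "free_rmodule R (c (Suc m))"
    note DS = D[OF Suc.prems]
    define \<kappa> where "\<kappa> v = G m (D (Suc m) v)" for v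
    define \<eta> where "\<eta> v = H m (D (Suc m) v)" for v
    define \<mu> where "\<mu> v = inc (Suc m) v \<otimes>\<^bsub>M (Suc m)\<^esub> inv\<^bsub>M (Suc m)\<^esub> \<eta> v" for v
    have \<kappa>: "\<kappa> \<in> rmod_hom R ?F (P m)" unfolding \<kappa>_def by (rule rmod_hom_compose[OF DS Gm])
    have \<eta>: "\<eta> \<in> rmod_hom R ?F (M (Suc m))" unfolding \<eta>_def by (rule rmod_hom_compose[OF DS Hm])
    have \<mu>: "\<mu> \<in> rmod_hom R ?F (M (Suc m))" unfolding \<mu>_def
      by (rule rmod_hom_mult[OF inc[OF Suc.prems] rmod_hom_inverse[OF \<eta> F Md(1)] F Md(1)])
    have key: "dP m (\<kappa> v) = \<one>\<^bsub>P (m - 1)\<^esub> \<and> d (Suc m) (\<mu> v) = f m (\<kappa> v)" if v: "v \<in> carrier ?F" for v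
    proof -
      define w where "w = D (Suc m) v"
      have w: "w \<in> carrier (free_rmodule R (c m))" unfolding w_def by (rule rmod_homD(1)[OF DS v])
      have Qw: "dP m (G m w) = (if m = 0 then \<one>\<^bsub>P 0\<^esub> else G (m - 1) (D m w))"
        "inc m w = f m (G m w) \<otimes>\<^bsub>M m\<^esub> d (Suc m) (H m w) \<otimes>\<^bsub>M m\<^esub> (if m = 0 then \<one>\<^bsub>M m\<^esub> else H (m - 1) (D m w))"
        using GH w by blast+
      have prev: "(if m = 0 then \<one>\<^bsub>P 0\<^esub> else G (m - 1) (D m w)) = \<one>\<^bsub>P (m - 1)\<^esub>
        \<and> (if m = 0 then \<one>\<^bsub>M m\<^esub> else H (m - 1) (D m w)) = \<one>\<^bsub>M m\<^esub>"
      proof (cases m)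
        case (Suc l)
        have "D m w = \<one>\<^bsub>free_rmodule R (c l)\<^esub>"
          using DD[of l v] Suc.prems v by (simp add: w_def Suc)
        moreover have "G l \<in> rmod_hom R (free_rmodule R (c l)) (P l)"
          "H l \<in> rmod_hom R (free_rmodule R (c l)) (M (Suc l))"
          using GH Suc by auto
        ultimately show ?thesis
          using Suc rmod_hom_one[OF _ F Pd(1)] rmod_hom_one[OF _ F Md(1)] by simp
      qed simp
      have fG: "f m (G m w) \<in> carrier (M m)" by (rule rmod_homD(1)[OF fd(1) rmod_homD(1)[OF Gm w]])
      have Hw: "H m w \<in> carrier (M (Suc m))" by (rule rmod_homD(1)[OF Hm w])
      have iv: "inc (Suc m) v \<in> carrier (M (Suc m))" by (rule rmod_homD(1)[OF inc[OF Suc.prems] v])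
      have "d (Suc m) (\<mu> v) = inc m w \<otimes>\<^bsub>M m\<^esub> inv\<^bsub>M m\<^esub> d (Suc m) (H m w)"
        using iv Hw dinc[OF Suc.prems v] by (simp add: \<mu>_def \<eta>_def w_def)
      also have "inc m w = f m (G m w) \<otimes>\<^bsub>M m\<^esub> d (Suc m) (H m w)"
        using Qw(2) prev fG Hw by simp
      finally have "d (Suc m) (\<mu> v) = f m (G m w)"
        using fG Hw by (simp add: Mm.m_assoc)
      then show ?thesis using Qw(1) prev by (simp add: \<kappa>_def w_def)
    qed
    have "\<exists>g\<in>rmod_hom R ?F (P (Suc m)). \<exists>h\<in>rmod_hom R ?F (M (Suc (Suc m))).
      \<forall>v\<in>carrier ?F. dP (Suc m) (g v) = \<kappa> v \<and> \<mu> v = f (Suc m) (g v) \<otimes>\<^bsub>M (Suc m)\<^esub> d (Suc (Suc m)) (h v)"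
      by (rule lift_from_free[OF R P M f cone[OF Suc.prems]]) (use \<kappa> \<mu> key in simp_all)
    then obtain g h where g: "g \<in> rmod_hom R ?F (P (Suc m))" and h: "h \<in> rmod_hom R ?F (M (Suc (Suc m)))"
      and gh: "\<And>v. v \<in> carrier ?F \<Longrightarrow> dP (Suc m) (g v) = \<kappa> v"
        "\<And>v. v \<in> carrier ?F \<Longrightarrow> \<mu> v = f (Suc m) (g v) \<otimes>\<^bsub>M (Suc m)\<^esub> d (Suc (Suc m)) (h v)"
      by blast
    have split: "inc (Suc m) v = \<mu> v \<otimes>\<^bsub>M (Suc m)\<^esub> \<eta> v" if v: "v \<in> carrier ?F" for v
      using rmod_homD(1)[OF inc[OF Suc.prems] v] rmod_homD(1)[OF \<eta> v] by (simp add: \<mu>_def MS.m_assoc)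
    have "?Q (G(Suc m := g)) (H(Suc m := h)) n" if n: "n \<le> Suc m" for n
    proof (cases "n = Suc m")
      case True
      then show ?thesis
        using g h gh split by (simp del: free_rmodule_simps add: \<kappa>_def \<eta>_def)
    next
      case False
      with n have nm: "n \<le> m" "n \<noteq> Suc m" "n - 1 \<noteq> Suc m" by simp_all
      have "?Q G H n" using GH nm(1) by blast
      then show ?thesis unfolding fun_upd_other[OF nm(2)] fun_upd_other[OF nm(3)] .
    qed
    then show ?case by blast
  qed
  then show ?thesis by blast
qed

section \<open>Contractions up to strictly positive terms\<close>

lemma supp_ge_uniform:
  assumes "finite A"
  shows "\<exists>N. \<forall>x\<in>A. f x \<in> supp_ge \<xi> N"
  using assms
proof (induction A rule: finite_induct)
  case (insert x A)
  then obtain N where N: "\<forall>x\<in>A. f x \<in> supp_ge \<xi> N" by blast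
  obtain N' where "f x \<in> supp_ge \<xi> N'" using supp_ge_exists by blast
  with N have "\<forall>y\<in>insert x A. f y \<in> supp_ge \<xi> (min N N')"
    by (auto intro: supp_ge_mono)
  then show ?case by blast
qed simp

lemma subring_1_nonneg:
  assumes "\<xi> \<in> characters" shows "subring_1 (nonneg_group_ring \<xi>)"
  unfolding subring_1_def nonneg_group_ring_eq_supp_ge
  using supp_ge_mult[OF assms, of _ 0 _ 0]
  by (auto simp: supp_ge_one[OF assms] supp_ge_uminus supp_ge_add)

text \<open>
  The image of a finitely generated module is generated by finitely many vectors with finitely many
  nonzero entries, which have a common lower bound; scalars supported where \<open>\<xi> \<ge> 0\<close> cannot lower it.
\<close>

lemma fg_projective_bounded_below:
  assumes \<xi>: "\<xi> \<in> characters" and P: "fg_projective (nonneg_group_ring \<xi>) P"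
    and \<psi>: "\<psi> \<in> rmod_hom (nonneg_group_ring \<xi>) P (free_rmodule UNIV m)"
  shows "\<exists>N. \<forall>x\<in>carrier P. \<forall>i. \<psi> x i \<in> supp_ge \<xi> N"
proof -
  let ?R = "nonneg_group_ring \<xi>"
  note R = subring_1_nonneg[OF \<xi>]
  obtain k \<iota> s where \<iota>: "\<iota> \<in> rmod_hom ?R P (free_rmodule ?R k)"
    and s: "s \<in> rmod_hom ?R (free_rmodule ?R k) P" and retr: "\<forall>x\<in>carrier P. s (\<iota> x) = x"
    using P unfolding fg_projective_def by blast
  have \<psi>s: "(\<lambda>v. \<psi> (s v)) \<in> rmod_hom ?R (free_rmodule ?R k) (free_rmodule UNIV m)"
    by (rule rmod_hom_compose[OF s \<psi>])
  obtain N where N: "\<forall>z\<in>{..<k} \<times> {..<m}. \<psi> (s (unit_coord (fst z))) (snd z) \<in> supp_ge \<xi> N"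
    using supp_ge_uniform[of "{..<k} \<times> {..<m}" "\<lambda>z. \<psi> (s (unit_coord (fst z))) (snd z)"] by blast
  have "\<psi> x i \<in> supp_ge \<xi> N" if x: "x \<in> carrier P" for x i
  proof (cases "i < m")
    case True
    have v: "\<iota> x \<in> carrier (free_rmodule ?R k)" by (rule rmod_homD(1)[OF \<iota> x])
    have "\<psi> x i = (\<Sum>j<k. \<psi> (s (unit_coord j)) i * \<iota> x j)"
      using rmod_hom_free_free[OF R subring_1_UNIV subset_UNIV \<psi>s v] retr x by simp
    also have "\<dots> \<in> supp_ge \<xi> N"
    proof (rule supp_ge_sum)
      fix j assume "j \<in> {..<k}"
      then have "\<psi> (s (unit_coord j)) i \<in> supp_ge \<xi> N" "\<iota> x j \<in> supp_ge \<xi> 0"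
        using N True v by (auto simp: nonneg_group_ring_eq_supp_ge)
      then show "\<psi> (s (unit_coord j)) i * \<iota> x j \<in> supp_ge \<xi> N"
        using supp_ge_mult[OF \<xi>, of _ N _ 0] by simp
    qed
    finally show ?thesis .
  next
    case False
    then show ?thesis using rmod_homD(1)[OF \<psi> x] by simp
  qed
  then show ?thesis by blast
qed

lemma character_unbounded:
  fixes t :: "'g::group_add"
  assumes \<xi>: "\<xi> \<in> characters" and t: "0 < \<xi> t"
  shows "\<exists>w. x \<le> \<xi> w"
proof -
  have mult: "\<xi> (((+) t ^^ n) 0) = real n * \<xi> t" for n
    by (induction n) (simp_all add: character_zero[OF \<xi>] character_add[OF \<xi>] algebra_simps)
  obtain n where "x < real n * \<xi> t" using reals_Archimedean3[OF t] by blast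
  then show ?thesis using mult[of n] by (intro exI[of _ "((+) t ^^ n) 0"]) simp
qed

text \<open>
  Here \<open>a n\<close> is the matrix of \<open>d n\<close>, and \<open>h n\<close> is the matrix of a map from degree \<open>n\<close> to degree \<open>n + 1\<close>,
  so the expression is the matrix of \<open>d h + h d - 1\<close>.  The lifting lemma is applied over the ring
  \<open>\<int>G\<^sub>\<xi>\<close> to the subcomplex spanned by suitable translates of the basis; the resulting homotopy is then
  extended \<open>\<int>G\<close>-linearly.
\<close>

lemma almost_contraction:
  fixes M :: "nat \<Rightarrow> ('m, 'g::group_add \<Rightarrow>\<^sub>0 int) rmodule"
  assumes M: "rmod_complex UNIV M d" and b: "\<And>n. rmodule_basis UNIV (M n) (c n) (b n)"
    and \<xi>: "\<xi> \<in> characters" and t: "0 < \<xi> t"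
    and ft: "finite_type (nonneg_group_ring \<xi>) q M d"
  defines "a \<equiv> \<lambda>n i j. coordinates UNIV (M (n - 1)) (c (n - 1)) (b (n - 1)) (d n (b n j)) i"
  shows "\<exists>h. \<forall>n\<le>q. \<forall>i<c n. \<forall>j<c n.
    (\<Sum>l<c (Suc n). a (Suc n) i l * h n l j) +
    (if n = 0 then 0 else \<Sum>l<c (n - 1). h (n - 1) i l * a n l j) - (if i = j then 1 else 0)
      \<in> positive_part \<xi>"
proof -
  let ?R = "nonneg_group_ring \<xi>"
  note R = subring_1_nonneg[OF \<xi>]
  note MU = rmod_complexD[OF M]
  have MR: "rmod_complex ?R M d" by (rule rmod_complex_mono[OF M subset_UNIV])
  note Md = rmod_complexD[OF MR]
  define co where "co n = coordinates UNIV (M n) (c n) (b n)" for n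
  have cp: "\<And>x. x \<in> carrier (M n) \<Longrightarrow> combination (M n) (c n) (b n) (co n x) = x"
    "\<And>v. v \<in> carrier (free_rmodule UNIV (c n)) \<Longrightarrow> co n (combination (M n) (c n) (b n) v) = v"
    "co n \<in> rmod_hom UNIV (M n) (free_rmodule UNIV (c n))" for n
    unfolding co_def using coordinates_props[OF MU(1)[of n] b[of n]] by blast+
  have bc: "b n j \<in> carrier (M n)" if "j < c n" for n j
    using b[of n] that by (simp add: rmodule_basis_def)
  have coR: "co n \<in> rmod_hom ?R (M n) (free_rmodule UNIV (c n))" for n
    by (rule rmod_hom_mono[OF cp(3) subset_UNIV])
  have co_inj: "x = y" if "x \<in> carrier (M n)" "y \<in> carrier (M n)" "co n x = co n y" for x y n
    using cp(1)[OF that(1)] cp(1)[OF that(2)] unfolding that(3) by (rule trans[OF sym])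
  have combU: "combination (M n) (c n) (b n) \<in> rmod_hom UNIV (free_rmodule UNIV (c n)) (M n)" for n
    by (rule combination_hom[OF subring_1_UNIV MU(1) bc])
  have a_eq: "a (Suc n) i j = co n (d (Suc n) (b (Suc n) j)) i" for n i j
    by (simp add: a_def co_def)
  have a_out: "a (Suc n) i j = 0" if "j < c (Suc n)" "c n \<le> i" for n i j
    using rmod_homD(1)[OF cp(3) rmod_homD(1)[OF MU(2)[of "Suc n"] bc[OF that(1)]]] that(2)
    by (simp add: a_eq)
  have co_d: "co n (d (Suc n) x) i = (\<Sum>j<c (Suc n). a (Suc n) i j * co (Suc n) x j)"
    if x: "x \<in> carrier (M (Suc n))" for n x i
  proof -
    have dh: "d (Suc n) \<in> rmod_hom UNIV (M (Suc n)) (M n)" using MU(2)[of "Suc n"] by simp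
    have "co n (d (Suc n) (combination (M (Suc n)) (c (Suc n)) (b (Suc n)) (co (Suc n) x))) i
      = (\<Sum>j<c (Suc n). co n (d (Suc n) (combination (M (Suc n)) (c (Suc n)) (b (Suc n)) (unit_coord j))) i * co (Suc n) x j)"
      by (rule rmod_hom_free_free[OF subring_1_UNIV subring_1_UNIV subset_UNIV
            rmod_hom_compose[OF rmod_hom_compose[OF combU dh] cp(3)] rmod_homD(1)[OF cp(3) x]])
    also have "\<dots> = (\<Sum>j<c (Suc n). a (Suc n) i j * co (Suc n) x j)"
      by (intro sum.cong) (simp_all add: combination_unit[OF subring_1_UNIV MU(1) bc] a_eq)
    finally show ?thesis by (simp add: cp(1)[OF x])
  qed
  obtain P :: "nat \<Rightarrow> (nat \<Rightarrow> 'g \<Rightarrow>\<^sub>0 int, 'g \<Rightarrow>\<^sub>0 int) rmodule" and dP f where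
    P: "rmod_complex ?R P dP" and fg: "\<And>n. fg_projective ?R (P n)" and f: "chain_map ?R P dP M d f"
    and cone: "\<And>n. n \<le> q \<Longrightarrow> cone_exact P dP M d f n"
    using finite_typeD[OF MR ft] by blast
  note fd = chain_mapD[OF f]
  have "\<exists>N. \<forall>n\<le>m. \<forall>x\<in>carrier (P n). \<forall>i. co n (f n x) i \<in> supp_ge \<xi> N" for m
  proof (induction m)
    case 0
    show ?case using fg_projective_bounded_below[OF \<xi> fg rmod_hom_compose[OF fd(1) coR], of 0] by simp
  next
    case (Suc m)
    then obtain N where N: "\<forall>n\<le>m. \<forall>x\<in>carrier (P n). \<forall>i. co n (f n x) i \<in> supp_ge \<xi> N" by blast
    obtain N' where N': "\<forall>x\<in>carrier (P (Suc m)). \<forall>i. co (Suc m) (f (Suc m) x) i \<in> supp_ge \<xi> N'"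
      using fg_projective_bounded_below[OF \<xi> fg rmod_hom_compose[OF fd(1) coR], of "Suc m"] by blast
    show ?case
      using N N' by (intro exI[of _ "min N N'"]) (auto simp: le_Suc_eq
          intro: supp_ge_mono[OF _ min.cobounded1] supp_ge_mono[OF _ min.cobounded2])
  qed
  then obtain N where N: "\<And>n x i. n \<le> q \<Longrightarrow> x \<in> carrier (P n) \<Longrightarrow> co n (f n x) i \<in> supp_ge \<xi> N"
    by blast
  let ?A = "Sigma {..q} (\<lambda>n. {..<c n} \<times> {..<c (Suc n)})"
  have "finite ?A" by simp
  from supp_ge_uniform[OF this, of "\<lambda>z. a (Suc (fst z)) (fst (snd z)) (snd (snd z))" \<xi>]
  obtain D0 where D0: "\<And>n i j. n \<le> q \<Longrightarrow> i < c n \<Longrightarrow> j < c (Suc n) \<Longrightarrow> a (Suc n) i j \<in> supp_ge \<xi> D0"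
    by fastforce
  obtain w where w: "max 0 (- D0) \<le> \<xi> w" using character_unbounded[OF \<xi> t] by blast
  obtain w' where w': "1 - N + real q * \<xi> w \<le> \<xi> w'" using character_unbounded[OF \<xi> t] by blast
  \<comment> \<open>Each step up in degree raises \<open>\<xi> (u n)\<close> by \<open>\<xi> w \<ge> - D0\<close>, which will make the entries of the
    differential in the translated basis nonnegative; \<open>w'\<close> keeps all values up to degree \<open>q\<close> below \<open>N\<close>.\<close>
  define u where "u n = ((+) w ^^ n) (- w')" for n
  have \<xi>u: "\<xi> (u n) = real n * \<xi> w - \<xi> w'" for n
    unfolding u_def by (induction n) (simp_all add: character_uminus[OF \<xi>] character_add[OF \<xi>] algebra_simps)
  have u_lt: "\<xi> (u n) < N" if "n \<le> q" for n
  proof -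
    have "real n * \<xi> w \<le> real q * \<xi> w" using that w by (intro mult_right_mono) auto
    then show ?thesis using w' by (simp add: \<xi>u)
  qed
  define U V :: "nat \<Rightarrow> 'g \<Rightarrow>\<^sub>0 int" where "U n = Poly_Mapping.single (u n) 1" and "V n = Poly_Mapping.single (- u n) 1" for n
  have UV: "U n * V n = 1" "V n * U n = 1" "U n * (V n * x) = x" "V n * (U n * x) = x" for n x
    by (simp_all add: U_def V_def mult_single mult.assoc[symmetric])
  have Uge: "U n \<in> supp_ge \<xi> (\<xi> (u n))" and Vge: "V n \<in> supp_ge \<xi> (- \<xi> (u n))" for n
    by (simp_all add: U_def V_def supp_ge_single character_uminus[OF \<xi>])
  \<comment> \<open>The matrix of the differential in the translated basis \<open>b n j \<cdot> u n\<close>.\<close>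
  define \<alpha> where "\<alpha> n i j = V (n - 1) * a n i j * U n" for n i j
  have \<alpha>R: "\<alpha> (Suc n) i j \<in> ?R" if "Suc n \<le> q" "i < c n" "j < c (Suc n)" for n i j
  proof -
    have "\<alpha> (Suc n) i j \<in> supp_ge \<xi> (- \<xi> (u n) + D0 + \<xi> (u (Suc n)))"
      unfolding \<alpha>_def diff_Suc_1 using that
      by (intro supp_ge_mult[OF \<xi>] Uge Vge D0) auto
    moreover have "0 \<le> - \<xi> (u n) + D0 + \<xi> (u (Suc n))" using w by (simp add: \<xi>u algebra_simps)
    ultimately show ?thesis unfolding nonneg_group_ring_eq_supp_ge by (rule supp_ge_mono)
  qed
  let ?F = "\<lambda>n. free_rmodule ?R (c n)"
  define D where "D n = combination (?F (n - 1)) (c n) (\<lambda>j i. \<alpha> n i j)" for n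
  have \<alpha>car: "(\<lambda>i. \<alpha> (Suc n) i j) \<in> carrier (?F n)" if "Suc n \<le> q" "j < c (Suc n)" for n j
    using \<alpha>R[OF that(1) _ that(2)] a_out[OF that(2)] by (auto simp: \<alpha>_def)
  have Dhom: "D (Suc n) \<in> rmod_hom ?R (?F (Suc n)) (?F n)" if "Suc n \<le> q" for n
    unfolding D_def diff_Suc_1 using that by (intro combination_hom[OF R right_module_free[OF R]] \<alpha>car)
  have Dval: "D (Suc n) v i = (\<Sum>j<c (Suc n). \<alpha> (Suc n) i j * v j)"
    if "Suc n \<le> q" "v \<in> carrier (?F (Suc n))" for n v i
    unfolding D_def diff_Suc_1 using combination_free[OF R \<alpha>car[OF that(1)] that(2)] by simp
  define inc where "inc n v = combination (M n) (c n) (b n) (\<lambda>i. U n * v i)" for n v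
  have shift: "(\<lambda>v i. U n * v i) \<in> rmod_hom ?R (?F n) (free_rmodule UNIV (c n))" for n
    by (rule rmod_homI) (auto simp: distrib_left mult.assoc)
  have incR: "inc n \<in> rmod_hom ?R (?F n) (M n)" for n
    unfolding inc_def by (rule rmod_hom_compose[OF shift rmod_hom_mono[OF combU subset_UNIV]])
  have co_inc: "co n (inc n v) = (\<lambda>i. U n * v i)" if "v \<in> carrier (?F n)" for n v
    unfolding inc_def by (rule cp(2)[OF rmod_homD(1)[OF shift that]])
  have dinc: "d (Suc n) (inc (Suc n) v) = inc n (D (Suc n) v)"
    if n: "Suc n \<le> q" and v: "v \<in> carrier (?F (Suc n))" for n v
  proof (rule co_inj)
    note iv = rmod_homD(1)[OF incR v] and Dv = rmod_homD(1)[OF Dhom[OF n] v]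
    show "d (Suc n) (inc (Suc n) v) \<in> carrier (M n)" using rmod_homD(1)[OF Md(2)[of "Suc n"] iv] by simp
    show "inc n (D (Suc n) v) \<in> carrier (M n)" by (rule rmod_homD(1)[OF incR Dv])
    show "co n (d (Suc n) (inc (Suc n) v)) = co n (inc n (D (Suc n) v))"
      unfolding co_inc[OF Dv]
      by (rule ext) (simp add: co_d[OF iv] co_inc[OF v] Dval[OF n v] \<alpha>_def sum_distrib_left mult.assoc UV)
  qed
  have DD: "D (Suc n) (D (Suc (Suc n)) v) = (\<lambda>_. 0)"
    if n: "Suc (Suc n) \<le> q" and v: "v \<in> carrier (?F (Suc (Suc n)))" for n v
  proof
    fix i
    have n': "Suc n \<le> q" using n by simp
    note Dv = rmod_homD(1)[OF Dhom[OF n] v]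
    note DDv = rmod_homD(1)[OF Dhom[OF n'] Dv]
    have "inc n (D (Suc n) (D (Suc (Suc n)) v)) = d (Suc n) (d (Suc (Suc n)) (inc (Suc (Suc n)) v))"
      by (simp only: dinc[OF n v] dinc[OF n' Dv])
    also have "\<dots> = \<one>\<^bsub>M n\<^esub>" using Md(4)[OF rmod_homD(1)[OF incR v]] by simp
    finally have "co n (inc n (D (Suc n) (D (Suc (Suc n)) v))) = (\<lambda>_. 0)"
      using rmod_hom_one[OF cp(3) MU(1) right_module_free[OF subring_1_UNIV]] by simp
    then have "U n * D (Suc n) (D (Suc (Suc n)) v) i = 0"
      unfolding co_inc[OF DDv] by (rule fun_cong)
    then show "D (Suc n) (D (Suc (Suc n)) v) i = 0" using UV(4)[of n] by (metis mult_zero_right)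
  qed
  obtain G H where GH: "\<forall>n\<le>q. G n \<in> rmod_hom ?R (?F n) (P n) \<and> H n \<in> rmod_hom ?R (?F n) (M (Suc n)) \<and>
      (\<forall>v\<in>carrier (?F n). dP n (G n v) = (if n = 0 then \<one>\<^bsub>P 0\<^esub> else G (n - 1) (D n v)) \<and>
         inc n v = f n (G n v) \<otimes>\<^bsub>M n\<^esub> d (Suc n) (H n v) \<otimes>\<^bsub>M n\<^esub>
           (if n = 0 then \<one>\<^bsub>M n\<^esub> else H (n - 1) (D n v)))"
    using lift_up_to_homotopy[OF R P MR f cone, where D = D and c = c and inc = inc, OF _ Dhom DD incR dinc]
    by blast
  \<comment> \<open>The homotopy on the translated basis, extended to \<open>b n j = (b n j \<cdot> u n) \<cdot> (u n)\<^sup>-\<^sup>1\<close>.\<close>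
  define h where "h n l j = co (Suc n) (H n (unit_coord j)) l * V n" for n l j
  have "(\<Sum>l<c (Suc n). a (Suc n) i l * h n l j) +
    (if n = 0 then 0 else \<Sum>l<c (n - 1). h (n - 1) i l * a n l j) - (if i = j then 1 else 0)
      \<in> positive_part \<xi>" if n: "n \<le> q" and i: "i < c n" and j: "j < c n" for n i j
  proof -
    note u = unit_coord_carrier[OF R j]
    have Gn: "G n \<in> rmod_hom ?R (?F n) (P n)" and Hn: "H n \<in> rmod_hom ?R (?F n) (M (Suc n))"
      and eq: "inc n (unit_coord j) = f n (G n (unit_coord j)) \<otimes>\<^bsub>M n\<^esub> d (Suc n) (H n (unit_coord j)) \<otimes>\<^bsub>M n\<^esub>
           (if n = 0 then \<one>\<^bsub>M n\<^esub> else H (n - 1) (D n (unit_coord j)))"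
      using GH n u by blast+
    interpret Mn: comm_group "M n" by (rule right_moduleD(1)[OF Md(1)])
    define T where "T = (if n = 0 then \<one>\<^bsub>M n\<^esub> else H (n - 1) (D n (unit_coord j)))"
    define X where "X = co n (f n (G n (unit_coord j))) i"
    have solve: "A + B - \<delta> = - Y" if "Z = Y + A + B" "Z = \<delta>"
      for A B Y Z \<delta> :: "'g \<Rightarrow>\<^sub>0 int"
      unfolding that(2)[symmetric] that(1) by (simp add: algebra_simps)
    have Gu: "G n (unit_coord j) \<in> carrier (P n)" by (rule rmod_homD(1)[OF Gn u])
    have Hu: "H n (unit_coord j) \<in> carrier (M (Suc n))" by (rule rmod_homD(1)[OF Hn u])
    have fG: "f n (G n (unit_coord j)) \<in> carrier (M n)" by (rule rmod_homD(1)[OF fd(1) Gu])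
    have dH: "d (Suc n) (H n (unit_coord j)) \<in> carrier (M n)"
      using rmod_homD(1)[OF Md(2)[of "Suc n"] Hu] by simp
    have T: "T \<in> carrier (M n) \<and> co n T i * V n = (if n = 0 then 0 else \<Sum>l<c (n - 1). h (n - 1) i l * a n l j)"
    proof (cases n)
      case 0
      then show ?thesis
        using rmod_hom_one[OF cp(3) MU(1) right_module_free[OF subring_1_UNIV], of n] Mn.one_closed
        by (simp add: T_def)
    next
      case (Suc m)
      have m: "Suc m \<le> q" using n Suc by simp
      have Hm: "H m \<in> rmod_hom ?R (?F m) (M n)" using GH m Suc by simp
      have uS: "unit_coord j \<in> carrier (?F (Suc m))" using u Suc by simp
      define w where "w = D (Suc m) (unit_coord j)"
      have wc: "w \<in> carrier (?F m)" unfolding w_def by (rule rmod_homD(1)[OF Dhom[OF m] uS])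
      have "combination (?F m) (c (Suc m)) (\<lambda>j i. \<alpha> (Suc m) i j) (unit_coord j) = (\<lambda>i. \<alpha> (Suc m) i j)"
        using \<alpha>car[OF m] j Suc by (intro combination_unit[OF R right_module_free[OF R]]) simp_all
      then have wl: "w l = \<alpha> (Suc m) l j" for l by (simp add: w_def D_def)
      have "co n (H m w) i = (\<Sum>l<c m. co n (H m (unit_coord l)) i * w l)"
        by (rule rmod_hom_free_free[OF R subring_1_UNIV subset_UNIV rmod_hom_compose[OF Hm coR] wc])
      then have "co n (H m w) i * V n = (\<Sum>l<c m. h m i l * a n l j)"
        using Suc by (simp add: wl \<alpha>_def h_def sum_distrib_right mult.assoc UV)
      moreover have "T = H m w" using Suc by (simp add: T_def w_def)
      ultimately show ?thesis using Suc rmod_homD(1)[OF Hm wc] by simp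
    qed
    have "co n (inc n (unit_coord j)) i = X + co n (d (Suc n) (H n (unit_coord j))) i + co n T i"
      unfolding eq T_def[symmetric] X_def
      using rmod_homD(2)[OF cp(3) Mn.m_closed[OF fG dH] conjunct1[OF T]] rmod_homD(2)[OF cp(3) fG dH]
      by simp
    then have "U n * unit_coord j i = X + (\<Sum>l<c (Suc n). a (Suc n) i l * co (Suc n) (H n (unit_coord j)) l) + co n T i"
      unfolding co_inc[OF u] co_d[OF Hu] .
    then have "U n * unit_coord j i * V n = X * V n + (\<Sum>l<c (Suc n). a (Suc n) i l * h n l j)
        + (if n = 0 then 0 else \<Sum>l<c (n - 1). h (n - 1) i l * a n l j)"
      using conjunct2[OF T] by (simp add: distrib_right sum_distrib_right h_def mult.assoc)
    moreover have "U n * unit_coord j i * V n = (if i = j then 1 else 0)"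
      by (simp add: unit_coord_def UV)
    \<comment> \<open>The error \<open>X\<close> comes from \<open>f (P n)\<close>, so it starts at \<open>N\<close>, above \<open>\<xi> (u n)\<close>.\<close>
    ultimately have "(\<Sum>l<c (Suc n). a (Suc n) i l * h n l j) +
      (if n = 0 then 0 else \<Sum>l<c (n - 1). h (n - 1) i l * a n l j) - (if i = j then 1 else 0) = - (X * V n)"
      by (rule solve)
    also have "\<dots> \<in> positive_part \<xi>"
    proof (rule supp_ge_imp_positive)
      show "- (X * V n) \<in> supp_ge \<xi> (N + - \<xi> (u n))"
        unfolding X_def by (intro supp_ge_uminus supp_ge_mult[OF \<xi>] N[OF n Gu] Vge)
      show "0 < N + - \<xi> (u n)" using u_lt[OF n] by simp
    qed
    finally show ?thesis .
  qed
  then show ?thesis by blast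
qed

section \<open>Lifting in covering spaces and deck transformations\<close>

text \<open>
  The set where two lifts agree is open and so is its complement: over an evenly covered
  neighbourhood, two lifts agree at a point exactly if they pass through the same sheet.
\<close>

lemma covering_lifts_agree:
  fixes f g :: "'t::topological_space \<Rightarrow> 'b::topological_space" and p :: "'b \<Rightarrow> 'a::topological_space"
  assumes cov: "covering_space E p X" and S: "connected S"
    and f: "continuous_on S f" "f ` S \<subseteq> E" and g: "continuous_on S g" "g ` S \<subseteq> E"
    and eq: "\<And>x. x \<in> S \<Longrightarrow> p (f x) = p (g x)"
    and a: "a \<in> S" "f a = g a" and x: "x \<in> S"
  shows "f x = g x"
proof (rule connected_induction_simple[OF S a(1) x, where P = "\<lambda>x. f x = g x"])
  show "f a = g a" by fact
next
  fix a assume a: "a \<in> S"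
  then have "p (f a) \<in> X" using f(2) covering_space_imp_surjective[OF cov] by blast
  then obtain T v where T: "p (f a) \<in> T" and v: "\<Union>v = E \<inter> p -` T"
    "\<forall>u\<in>v. openin (top_of_set E) u" "pairwise disjnt v" "\<forall>u\<in>v. \<exists>q. homeomorphism u T p q"
    using cov unfolding covering_space_def by meson
  have "f a \<in> \<Union>v" "g a \<in> \<Union>v" using v(1) T eq[OF a] f(2) g(2) a by auto
  then obtain u u' where u: "u \<in> v" "f a \<in> u" and u': "u' \<in> v" "g a \<in> u'" by blast
  let ?W = "(S \<inter> f -` u) \<inter> (S \<inter> g -` u')"
  have "openin (top_of_set S) (S \<inter> f -` u)" "openin (top_of_set S) (S \<inter> g -` u')"
    using v(2) u u' f g
    by (auto intro!: continuous_openin_preimage[of S f E] continuous_openin_preimage[of S g E])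
  then have "openin (top_of_set S) ?W" by blast
  moreover have "f y = g y" if x: "x \<in> ?W" "f x = g x" and y: "y \<in> ?W" for x y
  proof -
    have "\<not> disjnt u u'" using x by (auto simp: disjnt_iff)
    then have uu: "u' = u" using v(3) u u' by (auto simp: pairwise_def)
    obtain q where "homeomorphism u T p q" using v(4) u by blast
    then have "q (p z) = z" if "z \<in> u" for z using that by (simp add: homeomorphism_def)
    then show ?thesis using y eq[of y] uu by (metis IntE vimageE)
  qed
  ultimately show "\<exists>T. openin (top_of_set S) T \<and> a \<in> T \<and> (\<forall>x\<in>T. \<forall>y\<in>T. f x = g x \<longrightarrow> f y = g y)"
    using a u u' by (intro exI[of _ ?W]) blast
qed

text \<open>
  A lift over \<open>{0..x}\<close> extends to \<open>{0..y}\<close> if \<open>g\<close> maps the interval from \<open>x\<close> to \<open>y\<close> into an evenly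
  covered set.  Every point of the unit interval has a neighbourhood on which this applies, so connectedness carries
  the existence of a lift from \<open>0\<close> to \<open>1\<close>.
\<close>

lemma covering_lift_path_top:
  fixes p :: "'b::topological_space \<Rightarrow> 'a::topological_space"
  assumes cov: "covering_space E p X" and y: "y \<in> E"
    and g: "path g" "path_image g \<subseteq> X" "pathstart g = p y"
  obtains h where "path h" "path_image h \<subseteq> E" "pathstart h = y" "\<And>t. t \<in> {0..1} \<Longrightarrow> p (h t) = g t"
proof -
  define L where "L s h \<longleftrightarrow> continuous_on {0..s} h \<and> h ` {0..s} \<subseteq> E \<and> h 0 = y \<and> (\<forall>t\<in>{0..s}. p (h t) = g t)"
    for s :: real and h
  have "\<exists>h. L 1 h"
  proof (rule connected_induction_simple[of "{0..1::real}" 0 1 "\<lambda>s. \<exists>h. L s h"])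
    show "\<exists>h. L 0 h" using y g(3) by (intro exI[of _ "\<lambda>_. y"]) (simp add: L_def pathstart_def)
  next
    fix a :: real assume a: "a \<in> {0..1}"
    then have "g a \<in> X" using g(2) by (auto simp: path_image_def)
    then obtain T v where T: "g a \<in> T" "openin (top_of_set X) T" and v: "\<Union>v = E \<inter> p -` T"
      "\<forall>u\<in>v. \<exists>q. homeomorphism u T p q"
      using cov unfolding covering_space_def by meson
    have "openin (top_of_set {0..1}) ({0..1} \<inter> g -` T)"
      using g T by (intro continuous_openin_preimage[of _ _ X]) (auto simp: path_def path_image_def)
    then obtain e where e: "0 < e" "ball a e \<inter> {0..1} \<subseteq> {0..1} \<inter> g -` T"
      using a T unfolding openin_contains_ball by blast
    let ?W = "ball a e \<inter> {0..1::real}"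
    have conv: "convex ?W" by (intro convex_Int) auto
    have step: "\<exists>h. L y h" if x: "x \<in> ?W" and y: "y \<in> ?W" and h: "L x h" for x y h
    proof (cases "y \<le> x")
      case True
      then have "{0..y} \<subseteq> {0..x}" by auto
      with h have "L y h" by (auto simp: L_def intro: continuous_on_subset)
      then show ?thesis by blast
    next
      case False
      have seg: "{x..y} \<subseteq> ?W"
        using conv x y False by (metis closed_segment_eq_real_ivl1 convex_contains_segment nle_le)
      have "h x \<in> E" "p (h x) = g x" using h x by (auto simp: L_def)
      moreover have "g x \<in> T" using x e by auto
      ultimately have "h x \<in> \<Union>v" using v(1) by auto
      then obtain u where u: "u \<in> v" "h x \<in> u" by blast
      then obtain q where q: "homeomorphism u T p q" using v(2) by blast
      have gT: "g ` {x..y} \<subseteq> T" using seg e by auto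
      have uE: "u \<subseteq> E" using v(1) u by blast
      have qT: "q t \<in> u" "p (q t) = t" if "t \<in> T" for t using q that by (auto simp: homeomorphism_def)
      have "continuous_on {x..y} (\<lambda>t. q (g t))"
      proof (rule continuous_on_compose2[of T q])
        show "continuous_on T q" using q by (simp add: homeomorphism_def)
        show "continuous_on {x..y} g" using g(1) seg unfolding path_def by (blast intro: continuous_on_subset)
      qed (rule gT)
      moreover have "q (g x) = h x"
        using q u \<open>p (h x) = g x\<close> unfolding homeomorphism_def by metis
      ultimately have "continuous_on {0..y} (\<lambda>t. if t \<le> x then h t else q (g t))"
        using h x False by (intro continuous_on_cases_1) (auto simp: L_def elim!: continuous_on_subset)
      then have "L y (\<lambda>t. if t \<le> x then h t else q (g t))"
        using h gT qT uE x by (auto simp: L_def image_subset_iff subset_iff)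
      then show ?thesis by blast
    qed
    show "\<exists>T. openin (top_of_set {0..1}) T \<and> a \<in> T \<and> (\<forall>x\<in>T. \<forall>y\<in>T. (\<exists>h. L x h) \<longrightarrow> (\<exists>h. L y h))"
    proof (intro exI[of _ ?W] conjI ballI impI)
      show "openin (top_of_set {0..1}) ?W" using openin_open_Int[of "ball a e" "{0..1}"] by (simp add: Int_commute)
      show "a \<in> ?W" using a e by simp
    qed (use step in blast)
  qed auto
  then obtain h where "L 1 h" by blast
  then show ?thesis
    by (intro that[of h]) (auto simp: L_def path_def path_image_def pathstart_def)
qed

text \<open>
  The constant loops at two points are homotopic, and the homotopy traces out a path between them.
\<close>

lemma simply_connected_imp_connected_top:
  fixes S :: "'b::topological_space set"
  assumes "simply_connected S"
  shows "connected S"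
proof -
  have "path_component S a b" if "a \<in> S" "b \<in> S" for a b
  proof -
    have "homotopic_loops S (\<lambda>_. a) (\<lambda>_. b)"
      by (rule assms[unfolded simply_connected_def, rule_format])
        (use that in \<open>auto simp: path_def path_image_def pathstart_def pathfinish_def\<close>)
    then show ?thesis using homotopic_loops_imp_path_component_value[of S "\<lambda>_. a" "\<lambda>_. b" 0] by simp
  qed
  then show ?thesis
    by (intro path_connected_imp_connected) (simp add: path_connected_component)
qed

lemma loop_class_eqI:
  assumes "homotopic_paths X \<gamma> \<delta>"
  shows "loop_class X x0 \<gamma> = loop_class X x0 \<delta>"
  using assms unfolding loop_class_def by (blast intro: homotopic_paths_trans homotopic_paths_sym)

lemma deck_path:
  assumes cov: "universal_cover E p X" and y0: "y0 \<in> E"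
    and \<phi>: "\<phi> \<in> iso (fundamental_group X (p y0)) type_group"
    and act: "deck_action X E p y0 \<phi> act"
  shows "\<exists>\<gamma>. path \<gamma> \<and> path_image \<gamma> \<subseteq> E \<and> pathstart \<gamma> = y0 \<and> pathfinish \<gamma> = act g y0 \<and>
    p (pathfinish \<gamma>) = p y0 \<and> p \<circ> \<gamma> \<in> loops X (p y0) \<and> \<phi> (loop_class X (p y0) (p \<circ> \<gamma>)) = g"
proof -
  have cv: "covering_space E p X" using cov by (simp add: universal_cover_def)
  have "g \<in> \<phi> ` carrier (fundamental_group X (p y0))"
    using \<phi> by (simp add: iso_def bij_betw_def type_group_def)
  then obtain l where l: "l \<in> loops X (p y0)" "\<phi> (loop_class X (p y0) l) = g"
    by (auto simp: fundamental_group_def)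
  then have ll: "path l" "path_image l \<subseteq> X" "pathstart l = p y0" "pathfinish l = p y0"
    by (auto simp: loops_def)
  obtain \<gamma> where \<gamma>: "path \<gamma>" "path_image \<gamma> \<subseteq> E" "pathstart \<gamma> = y0" "\<And>t. t \<in> {0..1} \<Longrightarrow> p (\<gamma> t) = l t"
    using covering_lift_path_top[OF cv y0 ll(1-3)] by blast
  have h: "homotopic_paths X l (p \<circ> \<gamma>)" using ll \<gamma>(4) by (intro homotopic_paths_eq) auto
  have fin: "p (pathfinish \<gamma>) = p y0" using \<gamma>(4)[of 1] ll(4) by (simp add: pathfinish_def)
  have cls: "\<phi> (loop_class X (p y0) (p \<circ> \<gamma>)) = g" using l(2) loop_class_eqI[OF h] by simp
  have "act (\<phi> (loop_class X (p y0) (p \<circ> \<gamma>))) y0 = pathfinish \<gamma>"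
    using act \<gamma> fin unfolding deck_action_def by blast
  moreover have "p \<circ> \<gamma> \<in> loops X (p y0)"
    using homotopic_paths_imp_path[OF h] homotopic_paths_imp_subset[OF h] \<gamma>(3) fin
    by (auto simp: loops_def pathstart_compose pathfinish_compose)
  ultimately show ?thesis using \<gamma>(1-3) fin cls by (intro exI[of _ \<gamma>]) simp
qed

lemma deck_action_homeo:
  assumes "deck_action X E p y0 \<phi> act"
  shows "continuous_on E (act g)" "act g ` E = E" "inj_on (act g) E" "\<And>y. y \<in> E \<Longrightarrow> p (act g y) = p y"
proof -
  have h: "homeomorphic_map (top_of_set E) (top_of_set E) (act g)" and pe: "\<forall>y\<in>E. p (act g y) = p y"
    using assms unfolding deck_action_def by blast+
  show "continuous_on E (act g)" using homeomorphic_imp_continuous_map[OF h] by (simp add: continuous_map_in_subtopology)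
  show "act g ` E = E" using homeomorphic_imp_surjective_map[OF h] by simp
  show "inj_on (act g) E" using homeomorphic_imp_injective_map[OF h] by simp
  show "\<And>y. y \<in> E \<Longrightarrow> p (act g y) = p y" using pe by blast
qed

text \<open>
  If \<open>\<gamma>\<close> and \<open>\<delta>\<close> are the lifts of loops representing \<open>g\<close> and \<open>h\<close>, then \<open>\<gamma>\<close> followed by the translate of \<open>\<delta>\<close>
  by \<open>g\<close> is a lift of the product loop.  So the two sides agree at the base point, and both are lifts of
  \<open>p\<close>.
\<close>

lemma deck_action_add:
  fixes act :: "'g::group_add \<Rightarrow> 'b::topological_space \<Rightarrow> 'b"
  assumes cov: "universal_cover E p X" and y0: "y0 \<in> E"
    and \<phi>: "\<phi> \<in> iso (fundamental_group X (p y0)) type_group"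
    and act: "deck_action X E p y0 \<phi> act" and y: "y \<in> E"
  shows "act (g + h) y = act g (act h y)"
proof -
  note ah = deck_action_homeo[OF act]
  have cv: "covering_space E p X" and conn: "connected E"
    using cov simply_connected_imp_connected_top unfolding universal_cover_def by blast+
  obtain \<gamma> where \<gamma>: "path \<gamma>" "path_image \<gamma> \<subseteq> E" "pathstart \<gamma> = y0" "pathfinish \<gamma> = act g y0"
    "p (pathfinish \<gamma>) = p y0" "p \<circ> \<gamma> \<in> loops X (p y0)" "\<phi> (loop_class X (p y0) (p \<circ> \<gamma>)) = g"
    using deck_path[OF cov y0 \<phi> act, of g] by (elim exE conjE) (rule that)
  obtain \<delta> where \<delta>: "path \<delta>" "path_image \<delta> \<subseteq> E" "pathstart \<delta> = y0" "pathfinish \<delta> = act h y0"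
    "p (pathfinish \<delta>) = p y0" "p \<circ> \<delta> \<in> loops X (p y0)" "\<phi> (loop_class X (p y0) (p \<circ> \<delta>)) = h"
    using deck_path[OF cov y0 \<phi> act, of h] by (elim exE conjE) (rule that)
  define \<zeta> where "\<zeta> = \<gamma> +++ (act g \<circ> \<delta>)"
  have pd: "path (act g \<circ> \<delta>)" using \<delta>(1) continuous_on_subset[OF ah(1) \<delta>(2)] by (rule path_continuous_image)
  have sd: "pathstart (act g \<circ> \<delta>) = act g y0" using \<delta>(3) by (simp add: pathstart_compose)
  have fd: "pathfinish (act g \<circ> \<delta>) = act g (act h y0)" using \<delta>(4) by (simp add: pathfinish_compose)
  have id: "path_image (act g \<circ> \<delta>) \<subseteq> E" using \<delta>(2) ah(2) by (auto simp: path_image_compose)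
  have \<zeta>: "path \<zeta>" "path_image \<zeta> \<subseteq> E" "pathstart \<zeta> = y0" "pathfinish \<zeta> = act g (act h y0)"
    using \<gamma> pd sd fd id by (auto simp: \<zeta>_def path_image_join)
  have hy: "act h y0 \<in> E" using ah(2)[of h] y0 by blast
  have p\<zeta>: "p (pathfinish \<zeta>) = p y0" using \<zeta>(4) ah(4) hy y0 by simp
  have actz: "act (\<phi> (loop_class X (p y0) (p \<circ> \<zeta>))) y0 = pathfinish \<zeta>"
    using act \<zeta> p\<zeta> unfolding deck_action_def by blast
  have L: "path (p \<circ> \<gamma>)" "path_image (p \<circ> \<gamma>) \<subseteq> X" "pathstart (p \<circ> \<gamma>) = p y0" "pathfinish (p \<circ> \<gamma>) = p y0"
    "path (p \<circ> \<delta>)" "path_image (p \<circ> \<delta>) \<subseteq> X" "pathstart (p \<circ> \<delta>) = p y0" "pathfinish (p \<circ> \<delta>) = p y0"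
    using \<gamma>(6) \<delta>(6) by (auto simp: loops_def)
  have hom1: "homotopic_paths X (p \<circ> \<delta>) (p \<circ> (act g \<circ> \<delta>))"
  proof (rule homotopic_paths_eq[OF L(5,6)])
    fix t :: real assume "t \<in> {0..1}"
    then have "\<delta> t \<in> E" using \<delta>(2) by (auto simp: path_image_def)
    then show "(p \<circ> \<delta>) t = (p \<circ> (act g \<circ> \<delta>)) t" using ah(4)[of "\<delta> t" g] by simp
  qed
  have homz: "homotopic_paths X ((p \<circ> \<gamma>) +++ (p \<circ> \<delta>)) (p \<circ> \<zeta>)"
    unfolding \<zeta>_def path_compose_join
    using L by (intro homotopic_paths_join hom1) auto
  let ?P = "fundamental_group X (p y0)"
  have "loop_class X (p y0) (p \<circ> \<zeta>)
    = loop_class X (p y0) (p \<circ> \<gamma>) \<otimes>\<^bsub>?P\<^esub> loop_class X (p y0) (p \<circ> \<delta>)" (is "?l = ?r")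
  proof (rule Set.set_eqI)
    fix \<eta>
    have "homotopic_paths X (p \<circ> \<zeta>) \<eta> \<longleftrightarrow> homotopic_paths X ((p \<circ> \<gamma>) +++ (p \<circ> \<delta>)) \<eta>"
      using homz by (meson homotopic_paths_sym homotopic_paths_trans)
    moreover have "homotopic_paths X ((p \<circ> \<gamma>) +++ (p \<circ> \<delta>)) \<eta> \<longleftrightarrow>
      (\<exists>\<gamma>'\<in>loop_class X (p y0) (p \<circ> \<gamma>). \<exists>\<delta>'\<in>loop_class X (p y0) (p \<circ> \<delta>). homotopic_paths X (\<gamma>' +++ \<delta>') \<eta>)"
    proof
      assume "homotopic_paths X ((p \<circ> \<gamma>) +++ (p \<circ> \<delta>)) \<eta>"
      moreover have "p \<circ> \<gamma> \<in> loop_class X (p y0) (p \<circ> \<gamma>)" "p \<circ> \<delta> \<in> loop_class X (p y0) (p \<circ> \<delta>)"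
        using \<gamma>(6) \<delta>(6) L by (auto simp: loop_class_def)
      ultimately show "\<exists>\<gamma>'\<in>loop_class X (p y0) (p \<circ> \<gamma>). \<exists>\<delta>'\<in>loop_class X (p y0) (p \<circ> \<delta>). homotopic_paths X (\<gamma>' +++ \<delta>') \<eta>"
        by blast
    next
      assume "\<exists>\<gamma>'\<in>loop_class X (p y0) (p \<circ> \<gamma>). \<exists>\<delta>'\<in>loop_class X (p y0) (p \<circ> \<delta>). homotopic_paths X (\<gamma>' +++ \<delta>') \<eta>"
      then obtain \<gamma>' \<delta>' where "homotopic_paths X (p \<circ> \<gamma>) \<gamma>'" "homotopic_paths X (p \<circ> \<delta>) \<delta>'"
        and e: "homotopic_paths X (\<gamma>' +++ \<delta>') \<eta>"
        by (auto simp: loop_class_def)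
      then have "homotopic_paths X ((p \<circ> \<gamma>) +++ (p \<circ> \<delta>)) (\<gamma>' +++ \<delta>')"
        using L by (intro homotopic_paths_join) auto
      then show "homotopic_paths X ((p \<circ> \<gamma>) +++ (p \<circ> \<delta>)) \<eta>" using e by (rule homotopic_paths_trans)
    qed
    ultimately show "\<eta> \<in> ?l \<longleftrightarrow> \<eta> \<in> ?r"
      by (auto simp: loop_class_def[of _ _ "p \<circ> \<zeta>"] fundamental_group_def)
  qed
  moreover have "\<phi> \<in> hom ?P type_group" using \<phi> by (simp add: iso_def)
  moreover have "loop_class X (p y0) (p \<circ> \<gamma>) \<in> carrier ?P" "loop_class X (p y0) (p \<circ> \<delta>) \<in> carrier ?P"
    using \<gamma>(6) \<delta>(6) by (auto simp: fundamental_group_def)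
  ultimately have "\<phi> (loop_class X (p y0) (p \<circ> \<zeta>)) = g + h"
    using \<gamma>(7) \<delta>(7) by (simp add: hom_def type_group_def)
  then have base: "act (g + h) y0 = act g (act h y0)" using actz \<zeta>(4) by simp
  show ?thesis
  proof (rule covering_lifts_agree[OF cv conn, where f = "act (g + h)" and g = "\<lambda>y. act g (act h y)" and a = y0])
    show "continuous_on E (\<lambda>y. act g (act h y))"
      using ah(1)[of g] ah(1)[of h] ah(2)[of h] by (intro continuous_on_compose2[of E "act g" E "act h"]) auto
    show "(\<lambda>y. act g (act h y)) ` E \<subseteq> E" "act (g + h) ` E \<subseteq> E" using ah(2) by blast+
    show "p (act (g + h) x) = p (act g (act h x))" if "x \<in> E" for x
      using ah(4) ah(2)[of h] that by (metis imageI)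
  qed (use ah(1) base y y0 in auto)
qed

text \<open>
  By the preceding lemma \<open>act 0\<close> is idempotent, and it is injective.
\<close>

lemma deck_action_zero:
  fixes act :: "'g::group_add \<Rightarrow> 'b::topological_space \<Rightarrow> 'b"
  assumes "universal_cover E p X" "y0 \<in> E" "\<phi> \<in> iso (fundamental_group X (p y0)) type_group"
    and act: "deck_action X E p y0 \<phi> act" and y: "y \<in> E"
  shows "act 0 y = y"
proof -
  have "act 0 (act 0 y) = act 0 y" using deck_action_add[OF assms, of 0 0] by simp
  moreover have "act 0 y \<in> E" using deck_action_homeo(2)[OF act, of 0] y by blast
  ultimately show ?thesis using deck_action_homeo(3)[OF act, of 0] y by (auto dest: inj_onD)
qed

section \<open>Group ring modules from group actions\<close>

text \<open>
  A group action on an abelian group is extended to a right module structure over the integral group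
  ring, with \<open>c \<cdot> g = g\<^sup>-\<^sup>1 c\<close>.
\<close>

locale group_ring_action = C: comm_group C
  for C :: "('m, 'c) monoid_scheme" (structure) and act :: "'g::group_add \<Rightarrow> 'm \<Rightarrow> 'm" +
  assumes act_hom: "act g \<in> hom C C"
    and act_add: "c \<in> carrier C \<Longrightarrow> act (g + h) c = act g (act h c)"
    and act_zero: "c \<in> carrier C \<Longrightarrow> act 0 c = c"
begin

definition scale :: "'m \<Rightarrow> ('g \<Rightarrow>\<^sub>0 int) \<Rightarrow> 'm" where
  "scale c a = finprod C (\<lambda>g. act (- g) c [^] Poly_Mapping.lookup a g) (Poly_Mapping.keys a)"

lemma act_closed: "c \<in> carrier C \<Longrightarrow> act g c \<in> carrier C"
  using act_hom[of g] by (auto simp: hom_def)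

lemma scale_closed: "c \<in> carrier C \<Longrightarrow> scale c a \<in> carrier C"
  unfolding scale_def by (intro C.finprod_closed) (auto simp: act_closed)

lemma scale_superset:
  assumes c: "c \<in> carrier C" and S: "finite S" "Poly_Mapping.keys a \<subseteq> S"
  shows "scale c a = finprod C (\<lambda>g. act (- g) c [^] Poly_Mapping.lookup a g) S"
  unfolding scale_def using c S
  by (intro C.finprod_mono_neutral_cong_left) (auto simp: act_closed in_keys_iff)

lemma scale_single: "c \<in> carrier C \<Longrightarrow> scale c (Poly_Mapping.single g n) = act (- g) c [^] n"
  by (subst scale_superset[of _ "{g}"]) (auto simp: act_closed)

lemma scale_add:
  assumes c: "c \<in> carrier C"
  shows "scale c (a + b) = scale c a \<otimes> scale c b"
proof -
  let ?S = "Poly_Mapping.keys a \<union> Poly_Mapping.keys b"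
  have eq: "scale c x = finprod C (\<lambda>g. act (- g) c [^] Poly_Mapping.lookup x g) ?S"
    if "x \<in> {a, b, a + b}" for x
    using that c Poly_Mapping.keys_add[of a b] by (intro scale_superset) auto
  have "finprod C (\<lambda>g. act (- g) c [^] Poly_Mapping.lookup (a + b) g) ?S
    = finprod C (\<lambda>g. act (- g) c [^] Poly_Mapping.lookup a g \<otimes> act (- g) c [^] Poly_Mapping.lookup b g) ?S"
    using c by (intro C.finprod_cong') (auto simp: act_closed lookup_add C.int_pow_mult)
  also have "\<dots> = scale c a \<otimes> scale c b"
    using c eq[of a] eq[of b] by (simp add: C.finprod_multf act_closed Pi_def)
  finally show ?thesis using eq[of "a + b"] by simp
qed

lemma scale_mult_left:
  assumes c: "c \<in> carrier C" and d: "d \<in> carrier C"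
  shows "scale (c \<otimes> d) a = scale c a \<otimes> scale d a"
proof -
  have "scale (c \<otimes> d) a = finprod C (\<lambda>g. act (- g) c [^] Poly_Mapping.lookup a g
      \<otimes> act (- g) d [^] Poly_Mapping.lookup a g) (Poly_Mapping.keys a)"
    unfolding scale_def using c d
    by (intro C.finprod_cong') (auto simp: act_closed hom_mult[OF act_hom c d] C.int_pow_distrib)
  also have "\<dots> = scale c a \<otimes> scale d a"
    unfolding scale_def using c d by (intro C.finprod_multf) (auto simp: act_closed)
  finally show ?thesis .
qed

lemma act_int_pow: "c \<in> carrier C \<Longrightarrow> act g (c [^] (n::int)) = act g c [^] n"
  using hom_int_pow[OF act_hom] C.is_group by blast

text \<open>
  Additivity in both group ring elements reduces this to single group elements, where the inverse in
  \<open>c \<cdot> g = g\<^sup>-\<^sup>1 c\<close> reverses the order of the factors.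
\<close>

lemma scale_times:
  assumes c: "c \<in> carrier C"
  shows "scale c (a * b) = scale (scale c a) b"
proof (induction a rule: poly_mapping_single_induct)
  case (single g m)
  show ?case
  proof (induction b rule: poly_mapping_single_induct)
    case (single h n)
    have "act (- (g + h)) c = act (- h) (act (- g) c)"
      using act_add[OF c, of "- h" "- g"] by (simp add: minus_add)
    then show ?case
      using c by (simp add: mult_single scale_single act_closed act_int_pow C.int_pow_pow)
  next
    case (sum b b')
    then show ?case
      using c by (simp add: distrib_left scale_add scale_closed)
  qed
next
  case (sum a a')
  then show ?case
    using c by (simp add: distrib_right scale_add scale_mult_left scale_closed)
qed

lemma scale_one: "c \<in> carrier C \<Longrightarrow> scale c 1 = c"
  using scale_single[of c 0 1] by (simp add: act_zero C.int_pow_1)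

end

lemma scale_equivariant:
  assumes "group_ring_action C act" "group_ring_action D act'" and d: "d \<in> hom C D"
    and eq: "\<And>g c. c \<in> carrier C \<Longrightarrow> d (act g c) = act' g (d c)" and c: "c \<in> carrier C"
  shows "d (group_ring_action.scale C act c a) = group_ring_action.scale D act' (d c) a"
proof -
  interpret C: group_ring_action C act by fact
  interpret D: group_ring_action D act' by fact
  have dc: "d x \<in> carrier D" if "x \<in> carrier C" for x using d that by (auto simp: hom_def)
  have "d (C.scale c a)
    = finprod D (\<lambda>g. d (act (- g) c [^]\<^bsub>C\<^esub> Poly_Mapping.lookup a g)) (Poly_Mapping.keys a)"
    unfolding C.scale_def using c
    by (intro finprod_hom[OF C.C.comm_group_axioms D.C.comm_group_axioms d]) (auto simp: C.act_closed)
  also have "\<dots> = D.scale (d c) a"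
    unfolding D.scale_def using c hom_int_pow[OF d] C.C.is_group D.C.is_group
    by (intro D.C.finprod_cong') (auto simp: C.act_closed D.act_closed dc eq)
  finally show ?thesis .
qed

section \<open>The cellular chain complex of the universal cover\<close>

lemma skeleton_mono: "k \<le> l \<Longrightarrow> cover_skeleton E p K k \<subseteq> cover_skeleton E p K l"
  unfolding cover_skeleton_def skeleton_def by (auto intro: order_trans)

lemma deck_skeleton:
  assumes "deck_action X E p y0 \<phi> act"
  shows "continuous_map (top_of_set (cover_skeleton E p K k)) (top_of_set (cover_skeleton E p K k)) (act g)"
    and "act g \<in> cover_skeleton E p K k \<rightarrow> cover_skeleton E p K k"
proof -
  note ah = deck_action_homeo[OF assms, where g = g]
  show *: "act g \<in> cover_skeleton E p K k \<rightarrow> cover_skeleton E p K k"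
    using ah(2,4) by (auto simp: cover_skeleton_def)
  have "continuous_on (cover_skeleton E p K k) (act g)"
    using ah(1) by (rule continuous_on_subset) (auto simp: cover_skeleton_def)
  with * show "continuous_map (top_of_set (cover_skeleton E p K k)) (top_of_set (cover_skeleton E p K k)) (act g)"
    by (auto simp: continuous_map_in_subtopology)
qed

lemma cell_group_action:
  fixes act :: "'g::group_add \<Rightarrow> 'b::topological_space \<Rightarrow> 'b"
  assumes cov: "universal_cover E p X" "y0 \<in> E" "\<phi> \<in> iso (fundamental_group X (p y0)) type_group"
    and act: "deck_action X E p y0 \<phi> act"
  shows "group_ring_action (cell_group E p K n) (cell_act E p K act n)"
proof -
  note ds = deck_skeleton[OF act, where K = K]
  have sub: "cover_skeleton E p K k \<subseteq> E" for k by (auto simp: cover_skeleton_def)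
  interpret comm_group "cell_group E p K n" by (simp add: cell_group_def)
  show ?thesis
  proof unfold_locales
    show "cell_act E p K act n g \<in> hom (cell_group E p K n) (cell_group E p K n)" for g
      unfolding cell_act_def cell_group_def by (rule hom_induced_hom)
    show "cell_act E p K act n (g + h) c = cell_act E p K act n g (cell_act E p K act n h c)" for g h c
    proof -
      have "cell_act E p K act n (g + h) = hom_induced (int n)
       (top_of_set (cover_skeleton E p K (int n))) (cover_skeleton E p K (int n - 1))
       (top_of_set (cover_skeleton E p K (int n))) (cover_skeleton E p K (int n - 1)) (act g \<circ> act h)"
        unfolding cell_act_def
      proof (rule hom_induced_eq)
        fix x assume "x \<in> topspace (top_of_set (cover_skeleton E p K (int n)))"
        then have "x \<in> E" using sub[of "int n"] by auto
        then show "act (g + h) x = (act g \<circ> act h) x" using deck_action_add[OF cov act] by simp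
      qed
      then show ?thesis
        unfolding cell_act_def by (simp add: hom_induced_compose'[OF ds ds])
    qed
    show "cell_act E p K act n 0 c = c" if "c \<in> carrier (cell_group E p K n)" for c
      unfolding cell_act_def
    proof (rule hom_induced_id_gen)
      show "act 0 x = x" if "x \<in> topspace (top_of_set (cover_skeleton E p K (int n)))" for x
        using that sub deck_action_zero[OF cov act] by auto
    qed (use that ds in \<open>auto simp: cell_group_def\<close>)
  qed
qed

lemma cell_module_simps:
  "carrier (cell_module E p K act n) = carrier (cell_group E p K n)"
  "monoid.mult (cell_module E p K act n) = monoid.mult (cell_group E p K n)"
  "one (cell_module E p K act n) = one (cell_group E p K n)"
  by (simp_all add: cell_module_def)

lemma cell_module_rscale:
  assumes "group_ring_action (cell_group E p K n) (cell_act E p K act n)"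
  shows "rscale (cell_module E p K act n)
    = group_ring_action.scale (cell_group E p K n) (cell_act E p K act n)"
  by (intro ext) (simp add: cell_module_def group_ring_action.scale_def[OF assms])

lemma right_module_cell_module:
  assumes ga: "group_ring_action (cell_group E p K n) (cell_act E p K act n)"
  shows "right_module UNIV (cell_module E p K act n)"
proof -
  interpret group_ring_action "cell_group E p K n" "cell_act E p K act n" by (rule ga)
  have "comm_group (cell_module E p K act n)"
    by (rule comm_groupI; unfold cell_module_simps) (simp_all add: C.m_ac C.l_inv_ex)
  then show ?thesis
    unfolding right_module_def cell_module_simps cell_module_rscale[OF ga]
    by (simp add: scale_closed scale_mult_left scale_add scale_times scale_one)
qed

lemma cell_boundary_hom:
  fixes act :: "'g::group_add \<Rightarrow> 'b::topological_space \<Rightarrow> 'b"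
  assumes ga: "\<And>n. group_ring_action (cell_group E p K n) (cell_act E p K act n)"
    and act: "deck_action X E p y0 \<phi> act"
  shows "cell_boundary E p K n \<in> rmod_hom UNIV (cell_module E p K act n) (cell_module E p K act (n - 1))"
proof (cases n)
  case 0
  have "cell_boundary E p K 0 = (\<lambda>_. one (cell_module E p K act 0))"
    by (simp add: cell_boundary_def cell_module_simps)
  then show ?thesis using 0 rmod_hom_const_one[OF right_module_cell_module[OF ga]] by simp
next
  case (Suc m)
  let ?S = "\<lambda>k. cover_skeleton E p K k"
  note ds = deck_skeleton[OF act, where K = K]
  have sub: "subtopology (top_of_set (?S (int (Suc m)))) (?S (int m)) = top_of_set (?S (int m))"
    using skeleton_mono[of "int m" "int (Suc m)" E p K] by (simp add: subtopology_subtopology Int_absorb1)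
  have d: "cell_boundary E p K (Suc m)
    = hom_relboundary (int (Suc m)) (top_of_set (?S (int (Suc m)))) (?S (int m)) (?S (int m - 1))"
    by (simp add: cell_boundary_def algebra_simps)
  have hom: "cell_boundary E p K (Suc m) \<in> hom (cell_group E p K (Suc m)) (cell_group E p K m)"
    using group_homomorphism_hom_relboundary[of "int (Suc m)" "top_of_set (?S (int (Suc m)))" "?S (int m)" "?S (int m - 1)"]
    unfolding d sub by (simp add: cell_group_def)
  have eq: "cell_boundary E p K (Suc m) (cell_act E p K act (Suc m) g c)
    = cell_act E p K act m g (cell_boundary E p K (Suc m) c)" for g c
    using fun_cong[OF naturality_hom_induced_relboundary[OF ds(1)[where k = "int (Suc m)" and g = g]
          ds(2)[where k = "int m" and g = g] ds(2)[where k = "int m - 1" and g = g],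
        of "int (Suc m)"], of c]
    unfolding d sub cell_act_def by simp
  show ?thesis
    unfolding Suc
  proof (rule rmod_homI)
    fix x assume "x \<in> carrier (cell_module E p K act (Suc m))"
    then show "cell_boundary E p K (Suc m) x \<in> carrier (cell_module E p K act (Suc m - 1))"
      unfolding cell_module_simps diff_Suc_1 by (rule hom_in_carrier[OF hom])
  next
    fix x y assume "x \<in> carrier (cell_module E p K act (Suc m))" "y \<in> carrier (cell_module E p K act (Suc m))"
    then show "cell_boundary E p K (Suc m) (x \<otimes>\<^bsub>cell_module E p K act (Suc m)\<^esub> y)
        = cell_boundary E p K (Suc m) x \<otimes>\<^bsub>cell_module E p K act (Suc m - 1)\<^esub> cell_boundary E p K (Suc m) y"
      unfolding cell_module_simps diff_Suc_1 by (rule hom_mult[OF hom])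
  next
    fix x a assume "x \<in> carrier (cell_module E p K act (Suc m))"
    then show "cell_boundary E p K (Suc m) (rscale (cell_module E p K act (Suc m)) x a)
      = rscale (cell_module E p K act (Suc m - 1)) (cell_boundary E p K (Suc m) x) a"
      unfolding cell_module_rscale[OF ga] cell_module_simps diff_Suc_1
      by (intro scale_equivariant[OF ga[of "Suc m"] ga[of m] hom] eq) assumption
  qed
qed

text \<open>
  Between the two connecting homomorphisms the composite passes through
  \<open>H\<^sub>n(X\<^sub>n) \<rightarrow> H\<^sub>n(X\<^sub>n, X\<^sub>n\<^sub>-\<^sub>1) \<rightarrow> H\<^sub>n\<^sub>-\<^sub>1(X\<^sub>n\<^sub>-\<^sub>1)\<close>, which is zero by the exact sequence of the pair.
\<close>

lemma cell_boundary_boundary: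
  assumes x: "x \<in> carrier (cell_group E p K (Suc n))"
  shows "cell_boundary E p K n (cell_boundary E p K (Suc n) x) = one (cell_group E p K (n - 1))"
proof (cases n)
  case 0
  then show ?thesis by (simp add: cell_boundary_def)
next
  case (Suc m)
  let ?T = "\<lambda>k. top_of_set (cover_skeleton E p K k)" and ?S = "\<lambda>k. cover_skeleton E p K k"
  have sub: "subtopology (?T (int (Suc k))) (?S (int k)) = ?T (int k)" for k
    using skeleton_mono[of "int k" "int (Suc k)" E p K] by (simp add: subtopology_subtopology Int_absorb1)
  have sub2: "subtopology (?T (2 + int m)) (?S (1 + int m)) = ?T (1 + int m)"
    "subtopology (?T (1 + int m)) (?S (int m)) = ?T (int m)"
    using sub[of "Suc m"] sub[of m] by (simp_all add: algebra_simps)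
  let ?z = "hom_boundary (2 + int m) (?T (2 + int m)) (?S (1 + int m)) x"
  have z: "?z \<in> carrier (homology_group (1 + int m) (?T (1 + int m)))"
    using hom_boundary_carrier[of "2 + int m" "?T (2 + int m)" "?S (1 + int m)" x] by (simp add: sub2)
  have "hom_induced (1 + int m) (?T (1 + int m)) {} (?T (1 + int m)) (?S (int m)) id ?z
      \<in> kernel (relative_homology_group (1 + int m) (?T (1 + int m)) (?S (int m)))
          (homology_group (int m) (?T (int m))) (hom_boundary (1 + int m) (?T (1 + int m)) (?S (int m)))"
    using homology_exactness_axiom_1[of "1 + int m" "?T (1 + int m)" "?S (int m)"] z
    by (auto simp: sub2)
  then have k: "hom_boundary (1 + int m) (?T (1 + int m)) (?S (int m))
      (hom_induced (1 + int m) (?T (1 + int m)) {} (?T (1 + int m)) (?S (int m)) id ?z)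
    = one (homology_group (int m) (?T (int m)))"
    by (simp add: kernel_def)
  have "group_hom (homology_group (int m) (?T (int m))) (relative_homology_group (int m) (?T (int m)) (?S (int m - 1)))
     (hom_induced (int m) (?T (int m)) {} (?T (int m)) (?S (int m - 1)) id)"
    by (simp add: group_hom_def group_hom_axioms_def hom_induced_hom)
  note one = group_hom.hom_one[OF this]
  have ar: "int (Suc (Suc m)) = 2 + int m" "2 + int m - 1 = 1 + int m" "2 + int m - 2 = int m"
    "int (Suc m) = 1 + int m" "1 + int m - 1 = int m" "1 + int m - 2 = int m - 1"
    by simp_all
  have d2: "cell_boundary E p K (Suc (Suc m)) x
    = hom_induced (1 + int m) (?T (1 + int m)) {} (?T (1 + int m)) (?S (int m)) id ?z"
    unfolding cell_boundary_def hom_relboundary_def ar sub2 by simp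
  have d1: "cell_boundary E p K (Suc m) y = hom_induced (int m) (?T (int m)) {} (?T (int m)) (?S (int m - 1)) id
     (hom_boundary (1 + int m) (?T (1 + int m)) (?S (int m)) y)" for y
    unfolding cell_boundary_def hom_relboundary_def ar sub2 by simp
  show ?thesis
    unfolding Suc d2 d1 k one by (simp add: cell_group_def)
qed

lemma cellular_complex:
  fixes act :: "'g::group_add \<Rightarrow> 'b::topological_space \<Rightarrow> 'b"
  assumes cov: "universal_cover E p X" "y0 \<in> E" "\<phi> \<in> iso (fundamental_group X (p y0)) type_group"
    and act: "deck_action X E p y0 \<phi> act"
  shows "rmod_complex UNIV (cell_module E p K act) (cell_boundary E p K)"
proof -
  note ga = cell_group_action[OF cov act]
  show ?thesis
    unfolding rmod_complex_def
  proof (intro conjI allI ballI)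
    show "cell_boundary E p K 0 x = one (cell_module E p K act 0)" for x
      by (simp add: cell_boundary_def cell_module_simps)
    show "cell_boundary E p K n (cell_boundary E p K (Suc n) x) = one (cell_module E p K act (n - 1))"
      if "x \<in> carrier (cell_module E p K act (Suc n))" for n x
      using cell_boundary_boundary that unfolding cell_module_simps by blast
  qed (rule right_module_cell_module[OF ga] cell_boundary_hom[OF ga act])+
qed

section \<open>Jump ideals and the tropical bound\<close>

text \<open>
  The matrix is the base change of \<open>d h + h d\<close>, which has the form \<open>A * S + T * B\<close> for the two
  consecutive twisted differentials \<open>A\<close> and \<open>B\<close>.
\<close>

lemma det_homotopy_in_jump_ideal:
  fixes M :: "nat \<Rightarrow> ('m, 'g::group_add \<Rightarrow>\<^sub>0 int) rmodule" and d and c :: "nat \<Rightarrow> nat" and b and ab :: "'g \<Rightarrow> 'h::ab_group_add"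
  assumes \<sigma>: "GL_representation r \<sigma>" and ab: "\<And>x y. ab (x + y) = ab x + ab y"
  defines "a \<equiv> \<lambda>n i j. coordinates UNIV (M (n - 1)) (c (n - 1)) (b (n - 1)) (d n (b n j)) i"
  shows "Determinant.det (twist_mat ab \<sigma> r (c n) (c n) (\<lambda>i j.
      (\<Sum>l<c (Suc n). a (Suc n) i l * h n l j) + (if n = 0 then 0 else \<Sum>l<c (n - 1). h (n - 1) i l * a n l j)))
    \<in> jump_ideal M d c b ab r \<sigma> n"
proof -
  define A where "A = twisted_boundary M d c b ab r \<sigma> (Suc n)"
  define B where "B = twisted_boundary M d c b ab r \<sigma> n"
  have A: "A = twist_mat ab \<sigma> r (c n) (c (Suc n)) (a (Suc n))"
    by (simp add: A_def twisted_boundary_def twist_mat_def a_def)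
  let ?S = "twist_mat ab \<sigma> r (c (Suc n)) (c n) (h n)"
  obtain mB T where B: "B \<in> carrier_mat mB (r * c n)" and T: "T \<in> carrier_mat (r * c n) mB"
    and TB: "twist_mat ab \<sigma> r (c n) (c n) (\<lambda>i j. if n = 0 then 0 else \<Sum>l<c (n - 1). h (n - 1) i l * a n l j) = T * B"
  proof (cases n)
    case 0
    \<comment> \<open>The twisted boundary in degree \<open>0\<close> is a matrix without rows.\<close>
    show ?thesis
      by (rule that[of 0 "0\<^sub>m (r * c n) 0"])
        (auto simp: 0 B_def twisted_boundary_def twist_mat_def intro!: eq_matI)
  next
    case (Suc m)
    have B: "B = twist_mat ab \<sigma> r (c m) (c n) (a n)"
      by (simp add: Suc B_def twisted_boundary_def twist_mat_def a_def)
    show ?thesis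
    proof (rule that)
      show "B \<in> carrier_mat (r * c m) (r * c n)" by (simp add: B)
      show "twist_mat ab \<sigma> r (c n) (c n) (\<lambda>i j. if n = 0 then 0 else \<Sum>l<c (n - 1). h (n - 1) i l * a n l j)
          = twist_mat ab \<sigma> r (c n) (c m) (h m) * B"
        unfolding B twist_mat_mult[where r=r and \<sigma>=\<sigma> and ab=ab, OF \<sigma> ab] by (simp add: Suc)
    qed simp
  qed
  have "Determinant.det (A * ?S + T * B) \<in> ideal_generated (minors (r * c n)
    (four_block_mat A (0\<^sub>m (dim_row A) (dim_col B)) (0\<^sub>m (dim_row B) (dim_col A)) B))"
    by (rule det_in_block_minor_ideal[where nA = "r * c (Suc n)", OF _ B _ T]) (simp_all add: A)
  then show ?thesis
    unfolding twist_mat_add TB twist_mat_mult[where r=r and \<sigma>=\<sigma> and ab=ab, OF \<sigma> ab, symmetric]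
    by (simp add: jump_ideal_def A_def[symmetric] B_def[symmetric] A[symmetric] Let_def)
qed

lemma finite_type_not_in_Trop:
  fixes M :: "nat \<Rightarrow> ('m, 'g::group_add \<Rightarrow>\<^sub>0 int) rmodule" and d and c :: "nat \<Rightarrow> nat" and b and ab :: "'g \<Rightarrow> 'h::ab_group_add"
  assumes M: "rmod_complex UNIV M d" and b: "\<And>n. rmodule_basis UNIV (M n) (c n) (b n)"
    and \<sigma>: "GL_representation r \<sigma>" and ab: "\<And>x y. ab (x + y) = ab x + ab y"
    and \<xi>: "\<xi> \<in> characters" and ne: "\<xi> \<circ> ab \<noteq> (\<lambda>_. 0)"
    and ft: "finite_type (nonneg_group_ring (\<xi> \<circ> ab)) q M d"
  shows "\<xi> \<notin> Trop (jump_ideal_le M d c b ab r \<sigma> q)"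
proof -
  have \<xi>ab: "\<xi> \<circ> ab \<in> characters" using \<xi> by (simp add: characters_def ab)
  from ne obtain g where "(\<xi> \<circ> ab) g \<noteq> 0" by (auto simp: fun_eq_iff)
  then obtain t where t: "0 < (\<xi> \<circ> ab) t"
    using character_uminus[OF \<xi>ab, of g] by (metis linorder_neqE_linordered_idom neg_0_less_iff_less)
  define a where "a n i j = coordinates UNIV (M (n - 1)) (c (n - 1)) (b (n - 1)) (d n (b n j)) i" for n i j
  obtain h where h: "\<forall>n\<le>q. \<forall>i<c n. \<forall>j<c n.
    (\<Sum>l<c (Suc n). a (Suc n) i l * h n l j) +
    (if n = 0 then 0 else \<Sum>l<c (n - 1). h (n - 1) i l * a n l j) - (if i = j then 1 else 0)
      \<in> positive_part (\<xi> \<circ> ab)"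
    using almost_contraction[OF M b \<xi>ab t ft] unfolding a_def by blast
  define F where "F n = Determinant.det (twist_mat ab \<sigma> r (c n) (c n) (\<lambda>i j.
      (\<Sum>l<c (Suc n). a (Suc n) i l * h n l j) + (if n = 0 then 0 else \<Sum>l<c (n - 1). h (n - 1) i l * a n l j)))" for n
  have pos: "F n - 1 \<in> positive_part \<xi>" if "n \<le> q" for n
    unfolding F_def using h that by (intro twist_mat_unipotent[OF \<sigma> ab \<xi>]) blast
  have F: "F n \<in> jump_ideal M d c b ab r \<sigma> n" for n
    unfolding F_def a_def by (rule det_homotopy_in_jump_ideal[OF \<sigma> ab])
  have "prod F {..q} \<in> jump_ideal M d c b ab r \<sigma> n" if n: "n \<le> q" for n
  proof -
    have "prod F {..q} = prod F ({..q} - {n}) * F n"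
      using n by (subst prod.remove[of _ n]) (auto simp: mult.commute)
    then show ?thesis
      using F[of n] unfolding jump_ideal_def
      by (simp add: Modules.module.span_scale[OF module_mult_self])
  qed
  then have "prod F {..q} \<in> jump_ideal_le M d c b ab r \<sigma> q"
    by (simp add: jump_ideal_le_def)
  then show ?thesis
    by (rule unipotent_not_in_Trop) (use pos in \<open>auto intro!: unipotent_prod[OF \<xi>]\<close>)
qed

theorem corollary1p1:
  fixes X :: "'a::topological_space set" and K :: "nat \<Rightarrow> 'a set set"
    and E :: "'b::topological_space set" and p :: "'b \<Rightarrow> 'a" and y0 :: 'b
    and \<phi> :: "(real \<Rightarrow> 'a) set \<Rightarrow> 'g::group_add" and act :: "'g \<Rightarrow> 'b \<Rightarrow> 'b"
    and ab :: "'g \<Rightarrow> 'h::ab_group_add"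
    and b :: "nat \<Rightarrow> nat \<Rightarrow> 'b chain set"
    and r q :: nat and \<sigma> :: "'g \<Rightarrow> int mat"
  assumes "finite_CW_complex X K" and "connected X" and "H1_nonzero (top_of_set X)"
    and "universal_cover E p X" and "y0 \<in> E"
    and "\<phi> \<in> iso (fundamental_group X (p y0)) type_group"
    and "deck_action X E p y0 \<phi> act"
    and "abelianization ab"
    and "\<And>n. rmodule_basis UNIV (cell_module E p K act n) (card (K n)) (b n)"
    and "q \<ge> 1"
    and "GL_representation r \<sigma>"
  shows "BNSR q E p K act \<subseteq>
    rays characters -
    rays ((\<lambda>\<xi>. \<xi> \<circ> ab) ` Trop (jump_ideal_le (cell_module E p K act) (cell_boundary E p K)
            (\<lambda>n. card (K n)) b ab r \<sigma> q))"
proof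
  note complex = cellular_complex[OF assms(4-7)]
  have ab: "ab (x + y) = ab x + ab y" for x y
    using assms(8) by (auto simp: abelianization_def epi_def hom_def type_group_def)
  let ?J = "jump_ideal_le (cell_module E p K act) (cell_boundary E p K) (\<lambda>n. card (K n)) b ab r \<sigma> q"
  fix \<rho> assume "\<rho> \<in> BNSR q E p K act"
  then obtain \<psi> where \<psi>: "\<psi> \<in> characters" "\<psi> \<noteq> (\<lambda>_. 0)" "\<rho> = ray_rel `` {\<psi>}"
    and ft: "finite_type (nonneg_group_ring \<psi>) q (cell_module E p K act) (cell_boundary E p K)"
    by (auto simp: BNSR_def rays_def elim!: quotientE)
  have "\<rho> \<in> rays characters"
    unfolding rays_def \<psi>(3) using \<psi>(1,2) by (intro quotientI) simp
  moreover have "\<rho> \<notin> rays ((\<lambda>\<xi>. \<xi> \<circ> ab) ` Trop ?J)"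
  proof
    assume "\<rho> \<in> rays ((\<lambda>\<xi>. \<xi> \<circ> ab) ` Trop ?J)"
    then obtain \<xi> where \<xi>: "\<xi> \<in> Trop ?J" "\<xi> \<circ> ab \<noteq> (\<lambda>_. 0)" "\<rho> = ray_rel `` {\<xi> \<circ> ab}"
      by (auto simp: rays_def elim!: quotientE)
    have \<xi>c: "\<xi> \<in> characters" using \<xi>(1) by (simp add: Trop_def)
    then have "\<xi> \<circ> ab \<in> characters" by (simp add: characters_def ab)
    then have "(\<xi> \<circ> ab, \<xi> \<circ> ab) \<in> ray_rel"
      using \<xi>(2) by (auto simp: ray_rel_def intro!: exI[of _ "1::real"])
    then have "(\<psi>, \<xi> \<circ> ab) \<in> ray_rel" using \<psi>(3) \<xi>(3) by blast
    then obtain k where k: "k > 0" "\<xi> \<circ> ab = (\<lambda>g. k * \<psi> g)" by (auto simp: ray_rel_def)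
    \<comment> \<open>Characters on the same ray have the same nonnegative ring, so finite type passes to \<open>\<xi> \<circ> ab\<close>.\<close>
    then have "nonneg_group_ring (\<xi> \<circ> ab) = nonneg_group_ring \<psi>"
      by (simp add: nonneg_group_ring_def zero_le_mult_iff)
    with ft have "\<xi> \<notin> Trop ?J"
      by (intro finite_type_not_in_Trop[OF complex assms(9) assms(11) ab \<xi>c \<xi>(2)]) simp
    with \<xi>(1) show False by simp
  qed
  ultimately show "\<rho> \<in> rays characters - rays ((\<lambda>\<xi>. \<xi> \<circ> ab) ` Trop ?J)" by blast
qed

end
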